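(* Let $S$ be a unital semigroup with involution $\mathfrak{I}$, let $\phi$ be an action of $S$ on a set $X$, and let $\alpha:S\times X\to\mathbb{C}\setminus\{0\}$ satisfy $$\alpha(ab,x)\overline{\alpha(ab,y)}=\alpha(a,\phi(b,x))\overline{\alpha(a,\phi(b,y))}\,\alpha(b,x)\overline{\alpha(b,y)}\quad (a,b\in S,\ x,y\in X)$$ and $\alpha(a\mathfrak{I}(a),x)=1$ for all $a\in S$, $x\in X$. Let $\mathcal{H}$ be a Kreĭn space and let $K$ be an $\mathcal{L}(\mathcal{H})$-valued $\phi$-invariant hermitian kernel on $X$. The following assertions are equivalent: (1) There exists $L\in\mathcal{B}_\phi^+(X,\mathcal{H})$ such that $-L\le K\le L$ and $L$ is $\phi$-invariant. (2) $K$ has a projectively invariant Kolmogorov decomposition $(V;\mathcal{K})$ such that the associated projective representation is fundamentally reducible. (3) $K=K_+-K_-$ for two disjoint positive definite kernels such that $K_++K_-\in\mathcal{B}_\phi^+(X,\mathcal{H})$ and both $K_\pm$ are $\phi$-invariant.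
   Context: A Kreĭn space is an indefinite inner product space $(\mathcal{H},[\cdot,\cdot])$ for which there is a positive inner product $\langle\cdot,\cdot\rangle$ turning $\mathcal{H}$ into a Hilbert space, and an operator $J=J^*=J^{-1}$ on $\mathcal{H}$ (a fundamental symmetry) with $[\xi,\eta]=\langle J\xi,\eta\rangle$. $\mathcal{L}(\mathcal{H},\mathcal{K})$ is the set of bounded linear operators; $T^\sharp$ is the adjoint with respect to the indefinite inner products. Kernels. A hermitian kernel on a set $X$ is a map $K:X\times X\to\mathcal{L}(\mathcal{H})$ with $K(x,y)=K(y,x)^\sharp$. $\mathcal{F}_0(X,\mathcal{H})$ is the vector space of finitely supported functions $X\to\mathcal{H}$, with inner product $[f,g]_K=\sum_{x,y\in X}[K(x,y)f(y),g(x)]_{\mathcal{H}}$. $K$ is positive definite if $[f,f]_K\ge0$ for all $f$. $A\le B$ means $[f,f]_A\le[f,f]_B$ for all $f\in\mathcal{F}_0(X,\mathcal{H})$. Two positive definite kernels $A,B$ are disjoint if every positive definite kernel $P$ with $P\le A$ and $P\le B$ is $0$. A Kolmogorov decomposition of $K$ is a pair $(V;\mathcal{K})$ with $\mathcal{K}$ a Kreĭn space and $V(x)\in\mathcal{L}(\mathcal{H},\mathcal{K})$, $x\in X$, such that $K(x,y)=V(x)^\sharp V(y)$ and the linear span of $\bigcup_xV(x)\mathcal{H}$ is dense in $\mathcal{K}$. Action and cocycle. An action of $S$ (unit $e$) on $X$ is a map $\phi:S\times X\to X$ with $\phi(a,\phi(b,x))=\phi(ab,x)$ and $\phi(e,x)=x$.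 An involution satisfies $\mathfrak{I}(\mathfrak{I}(a))=a$, $\mathfrak{I}(ab)=\mathfrak{I}(b)\mathfrak{I}(a)$. With $\alpha$ as in the claim, $\sigma(a,b)=\alpha(a,\phi(b,x))^{-1}\alpha(b,x)^{-1}\alpha(ab,x)$, which is independent of $x$ and has modulus one. $\phi$-bounded kernels. For $\xi\in\mathcal{H}$, $x\in X$, $\xi_x\in\mathcal{F}_0(X,\mathcal{H})$ equals $\xi$ at $x$ and $0$ elsewhere. For $a\in S$, $\psi_a$ is the linear map on $\mathcal{F}_0(X,\mathcal{H})$ with $\psi_a(\xi_x)=\alpha(a,x)^{-1}\xi_{\phi(a,x)}$. A positive definite kernel $L$ is $\phi$-bounded if every $\psi_a$ is bounded with respect to the seminorm $[\cdot,\cdot]_L^{1/2}$; $\mathcal{B}_\phi^+(X,\mathcal{H})$ is the set of positive definite $\phi$-bounded $\mathcal{L}(\mathcal{H})$-valued kernels on $X$. Invariance. A hermitian kernel $K$ is $\phi$-invariant if $K(x,\phi(a,y))=\overline{\alpha(a,\phi(\mathfrak{I}(a),x))}\,\alpha(a,y)\,K(\phi(\mathfrak{I}(a),x),y)$ for all $x,y\in X$, $a\in S$. A projective representation of $S$ on $\mathcal{K}$ is a map $U:S\to\mathcal{L}(\mathcal{K})$ with $U(a)U(b)=\sigma(a,b)U(ab)$. A Kolmogorov decomposition $(V;\mathcal{K})$ of $K$ is projectively invariant if there is a projective representation $U$ of $S$ on $\mathcal{K}$ (the associated projective representation) with $V(\phi(a,x))=\alpha(a,x)U(a)V(x)$ for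 all $x\in X$, $a\in S$. $U$ is fundamentally reducible if there exists a fundamental symmetry $J$ on $\mathcal{K}$ with $U(a)J=JU(a)$ for all $a\in S$. *)

theory Defs
  imports "HOL-Analysis.Analysis" "HOL-Library.Poly_Mapping" "HOL-Library.Function_Algebras"
begin

section \<open>Krein spaces\<close>

text \<open>
  A space consists of a linear subspace \<open>vecs E\<close> of an ambient complex vector space, which is the
  type \<^typ>\<open>'a\<close> with its own addition and the scalar multiplication \<open>scale E\<close>, together with an
  inner product \<open>ip E\<close>. The carrier is explicit because Krein spaces have to be quantified over
  existentially. Values of operators and inner products outside the carriers are irrelevant.
  Inner products are linear in the first argument.
\<close>

record 'a ispace =
  vecs :: "'a set"
  scale :: "complex \<Rightarrow> 'a \<Rightarrow> 'a"
  ip :: "'a \<Rightarrow> 'a \<Rightarrow> complex"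

definition inner_product_space :: "'a::ab_group_add ispace \<Rightarrow> bool" where
  "inner_product_space E \<longleftrightarrow>
     vector_space (scale E) \<and> module.subspace (scale E) (vecs E) \<and>
     (\<forall>x\<in>vecs E. \<forall>y\<in>vecs E. \<forall>z\<in>vecs E. ip E (x + y) z = ip E x z + ip E y z) \<and>
     (\<forall>c. \<forall>x\<in>vecs E. \<forall>y\<in>vecs E. ip E (scale E c x) y = c * ip E x y) \<and>
     (\<forall>x\<in>vecs E. \<forall>y\<in>vecs E. ip E y x = cnj (ip E x y))"

definition inorm :: "'a ispace \<Rightarrow> 'a \<Rightarrow> real" where
  "inorm E x = sqrt (Re (ip E x x))"

text \<open>The distance is cut off outside the carrier since \<^locale>\<open>Metric_space\<close> demands symmetry and
  nonnegativity on the whole type.\<close>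

definition idist :: "'a::ab_group_add ispace \<Rightarrow> 'a \<Rightarrow> 'a \<Rightarrow> real" where
  "idist E x y = (if x \<in> vecs E \<and> y \<in> vecs E then inorm E (x - y) else 0)"

definition hilbert_space :: "'a::ab_group_add ispace \<Rightarrow> bool" where
  "hilbert_space E \<longleftrightarrow>
     inner_product_space E \<and> (\<forall>x\<in>vecs E. x \<noteq> 0 \<longrightarrow> 0 < Re (ip E x x)) \<and>
     Metric_space.mcomplete (vecs E) (idist E)"

definition linear_on :: "'a::ab_group_add ispace \<Rightarrow> 'b::ab_group_add ispace \<Rightarrow> ('a \<Rightarrow> 'b) \<Rightarrow> bool" where
  "linear_on E F T \<longleftrightarrow>
     (\<forall>x\<in>vecs E. T x \<in> vecs F) \<and>
     (\<forall>x\<in>vecs E. \<forall>y\<in>vecs E. T (x + y) = T x + T y) \<and>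
     (\<forall>c. \<forall>x\<in>vecs E. T (scale E c x) = scale F c (T x))"

text \<open>\<open>g\<close> is a Hilbert space inner product on \<open>E\<close>, and \<open>J\<close> satisfies \<open>J = J\<^sup>* = J\<^sup>-\<^sup>1\<close> with respect
  to \<open>g\<close> (boundedness is automatic, as \<open>J\<close> is isometric) and \<open>[x, y] = g (J x) y\<close>.\<close>

definition fundamental_pair :: "'a::ab_group_add ispace \<Rightarrow> ('a \<Rightarrow> 'a \<Rightarrow> complex) \<Rightarrow> ('a \<Rightarrow> 'a) \<Rightarrow> bool" where
  "fundamental_pair E g J \<longleftrightarrow>
     hilbert_space (E\<lparr>ip := g\<rparr>) \<and> linear_on E E J \<and>
     (\<forall>x\<in>vecs E. J (J x) = x) \<and>
     (\<forall>x\<in>vecs E. \<forall>y\<in>vecs E. g (J x) y = g x (J y)) \<and>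
     (\<forall>x\<in>vecs E. \<forall>y\<in>vecs E. ip E x y = g (J x) y)"

definition fundamental_symmetry :: "'a::ab_group_add ispace \<Rightarrow> ('a \<Rightarrow> 'a) \<Rightarrow> bool" where
  "fundamental_symmetry E J \<longleftrightarrow> (\<exists>g. fundamental_pair E g J)"

definition hilbert_structure :: "'a::ab_group_add ispace \<Rightarrow> ('a \<Rightarrow> 'a \<Rightarrow> complex) \<Rightarrow> bool" where
  "hilbert_structure E g \<longleftrightarrow> (\<exists>J. fundamental_pair E g J)"

definition krein_space :: "'a::ab_group_add ispace \<Rightarrow> bool" where
  "krein_space E \<longleftrightarrow> inner_product_space E \<and> (\<exists>g. hilbert_structure E g)"

text \<open>All Hilbert structures of a Krein space induce equivalent norms, so boundedness and density do
  not depend on the choice of \<open>g\<close> and \<open>h\<close>.\<close>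

definition bounded_operator :: "'a::ab_group_add ispace \<Rightarrow> 'b::ab_group_add ispace \<Rightarrow> ('a \<Rightarrow> 'b) \<Rightarrow> bool" where
  "bounded_operator E F T \<longleftrightarrow>
     linear_on E F T \<and>
     (\<exists>g h c. hilbert_structure E g \<and> hilbert_structure F h \<and>
        (\<forall>x\<in>vecs E. inorm (F\<lparr>ip := h\<rparr>) (T x) \<le> c * inorm (E\<lparr>ip := g\<rparr>) x))"

definition dense_in :: "'a::ab_group_add ispace \<Rightarrow> 'a set \<Rightarrow> bool" where
  "dense_in E A \<longleftrightarrow>
     (\<exists>g. hilbert_structure E g \<and>
        Metric_space.mtopology (vecs E) (idist (E\<lparr>ip := g\<rparr>)) closure_of A = vecs E)"

definition adj :: "'a ispace \<Rightarrow> 'b ispace \<Rightarrow> ('a \<Rightarrow> 'b) \<Rightarrow> 'b \<Rightarrow> 'a" where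
  "adj E F T y = (THE z. z \<in> vecs E \<and> (\<forall>x\<in>vecs E. ip F (T x) y = ip E x z))"


section \<open>Kernels\<close>

type_synonym ('x, 'h) kernel = "'x \<Rightarrow> 'x \<Rightarrow> 'h \<Rightarrow> 'h"

definition hermitian_kernel :: "'h::ab_group_add ispace \<Rightarrow> ('x, 'h) kernel \<Rightarrow> bool" where
  "hermitian_kernel H K \<longleftrightarrow>
     (\<forall>x y. bounded_operator H H (K x y)) \<and>
     (\<forall>x y. \<forall>\<xi>\<in>vecs H. K x y \<xi> = adj H H (K y x) \<xi>)"

definition finsupp :: "'h::ab_group_add ispace \<Rightarrow> ('x \<Rightarrow>\<^sub>0 'h) set" where
  "finsupp H = {f. range (Poly_Mapping.lookup f) \<subseteq> vecs H}"

definition kernel_ip ::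
  "'h::ab_group_add ispace \<Rightarrow> ('x, 'h) kernel \<Rightarrow> ('x \<Rightarrow>\<^sub>0 'h) \<Rightarrow> ('x \<Rightarrow>\<^sub>0 'h) \<Rightarrow> complex" where
  "kernel_ip H K f g =
     (\<Sum>x\<in>Poly_Mapping.keys g. \<Sum>y\<in>Poly_Mapping.keys f.
        ip H (K x y (Poly_Mapping.lookup f y)) (Poly_Mapping.lookup g x))"

text \<open>For hermitian kernels \<open>[f, f]\<^sub>K\<close> is real, so its real part loses nothing.\<close>

definition pd_kernel :: "'h::ab_group_add ispace \<Rightarrow> ('x, 'h) kernel \<Rightarrow> bool" where
  "pd_kernel H K \<longleftrightarrow> hermitian_kernel H K \<and> (\<forall>f\<in>finsupp H. 0 \<le> Re (kernel_ip H K f f))"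

definition kernel_le :: "'h::ab_group_add ispace \<Rightarrow> ('x, 'h) kernel \<Rightarrow> ('x, 'h) kernel \<Rightarrow> bool" where
  "kernel_le H A B \<longleftrightarrow> (\<forall>f\<in>finsupp H. Re (kernel_ip H A f f) \<le> Re (kernel_ip H B f f))"

definition disjoint_kernels :: "'h::ab_group_add ispace \<Rightarrow> ('x, 'h) kernel \<Rightarrow> ('x, 'h) kernel \<Rightarrow> bool" where
  "disjoint_kernels H A B \<longleftrightarrow>
     (\<forall>P. pd_kernel H P \<and> kernel_le H P A \<and> kernel_le H P B \<longrightarrow>
        (\<forall>x y. \<forall>\<xi>\<in>vecs H. P x y \<xi> = 0))"

definition kolmogorov_decomposition ::
  "'h::ab_group_add ispace \<Rightarrow> ('x, 'h) kernel \<Rightarrow> 'k::ab_group_add ispace \<Rightarrow> ('x \<Rightarrow> 'h \<Rightarrow> 'k) \<Rightarrow> bool" where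
  "kolmogorov_decomposition H K E V \<longleftrightarrow>
     krein_space E \<and>
     (\<forall>x. bounded_operator H E (V x)) \<and>
     (\<forall>x y. \<forall>\<xi>\<in>vecs H. K x y \<xi> = adj H E (V x) (V y \<xi>)) \<and>
     dense_in E (module.span (scale E) (\<Union>x. V x ` vecs H))"


section \<open>Actions, invariance and projective representations\<close>

definition psi ::
  "'h::ab_group_add ispace \<Rightarrow> ('s \<Rightarrow> 'x \<Rightarrow> 'x) \<Rightarrow> ('s \<Rightarrow> 'x \<Rightarrow> complex) \<Rightarrow> 's \<Rightarrow> ('x \<Rightarrow>\<^sub>0 'h) \<Rightarrow> ('x \<Rightarrow>\<^sub>0 'h)" where
  "psi H \<phi> \<alpha> a f =
     (\<Sum>x\<in>Poly_Mapping.keys f.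
        Poly_Mapping.single (\<phi> a x) (scale H (inverse (\<alpha> a x)) (Poly_Mapping.lookup f x)))"

definition phi_bounded_pd_kernels ::
  "'h::ab_group_add ispace \<Rightarrow> ('s \<Rightarrow> 'x \<Rightarrow> 'x) \<Rightarrow> ('s \<Rightarrow> 'x \<Rightarrow> complex) \<Rightarrow> ('x, 'h) kernel set" where
  "phi_bounded_pd_kernels H \<phi> \<alpha> =
     {L. pd_kernel H L \<and>
         (\<forall>a. \<exists>c. \<forall>f\<in>finsupp H.
            sqrt (Re (kernel_ip H L (psi H \<phi> \<alpha> a f) (psi H \<phi> \<alpha> a f)))
              \<le> c * sqrt (Re (kernel_ip H L f f)))}"

definition phi_invariant ::
  "'h::ab_group_add ispace \<Rightarrow> ('s \<Rightarrow> 's) \<Rightarrow> ('s \<Rightarrow> 'x \<Rightarrow> 'x) \<Rightarrow> ('s \<Rightarrow> 'x \<Rightarrow> complex) \<Rightarrow>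
     ('x, 'h) kernel \<Rightarrow> bool" where
  "phi_invariant H \<II> \<phi> \<alpha> K \<longleftrightarrow>
     (\<forall>x y a. \<forall>\<xi>\<in>vecs H.
        K x (\<phi> a y) \<xi> = scale H (cnj (\<alpha> a (\<phi> (\<II> a) x)) * \<alpha> a y) (K (\<phi> (\<II> a) x) y \<xi>))"

text \<open>The common value, for all \<open>x\<close>, of \<open>\<alpha>(a, \<phi>(b, x))\<^sup>-\<^sup>1 \<alpha>(b, x)\<^sup>-\<^sup>1 \<alpha>(ab, x)\<close>.\<close>

definition sigma :: "('s::monoid_mult \<Rightarrow> 'x \<Rightarrow> 'x) \<Rightarrow> ('s \<Rightarrow> 'x \<Rightarrow> complex) \<Rightarrow> 's \<Rightarrow> 's \<Rightarrow> complex" where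
  "sigma \<phi> \<alpha> a b =
     (THE c. \<forall>x. c = inverse (\<alpha> a (\<phi> b x)) * inverse (\<alpha> b x) * \<alpha> (a * b) x)"

definition projective_representation ::
  "('s::monoid_mult \<Rightarrow> 'x \<Rightarrow> 'x) \<Rightarrow> ('s \<Rightarrow> 'x \<Rightarrow> complex) \<Rightarrow> 'k::ab_group_add ispace \<Rightarrow>
     ('s \<Rightarrow> 'k \<Rightarrow> 'k) \<Rightarrow> bool" where
  "projective_representation \<phi> \<alpha> E U \<longleftrightarrow>
     (\<forall>a. bounded_operator E E (U a)) \<and>
     (\<forall>a b. \<forall>k\<in>vecs E. U a (U b k) = scale E (sigma \<phi> \<alpha> a b) (U (a * b) k))"

definition associated_representation ::
  "'h::ab_group_add ispace \<Rightarrow> ('s::monoid_mult \<Rightarrow> 'x \<Rightarrow> 'x) \<Rightarrow> ('s \<Rightarrow> 'x \<Rightarrow> complex) \<Rightarrow>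
     'k::ab_group_add ispace \<Rightarrow> ('x \<Rightarrow> 'h \<Rightarrow> 'k) \<Rightarrow> ('s \<Rightarrow> 'k \<Rightarrow> 'k) \<Rightarrow> bool" where
  "associated_representation H \<phi> \<alpha> E V U \<longleftrightarrow>
     projective_representation \<phi> \<alpha> E U \<and>
     (\<forall>x a. \<forall>\<xi>\<in>vecs H. V (\<phi> a x) \<xi> = scale E (\<alpha> a x) (U a (V x \<xi>)))"

definition fundamentally_reducible :: "'k::ab_group_add ispace \<Rightarrow> ('s \<Rightarrow> 'k \<Rightarrow> 'k) \<Rightarrow> bool" where
  "fundamentally_reducible E U \<longleftrightarrow>
     (\<exists>J. fundamental_symmetry E J \<and> (\<forall>a. \<forall>k\<in>vecs E. U a (J k) = J (U a k)))"

text \<open>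
  Existence of a projectively invariant Kolmogorov decomposition with fundamentally reducible
  associated representation, on a Krein space whose vectors have the type passed as first argument.
  HOL cannot quantify over types inside a formula, but the type \<^typ>\<open>'x \<Rightarrow> 'h\<close> is always large enough: by
  density and nondegeneracy, \<open>k \<mapsto> (\<lambda>x. V(x)\<^sup>\<sharp> k)\<close> embeds the Krein space of any Kolmogorov
  decomposition linearly into \<^typ>\<open>'x \<Rightarrow> 'h\<close>.
\<close>

definition has_reducible_decomposition ::
  "'k::ab_group_add itself \<Rightarrow> 'h::ab_group_add ispace \<Rightarrow> ('s::monoid_mult \<Rightarrow> 'x \<Rightarrow> 'x) \<Rightarrow>
     ('s \<Rightarrow> 'x \<Rightarrow> complex) \<Rightarrow> ('x, 'h) kernel \<Rightarrow> bool" where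
  "has_reducible_decomposition (_ :: 'k itself) H \<phi> \<alpha> K \<longleftrightarrow>
     (\<exists>(E :: 'k ispace) V U.
        kolmogorov_decomposition H K E V \<and>
        associated_representation H \<phi> \<alpha> E V U \<and>
        fundamentally_reducible E U)"

end

theory Submission
  imports Defs
begin

text \<open>
  The difficult implication is from (1) to (2). The forms of \<open>L\<close> and \<open>K\<close> on the finitely supported
  functions are regarded as forms \<open>p\<close> and \<open>k\<close> with \<open>\<bar>k(f, f)\<bar> \<le> p(f, f)\<close>, and \<open>p\<close> is improved by the Newton
  iteration for the modulus: \<open>p\<close> is replaced by \<open>(p + q) / 2\<close>, where \<open>q(f, g)\<close> is the inner product of the
  functionals \<open>k(f, \<cdot>)\<close> and \<open>k(g, \<cdot>)\<close> in the dual of \<open>p\<close>. This preserves domination of \<open>k\<close>, the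
  bounds of the operators \<open>\<psi>\<^sub>a\<close> and the existence of their adjoints. The forms \<open>p\<^sub>n\<close> decrease to a form
  \<open>p\<close>, so the dual norms \<open>q\<^sub>n\<close> increase and stay below \<open>q\<close>; since \<open>q\<^sub>n = 2 p\<^sub>n\<^sub>+\<^sub>1 - p\<^sub>n\<close> tends to \<open>p\<close> and
  \<open>q \<le> p\<close>, it follows that \<open>q = p\<close>. Hence \<open>p(f, \<cdot>) \<mapsto> k(f, \<cdot>)\<close> extends to a symmetry of the
  dual of \<open>p\<close>. It commutes with the operators induced by the \<open>\<psi>\<^sub>a\<close> and makes the dual of \<open>p\<close> a
  Krein space carrying the decomposition.

  From (2) to (3), \<open>K\<^sub>\<plusminus> = \<plusminus>V\<^sup>\<sharp> ((1 \<plusminus> J) / 2) V\<close>; a kernel below both is dominated by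
  \<open>\<parallel>P\<^sub>+ k\<parallel>\<^sup>2\<close> and \<open>\<parallel>P\<^sub>- k\<parallel>\<^sup>2\<close>, and density splits off the two components of \<open>k\<close>. From (3) to (1),
  \<open>L = K\<^sub>+ + K\<^sub>-\<close>.
\<close>

section \<open>Hermitian and positive forms on a carrier\<close>

text \<open>On the completion of \<open>L\<close> the kernel \<open>K\<close> would be given by a
  selfadjoint contraction A, but A may have a kernel or no bounded inverse, so that completion need
  not be a Krein space for \<open>K\<close>. Passing to the form of |A| turns A into a symmetry, the
  sign of A, and since A commutes with the operators induced by the \<psi>, so does its sign. The
  iteration reaches |A| without functional calculus or square roots of operators. Working with forms
  also spares quotients and completions: the bounded conjugate-linear functionals of a merely
  semidefinite form already constitute a Hilbert space. The price is that the vectors of the Krein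
  space become functionals on finitely supported functions, while the statement asks for functions
  on X; evaluation on one-point functions supplies the injection. A second obstacle lies in the
  definitions: boundedness and density refer to some Hilbert structure, possibly a different one
  each time, and the uniform boundedness principle is what makes all these norms equivalent.\<close>

lemma le_mult_of_weighted_mean:
  fixes x a b :: real
  assumes "\<And>t. t > 0 \<Longrightarrow> 2 * x \<le> t * a\<^sup>2 + b\<^sup>2 / t" "0 \<le> a" "0 \<le> b"
  shows "x \<le> a * b"
proof -
  have *: "x \<le> (a + e) * (b + e)" if "e > 0" for e
  proof -
    \<comment> \<open>The minimizer of the weighted mean for a + e and b + e. The shift by
      \<open>e\<close> keeps it defined and positive if \<open>a\<close> or \<open>b\<close>
      vanishes, and is removed by letting \<open>e\<close> tend to 0.\<close>
    define t where "t = (b + e) / (a + e)"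
    have t: "t > 0" using that assms by (simp add: t_def)
    have "a\<^sup>2 \<le> (a + e)\<^sup>2" "b\<^sup>2 \<le> (b + e)\<^sup>2" using that assms by (auto intro!: power_mono)
    then have "2 * x \<le> t * (a + e)\<^sup>2 + (b + e)\<^sup>2 / t"
      using assms(1)[OF t] t by (smt (verit) divide_right_mono mult_left_mono)
    also have "t * (a + e)\<^sup>2 = (a + e) * (b + e)" using that assms by (simp add: t_def power2_eq_square)
    also have "(b + e)\<^sup>2 / t = (a + e) * (b + e)" using that assms by (simp add: t_def power2_eq_square)
    finally show ?thesis by simp
  qed
  have "((\<lambda>e. (a + e) * (b + e)) \<longlongrightarrow> (a + 0) * (b + 0)) (at_right 0)"
    by (intro tendsto_intros)
  then show ?thesis
    using tendsto_lowerbound[of "\<lambda>e. (a + e) * (b + e)" "a * b" "at_right 0" x] *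
    by (simp add: eventually_at_right_less eventually_at_filter)
qed

text \<open>\<open>W\<close> is only a subspace of the type, so that one locale covers kernel forms,
  which live on \<open>finsupp H\<close>, as well as the definite and indefinite products of spaces
  with an explicit carrier.\<close>

locale hform = vector_space s for s :: "complex \<Rightarrow> 'w::ab_group_add \<Rightarrow> 'w" +
  fixes W :: "'w set" and p :: "'w \<Rightarrow> 'w \<Rightarrow> complex"
  assumes subspace_W: "subspace W"
    and add_left: "\<lbrakk>x \<in> W; y \<in> W; z \<in> W\<rbrakk> \<Longrightarrow> p (x + y) z = p x z + p y z"
    and scale_left: "\<lbrakk>x \<in> W; y \<in> W\<rbrakk> \<Longrightarrow> p (s c x) y = c * p x y"
    and herm: "\<lbrakk>x \<in> W; y \<in> W\<rbrakk> \<Longrightarrow> p y x = cnj (p x y)"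
begin

lemma W_intros [simp, intro]:
  "0 \<in> W"
  "\<lbrakk>x \<in> W; y \<in> W\<rbrakk> \<Longrightarrow> x + y \<in> W"
  "\<lbrakk>x \<in> W; y \<in> W\<rbrakk> \<Longrightarrow> x - y \<in> W"
  "x \<in> W \<Longrightarrow> - x \<in> W"
  "x \<in> W \<Longrightarrow> s c x \<in> W"
  using subspace_W by (auto simp: subspace_0 subspace_add subspace_diff subspace_neg subspace_scale)

lemma W_sum [intro]: "(\<And>i. i \<in> A \<Longrightarrow> f i \<in> W) \<Longrightarrow> sum f A \<in> W"
  using subspace_W by (rule subspace_sum)

lemma minus_left: "\<lbrakk>x \<in> W; y \<in> W\<rbrakk> \<Longrightarrow> p (- x) y = - p x y"
  using scale_left[of x y "-1"] by simp

lemma zero_left [simp]: "y \<in> W \<Longrightarrow> p 0 y = 0"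
  using scale_left[of 0 y 0] by simp

lemma diff_left: "\<lbrakk>x \<in> W; y \<in> W; z \<in> W\<rbrakk> \<Longrightarrow> p (x - y) z = p x z - p y z"
  using add_left[of x "-y" z] by (simp add: minus_left)

lemma add_right: "\<lbrakk>x \<in> W; y \<in> W; z \<in> W\<rbrakk> \<Longrightarrow> p z (x + y) = p z x + p z y"
  using herm[of "x + y" z] herm[of x z] herm[of y z] by (simp add: add_left)

lemma scale_right: "\<lbrakk>x \<in> W; y \<in> W\<rbrakk> \<Longrightarrow> p x (s c y) = cnj c * p x y"
  using herm[of "s c y" x] herm[of y x] by (simp add: scale_left)

lemma minus_right: "\<lbrakk>x \<in> W; y \<in> W\<rbrakk> \<Longrightarrow> p x (- y) = - p x y"
  using scale_right[of x y "-1"] by simp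

lemma zero_right [simp]: "x \<in> W \<Longrightarrow> p x 0 = 0"
  using scale_right[of x 0 0] by simp

lemma diff_right: "\<lbrakk>x \<in> W; y \<in> W; z \<in> W\<rbrakk> \<Longrightarrow> p z (x - y) = p z x - p z y"
  using add_right[of x "-y" z] by (simp add: minus_right)

lemma sum_left: "\<lbrakk>\<And>i. i \<in> A \<Longrightarrow> f i \<in> W; z \<in> W\<rbrakk> \<Longrightarrow> p (sum f A) z = (\<Sum>i\<in>A. p (f i) z)"
  by (induction A rule: infinite_finite_induct) (auto simp: add_left W_sum)

lemma sum_right: "\<lbrakk>\<And>i. i \<in> A \<Longrightarrow> f i \<in> W; z \<in> W\<rbrakk> \<Longrightarrow> p z (sum f A) = (\<Sum>i\<in>A. p z (f i))"
  by (induction A rule: infinite_finite_induct) (auto simp: add_right W_sum)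

lemma Re_sym: "\<lbrakk>x \<in> W; y \<in> W\<rbrakk> \<Longrightarrow> Re (p x y) = Re (p y x)"
  using herm[of x y] by simp

lemma Im_diag: "x \<in> W \<Longrightarrow> Im (p x x) = 0"
  using herm[of x x] by (simp add: complex_eq_iff)

lemma diag: "x \<in> W \<Longrightarrow> p x x = of_real (Re (p x x))"
  using Im_diag[of x] by (simp add: complex_eq_iff)

lemma Re_diag_add:
  "\<lbrakk>x \<in> W; y \<in> W\<rbrakk> \<Longrightarrow> Re (p (x + y) (x + y)) = Re (p x x) + Re (p y y) + 2 * Re (p x y)"
  using Re_sym[of x y] by (simp add: add_left add_right)

lemma Re_diag_diff:
  "\<lbrakk>x \<in> W; y \<in> W\<rbrakk> \<Longrightarrow> Re (p (x - y) (x - y)) = Re (p x x) + Re (p y y) - 2 * Re (p x y)"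
  using Re_sym[of x y] by (simp add: diff_left diff_right)

lemma diag_scale: "x \<in> W \<Longrightarrow> p (s c x) (s c x) = (cmod c)\<^sup>2 * p x x"
  by (simp only: complex_norm_square) (simp add: scale_left scale_right)

lemma Re_diag_scale: "x \<in> W \<Longrightarrow> Re (p (s c x) (s c x)) = (cmod c)\<^sup>2 * Re (p x x)"
  by (simp add: diag_scale)

lemma polarization:
  assumes "x \<in> W" "y \<in> W"
  shows "4 * p x y = complex_of_real (Re (p (x + y) (x + y)) - Re (p (x - y) (x - y)))
    + \<i> * complex_of_real (Re (p (x + s \<i> y) (x + s \<i> y)) - Re (p (x - s \<i> y) (x - s \<i> y)))"
  using assms by (simp add: Re_diag_add Re_diag_diff scale_right complex_eq_iff)

end

text \<open>Polarization recovers both forms from their diagonals.\<close>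

lemma hform_eqI:
  assumes "hform s W p" "hform s W q" "\<And>x. x \<in> W \<Longrightarrow> Re (p x x) = Re (q x x)" "x \<in> W" "y \<in> W"
  shows "p x y = q x y"
proof -
  interpret p: hform s W p by fact
  interpret q: hform s W q by fact
  have "4 * p x y = 4 * q x y"
    using assms(3-) p.polarization[of x y] q.polarization[of x y] by auto
  then show ?thesis by simp
qed

locale psd_form = hform +
  assumes nonneg: "x \<in> W \<Longrightarrow> 0 \<le> Re (p x x)"
begin

definition nrm :: "'a \<Rightarrow> real" where "nrm x = sqrt (Re (p x x))"

lemma nrm_nonneg [simp]: "x \<in> W \<Longrightarrow> 0 \<le> nrm x" by (simp add: nrm_def nonneg)

lemma nrm_sq: "x \<in> W \<Longrightarrow> (nrm x)\<^sup>2 = Re (p x x)" by (simp add: nrm_def nonneg)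

text \<open>Polarization and the parallelogram law of \<open>p\<close> bound Re k(f, g) by the mean
  of p(f, f) and p(g, g); a phase and a weight \<open>t\<close> on \<open>f\<close> sharpen this to
  a product. For k = p it is the Cauchy-Schwarz inequality.\<close>

lemma form_bound:
  assumes k: "hform s W k" and dom: "\<And>f. f \<in> W \<Longrightarrow> \<bar>Re (k f f)\<bar> \<le> Re (p f f)"
    and f: "f \<in> W" and g: "g \<in> W"
  shows "cmod (k f g) \<le> nrm f * nrm g"
proof (rule le_mult_of_weighted_mean)
  interpret k: hform s W k by fact
  fix t :: real assume t: "t > 0"
  \<comment> \<open>The phase that makes k(u f, g) the real number |k(f, g)|; if the value is 0, any
    number of modulus one would do.\<close>
  define u where "u = (if k f g = 0 then 1 else cnj (k f g) / cmod (k f g))"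
  have u: "cmod u = 1" by (simp add: u_def norm_divide)
  have ku: "u * k f g = cmod (k f g)"
    by (simp add: u_def complex_norm_square[symmetric] mult.commute power2_eq_square)
  define h where "h = s (of_real t * u) f"
  have h: "h \<in> W" using f by (simp add: h_def)
  have "k h g = of_real (t * cmod (k f g))"
    using ku f g by (simp add: h_def k.scale_left mult.assoc)
  then have "4 * (t * cmod (k f g)) = Re (k (h + g) (h + g)) - Re (k (h - g) (h - g))"
    using h g by (simp add: k.Re_diag_add k.Re_diag_diff)
  also have "\<dots> \<le> Re (p (h + g) (h + g)) + Re (p (h - g) (h - g))"
    using dom[of "h + g"] dom[of "h - g"] h g by auto
  also have "\<dots> = 2 * (Re (p h h) + Re (p g g))"
    using h g by (simp add: Re_diag_add Re_diag_diff)
  also have "Re (p h h) = t\<^sup>2 * (nrm f)\<^sup>2"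
    using f t u by (simp add: h_def Re_diag_scale norm_mult power_mult_distrib nrm_sq)
  finally have "2 * (t * cmod (k f g)) \<le> t\<^sup>2 * (nrm f)\<^sup>2 + (nrm g)\<^sup>2" using g by (simp add: nrm_sq)
  then have "2 * (t * cmod (k f g)) / t \<le> (t\<^sup>2 * (nrm f)\<^sup>2 + (nrm g)\<^sup>2) / t"
    using t by (intro divide_right_mono) auto
  then show "2 * cmod (k f g) \<le> t * (nrm f)\<^sup>2 + (nrm g)\<^sup>2 / t"
    using t by (simp add: add_divide_distrib power2_eq_square)
qed (use f g in auto)

lemma Cauchy_Schwarz: "\<lbrakk>f \<in> W; g \<in> W\<rbrakk> \<Longrightarrow> cmod (p f g) \<le> nrm f * nrm g"
  by (rule form_bound[OF hform_axioms]) (auto simp: nonneg)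

lemma nrm_triangle: assumes "x \<in> W" "y \<in> W" shows "nrm (x + y) \<le> nrm x + nrm y"
proof (rule power2_le_imp_le)
  have "Re (p x y) \<le> nrm x * nrm y"
    using Cauchy_Schwarz[OF assms] complex_Re_le_cmod[of "p x y"] by simp
  then show "(nrm (x + y))\<^sup>2 \<le> (nrm x + nrm y)\<^sup>2"
    using assms by (simp add: nrm_sq Re_diag_add power2_sum)
qed (use assms in auto)

lemma nrm_scale: "x \<in> W \<Longrightarrow> nrm (s c x) = cmod c * nrm x"
  by (simp add: nrm_def Re_diag_scale real_sqrt_mult)

lemma nrm_minus: "x \<in> W \<Longrightarrow> nrm (- x) = nrm x"
  using nrm_scale[of x "-1"] by simp

lemma nrm_commute: "\<lbrakk>x \<in> W; y \<in> W\<rbrakk> \<Longrightarrow> nrm (x - y) = nrm (y - x)"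
  using nrm_minus[of "x - y"] by simp

lemma nrm_zero [simp]: "nrm 0 = 0" by (simp add: nrm_def)

lemma nrm_triangle_diff: "\<lbrakk>x \<in> W; y \<in> W; z \<in> W\<rbrakk> \<Longrightarrow> nrm (x - z) \<le> nrm (x - y) + nrm (y - z)"
  using nrm_triangle[of "x - y" "y - z"] by simp

lemma nrm_leI:
  assumes "x \<in> W" "\<And>y. y \<in> W \<Longrightarrow> cmod (p x y) \<le> C * nrm y" "0 \<le> C"
  shows "nrm x \<le> C"
proof -
  have "nrm x * nrm x \<le> C * nrm x"
    using assms(1) assms(2)[of x] complex_Re_le_cmod[of "p x x"] nrm_sq[of x]
    by (simp add: power2_eq_square)
  then show ?thesis using assms(3) nrm_nonneg[OF assms(1)] mult_right_le_imp_le[of "nrm x" "nrm x" C]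
    by linarith
qed


section \<open>The dual of a positive form\<close>

text \<open>Functionals are conjugate linear so that f -> p(f, .) is linear, and vanish off
  \<open>W\<close> so that agreement on \<open>W\<close> is equality of functions.\<close>

definition dual :: "('a \<Rightarrow> complex) set" where
  "dual = {l. (\<forall>x. x \<notin> W \<longrightarrow> l x = 0) \<and> (\<forall>x\<in>W. \<forall>y\<in>W. l (x + y) = l x + l y) \<and>
     (\<forall>c. \<forall>x\<in>W. l (s c x) = cnj c * l x) \<and> (\<exists>C. \<forall>x\<in>W. cmod (l x) \<le> C * nrm x)}"

lemma dualI:
  assumes "\<And>x. x \<notin> W \<Longrightarrow> l x = 0" "\<And>x y. \<lbrakk>x \<in> W; y \<in> W\<rbrakk> \<Longrightarrow> l (x + y) = l x + l y"
    "\<And>c x. x \<in> W \<Longrightarrow> l (s c x) = cnj c * l x" "\<And>x. x \<in> W \<Longrightarrow> cmod (l x) \<le> C * nrm x"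
  shows "l \<in> dual"
  using assms unfolding dual_def by blast

lemma dual_off: "l \<in> dual \<Longrightarrow> x \<notin> W \<Longrightarrow> l x = 0"
  and dual_add: "l \<in> dual \<Longrightarrow> x \<in> W \<Longrightarrow> y \<in> W \<Longrightarrow> l (x + y) = l x + l y"
  and dual_scale: "l \<in> dual \<Longrightarrow> x \<in> W \<Longrightarrow> l (s c x) = cnj c * l x"
  unfolding dual_def by blast+

lemma dual_minus: "l \<in> dual \<Longrightarrow> x \<in> W \<Longrightarrow> l (- x) = - l x"
  using dual_scale[of l x "-1"] by simp

lemma dual_diff: "l \<in> dual \<Longrightarrow> x \<in> W \<Longrightarrow> y \<in> W \<Longrightarrow> l (x - y) = l x - l y"
  using dual_add[of l x "-y"] dual_minus[of l y] by simp

lemma dual_bounded: "l \<in> dual \<Longrightarrow> \<exists>C\<ge>0. \<forall>x\<in>W. cmod (l x) \<le> C * nrm x"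
  unfolding dual_def by clarify (meson abs_ge_self abs_ge_zero mult_right_mono nrm_nonneg order_trans)

text \<open>The values \<open>2 Re l(f) - p(f, f)\<close> are bounded; a near-maximizer \<open>f\<close> nearly represents \<open>l\<close>.\<close>

lemma dual_approx:
  assumes l: "l \<in> dual" and e: "e > 0"
  shows "\<exists>f\<in>W. \<forall>h\<in>W. cmod (l h - p f h) \<le> e * nrm h"
proof -
  obtain C where C: "C \<ge> 0" "\<And>x. x \<in> W \<Longrightarrow> cmod (l x) \<le> C * nrm x"
    using dual_bounded[OF l] by blast
  define \<Phi> where "\<Phi> f = 2 * Re (l f) - Re (p f f)" for f
  have "\<Phi> f \<le> C\<^sup>2" if "f \<in> W" for f
  proof -
    have "Re (l f) \<le> C * nrm f" using C(2)[OF that] complex_Re_le_cmod[of "l f"] by simp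
    moreover have "0 \<le> (C - nrm f)\<^sup>2" by simp
    ultimately show ?thesis using that by (simp add: \<Phi>_def power2_diff nrm_sq)
  qed
  then have bdd: "bdd_above (\<Phi> ` W)" by (intro bdd_aboveI2)
  \<comment> \<open>The defect is e^2 because optimizing over the scale of the increment
    \<open>h\<close> below takes its square root.\<close>
  have "Sup (\<Phi> ` W) - e\<^sup>2 < Sup (\<Phi> ` W)" using e by simp
  then obtain f where f: "f \<in> W" "Sup (\<Phi> ` W) - e\<^sup>2 < \<Phi> f"
    using less_cSup_iff[OF _ bdd] W_intros(1) by (metis (no_types, lifting) empty_iff imageE image_is_empty)
  have step: "2 * Re (l h - p f h) \<le> (nrm h)\<^sup>2 + e\<^sup>2" if h: "h \<in> W" for h
  proof -
    have "\<Phi> (f + h) \<le> Sup (\<Phi> ` W)" using f h by (intro cSup_upper bdd) auto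
    then have "\<Phi> (f + h) < \<Phi> f + e\<^sup>2" using f by simp
    then show ?thesis using f h l by (simp add: \<Phi>_def dual_add Re_diag_add nrm_sq)
  qed
  have "cmod (l h - p f h) \<le> nrm h * e" if h: "h \<in> W" for h
  proof (rule le_mult_of_weighted_mean)
    fix t :: real assume t: "t > 0"
    define m where "m = l h - p f h"
    define u where "u = (if m = 0 then 1 else m / cmod m)"
    have u: "cmod u = 1" by (simp add: u_def norm_divide)
    have mu: "cnj u * m = cmod m"
      by (simp add: u_def complex_norm_square[symmetric] mult.commute power2_eq_square)
    have "l (s (of_real t * u) h) - p f (s (of_real t * u) h) = of_real t * (cnj u * m)"
      using l f h by (simp add: dual_scale scale_right m_def algebra_simps)
    then have "2 * (t * cmod m) \<le> t\<^sup>2 * (nrm h)\<^sup>2 + e\<^sup>2"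
      using step[of "s (of_real t * u) h"] h t u mu
      by (simp add: nrm_scale norm_mult power_mult_distrib)
    then have "2 * (t * cmod m) / t \<le> (t\<^sup>2 * (nrm h)\<^sup>2 + e\<^sup>2) / t"
      using t by (intro divide_right_mono) auto
    then show "2 * cmod (l h - p f h) \<le> t * (nrm h)\<^sup>2 + e\<^sup>2 / t"
      using t by (simp add: add_divide_distrib power2_eq_square m_def)
  qed (use h e in auto)
  with f show ?thesis by (auto simp: mult.commute)
qed

text \<open>The functionals p(b i, .) tend to \<open>l\<close> in dual norm, with explicit errors
  \<open>e i\<close> because the dual has no norm yet. The sequence \<open>b\<close> itself need not
  converge in \<open>W\<close>.\<close>

definition approximates :: "(nat \<Rightarrow> 'a) \<Rightarrow> ('a \<Rightarrow> complex) \<Rightarrow> bool" where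
  "approximates b l \<longleftrightarrow> (\<forall>i. b i \<in> W) \<and>
     (\<exists>e. e \<longlonglongrightarrow> 0 \<and> (\<forall>i. 0 \<le> e i) \<and> (\<forall>i. \<forall>h\<in>W. cmod (l h - p (b i) h) \<le> e i * nrm h))"

lemma approximates_ex: assumes "l \<in> dual" shows "\<exists>b. approximates b l"
proof -
  have "\<forall>i. \<exists>f\<in>W. \<forall>h\<in>W. cmod (l h - p f h) \<le> inverse (real (Suc i)) * nrm h"
    using dual_approx[OF assms] by (meson inverse_positive_iff_positive of_nat_0_less_iff zero_less_Suc)
  then obtain b where "\<And>i. b i \<in> W" "\<And>i h. h \<in> W \<Longrightarrow> cmod (l h - p (b i) h) \<le> inverse (real (Suc i)) * nrm h"
    by metis
  moreover have "0 \<le> inverse (real (Suc i))" for i by simp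
  ultimately have "approximates b l"
    unfolding approximates_def using LIMSEQ_inverse_real_of_nat by blast
  then show ?thesis by blast
qed

lemma approximates_in: "approximates b l \<Longrightarrow> b i \<in> W" by (simp add: approximates_def)

text \<open>Subtracting the two error estimates leaves p(a i - b j, .). For a = b this is the Cauchy
  property of an approximating sequence; in general it makes limits along such sequences independent
  of the choice.\<close>

lemma approximates_bound:
  assumes "approximates a l" "approximates b l"
  obtains e d where "e \<longlonglongrightarrow> 0" "d \<longlonglongrightarrow> 0" "\<And>i j. nrm (a i - b j) \<le> e i + d j"
proof -
  obtain e where e: "e \<longlonglongrightarrow> 0" "\<And>i. 0 \<le> e i" "\<And>i h. h \<in> W \<Longrightarrow> cmod (l h - p (a i) h) \<le> e i * nrm h"
    using assms(1) unfolding approximates_def by blast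
  obtain d where d: "d \<longlonglongrightarrow> 0" "\<And>i. 0 \<le> d i" "\<And>i h. h \<in> W \<Longrightarrow> cmod (l h - p (b i) h) \<le> d i * nrm h"
    using assms(2) unfolding approximates_def by blast
  have "nrm (a i - b j) \<le> e i + d j" for i j
  proof (rule nrm_leI)
    show "a i - b j \<in> W" using assms by (simp add: approximates_in)
    fix y assume y: "y \<in> W"
    have "p (a i - b j) y = (l y - p (b j) y) - (l y - p (a i) y)"
      using assms y by (simp add: approximates_in diff_left)
    then show "cmod (p (a i - b j) y) \<le> (e i + d j) * nrm y"
      using e(3)[OF y, of i] d(3)[OF y, of j] norm_triangle_ineq4[of "l y - p (b j) y" "l y - p (a i) y"]
      by (simp add: distrib_right)
  qed (use e d in auto)
  with e d that show ?thesis by blast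
qed

lemma approximates_values_null:
  assumes "approximates a m" "approximates b m" "l \<in> dual"
  shows "(\<lambda>i. l (a i) - l (b i)) \<longlonglongrightarrow> 0"
proof -
  obtain e d where ed: "e \<longlonglongrightarrow> 0" "d \<longlonglongrightarrow> 0" "\<And>i j. nrm (a i - b j) \<le> e i + d j"
    by (rule approximates_bound[OF assms(1,2)]) blast
  obtain C where C: "C \<ge> 0" "\<And>x. x \<in> W \<Longrightarrow> cmod (l x) \<le> C * nrm x"
    using dual_bounded[OF assms(3)] by blast
  have "cmod (l (a i) - l (b i)) \<le> C * (e i + d i)" for i
  proof -
    have "l (a i) - l (b i) = l (a i - b i)" using assms by (simp add: approximates_in dual_diff)
    then show ?thesis using C(2)[of "a i - b i"] mult_left_mono[OF ed(3)[of i i] C(1)] assms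
      by (simp add: approximates_in)
  qed
  moreover have "(\<lambda>i. C * (e i + d i)) \<longlonglongrightarrow> 0"
    using tendsto_mult_right_zero[OF tendsto_add_zero[OF ed(1,2)]] .
  ultimately show ?thesis
    by (metis (no_types, lifting) Lim_null_comparison always_eventually)
qed

lemma approximates_values_convergent:
  assumes "approximates a m" "l \<in> dual"
  shows "convergent (\<lambda>i. l (a i))"
proof -
  obtain e d where ed: "e \<longlonglongrightarrow> 0" "d \<longlonglongrightarrow> 0" "\<And>i j. nrm (a i - a j) \<le> e i + d j"
    by (rule approximates_bound[OF assms(1,1)]) blast
  obtain C where C: "C \<ge> 0" "\<And>x. x \<in> W \<Longrightarrow> cmod (l x) \<le> C * nrm x"
    using dual_bounded[OF assms(2)] by blast
  have *: "cmod (l (a i) - l (a j)) \<le> C * e i + C * d j" for i j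
  proof -
    have "l (a i) - l (a j) = l (a i - a j)" using assms by (simp add: approximates_in dual_diff)
    then show ?thesis using C(2)[of "a i - a j"] mult_left_mono[OF ed(3)[of i j] C(1)] assms
      by (simp add: approximates_in distrib_left)
  qed
  have "Cauchy (\<lambda>i. l (a i))"
  proof (rule metric_CauchyI)
    fix r :: real assume r: "r > 0"
    have "(\<lambda>i. C * e i) \<longlonglongrightarrow> 0" "(\<lambda>i. C * d i) \<longlonglongrightarrow> 0"
      using ed by (auto intro: tendsto_mult_right_zero)
    then have "\<forall>\<^sub>F i in sequentially. C * e i < r / 2" "\<forall>\<^sub>F i in sequentially. C * d i < r / 2"
      using order_tendstoD(2)[of _ 0 sequentially "r / 2"] r by simp_all
    then obtain M N where "\<And>i. i \<ge> M \<Longrightarrow> C * e i < r / 2" "\<And>i. i \<ge> N \<Longrightarrow> C * d i < r / 2"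
      unfolding eventually_sequentially by blast
    then have "dist (l (a i)) (l (a j)) < r" if "i \<ge> max M N" "j \<ge> max M N" for i j
      using *[of i j] that by (smt (verit, best) dist_norm field_sum_of_halves max.boundedE)
    then show "\<exists>M. \<forall>m\<ge>M. \<forall>n\<ge>M. dist (l (a m)) (l (a n)) < r" by blast
  qed
  then show ?thesis by (simp add: Cauchy_convergent_iff)
qed

text \<open>If \<open>m\<close> is p(b, .), this is l(b); in general it is the limit of
  \<open>l\<close> along vectors that nearly represent \<open>m\<close>. By
  \<open>approximates_values_null\<close> the chosen sequence is immaterial.\<close>

definition dip :: "('a \<Rightarrow> complex) \<Rightarrow> ('a \<Rightarrow> complex) \<Rightarrow> complex" where
  "dip l m = lim (\<lambda>i. l ((SOME b. approximates b m) i))"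

lemma dip_lim:
  assumes "l \<in> dual" "approximates a m"
  shows "(\<lambda>i. l (a i)) \<longlonglongrightarrow> dip l m"
proof -
  define b where "b = (SOME b. approximates b m)"
  have b: "approximates b m" unfolding b_def using assms(2) by (rule someI[of "\<lambda>b. approximates b m"])
  have "(\<lambda>i. l (b i)) \<longlonglongrightarrow> dip l m"
    using approximates_values_convergent[OF b assms(1)] by (simp add: dip_def b_def convergent_LIMSEQ_iff)
  from tendsto_add[OF approximates_values_null[OF assms(2) b assms(1)] this]
  show ?thesis by simp
qed

text \<open>l(b i) and p(a i, b i) differ by at most c i times the norm of b i, which the Cauchy
  estimate keeps bounded. In this form symmetry and positivity pass from \<open>p\<close> to
  \<open>dip\<close>.\<close>

lemma dip_lim2:
  assumes "l \<in> dual" "approximates a l" "approximates b m"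
  shows "(\<lambda>i. p (a i) (b i)) \<longlonglongrightarrow> dip l m"
proof -
  obtain e d where ed: "e \<longlonglongrightarrow> 0" "d \<longlonglongrightarrow> 0" "\<And>i j. nrm (b i - b j) \<le> e i + d j"
    by (rule approximates_bound[OF assms(3,3)]) blast
  obtain c where c: "c \<longlonglongrightarrow> 0" "\<And>i. 0 \<le> c i" "\<And>i h. h \<in> W \<Longrightarrow> cmod (l h - p (a i) h) \<le> c i * nrm h"
    using assms(2) unfolding approximates_def by blast
  have "cmod (l (b i) - p (a i) (b i)) \<le> c i * (nrm (b 0) + (e i + d 0))" for i
  proof -
    have "nrm (b i) \<le> nrm (b 0) + (e i + d 0)"
      using nrm_triangle[of "b i - b 0" "b 0"] ed(3)[of i 0] approximates_in[OF assms(3)] by simp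
    then show ?thesis using c(3)[of "b i" i] mult_left_mono[OF _ c(2)[of i]] approximates_in[OF assms(3)]
      by (meson order_trans)
  qed
  moreover have "(\<lambda>i. c i * (nrm (b 0) + (e i + d 0))) \<longlonglongrightarrow> 0 * (nrm (b 0) + (0 + d 0))"
    by (intro tendsto_intros c ed)
  ultimately have "(\<lambda>i. l (b i) - p (a i) (b i)) \<longlonglongrightarrow> 0"
    by (metis (no_types, lifting) Lim_null_comparison always_eventually mult_zero_left)
  from tendsto_diff[OF dip_lim[OF assms(1,3)] this] show ?thesis by simp
qed

text \<open>The Riesz map. It need not be injective, as \<open>p\<close> may be degenerate, but its
  range is dense in the dual by \<open>dual_approx\<close>.\<close>

definition emb :: "'a \<Rightarrow> 'a \<Rightarrow> complex" where
  "emb f = (\<lambda>h. if h \<in> W then p f h else 0)"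

lemma emb_apply [simp]: "h \<in> W \<Longrightarrow> emb f h = p f h" by (simp add: emb_def)

lemma emb_in [simp, intro]: "f \<in> W \<Longrightarrow> emb f \<in> dual"
  by (rule dualI[where C = "nrm f"]) (auto simp: emb_def add_right scale_right Cauchy_Schwarz)

lemma approximates_emb: "f \<in> W \<Longrightarrow> approximates (\<lambda>_. f) (emb f)"
  by (auto simp: approximates_def intro!: exI[where x = "\<lambda>_. 0"])

lemma dip_emb: assumes "l \<in> dual" "f \<in> W" shows "dip l (emb f) = l f"
  using dip_lim[OF assms(1) approximates_emb[OF assms(2)]] LIMSEQ_unique tendsto_const by blast

definition dscale :: "complex \<Rightarrow> ('a \<Rightarrow> complex) \<Rightarrow> 'a \<Rightarrow> complex" where
  "dscale c l = (\<lambda>x. c * l x)"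

lemma dscale_apply [simp]: "dscale c l x = c * l x" by (simp add: dscale_def)

lemma vector_space_dscale: "vector_space dscale"
  by unfold_locales (auto simp: fun_eq_iff algebra_simps)

lemma dual_add_closed: assumes "l \<in> dual" "m \<in> dual" shows "l + m \<in> dual"
proof -
  obtain C D where "\<And>x. x \<in> W \<Longrightarrow> cmod (l x) \<le> C * nrm x" "\<And>x. x \<in> W \<Longrightarrow> cmod (m x) \<le> D * nrm x"
    using dual_bounded assms by metis
  then have "cmod (l x + m x) \<le> (C + D) * nrm x" if "x \<in> W" for x
    using that norm_triangle_ineq[of "l x" "m x"] by (fastforce simp: distrib_right)
  then show ?thesis
    using assms by (intro dualI[where C = "C + D"]) (auto simp: dual_off dual_add dual_scale algebra_simps)
qed

lemma dual_scale_closed: assumes "l \<in> dual" shows "dscale c l \<in> dual"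
proof -
  obtain C where C: "\<And>x. x \<in> W \<Longrightarrow> cmod (l x) \<le> C * nrm x" using dual_bounded assms by metis
  have "cmod (c * l x) \<le> (cmod c * C) * nrm x" if "x \<in> W" for x
    using mult_left_mono[OF C[OF that], of "cmod c"] by (simp add: norm_mult mult.assoc)
  then show ?thesis
    using assms by (intro dualI[where C = "cmod c * C"]) (auto simp: dual_off dual_add dual_scale algebra_simps)
qed

lemma psd_form_dual: "psd_form dscale dual dip"
proof -
  interpret D: vector_space dscale by (rule vector_space_dscale)
  show ?thesis
  proof
    show "D.subspace dual"
      by (rule D.subspaceI) (auto simp: dual_add_closed dual_scale_closed intro!: dualI[where C = 0])
    fix l m k assume lmk: "l \<in> dual" "m \<in> dual" "k \<in> dual"
    obtain b where b: "approximates b k" using approximates_ex lmk by blast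
    show "dip (l + m) k = dip l k + dip m k"
      using dip_lim[OF dual_add_closed[OF lmk(1,2)] b] tendsto_add[OF dip_lim[OF lmk(1) b] dip_lim[OF lmk(2) b]]
      by (simp add: LIMSEQ_unique)
  next
    fix l k c assume lk: "l \<in> dual" "k \<in> dual"
    obtain b where b: "approximates b k" using approximates_ex lk by blast
    show "dip (dscale c l) k = c * dip l k"
      using dip_lim[OF dual_scale_closed[OF lk(1)] b, of c] tendsto_mult_left[OF dip_lim[OF lk(1) b], of c]
      by (simp add: LIMSEQ_unique)
  next
    fix l k assume lk: "l \<in> dual" "k \<in> dual"
    obtain a where a: "approximates a l" using approximates_ex lk by blast
    obtain b where b: "approximates b k" using approximates_ex lk by blast
    have "(\<lambda>i. p (b i) (a i)) \<longlonglongrightarrow> cnj (dip l k)"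
      using tendsto_cnj[OF dip_lim2[OF lk(1) a b]] approximates_in[OF a] approximates_in[OF b]
      by (simp add: herm[symmetric])
    with dip_lim2[OF lk(2) b a] show "dip k l = cnj (dip l k)" by (rule LIMSEQ_unique)
  next
    fix l assume l: "l \<in> dual"
    obtain a where a: "approximates a l" using approximates_ex l by blast
    have "(\<lambda>i. Re (p (a i) (a i))) \<longlonglongrightarrow> Re (dip l l)"
      using dip_lim2[OF l a a] by (rule tendsto_Re)
    then show "0 \<le> Re (dip l l)"
      by (rule LIMSEQ_le_const) (auto simp: nonneg approximates_in[OF a])
  qed
qed

end

section \<open>The dual norm and completeness of the dual\<close>

context psd_form
begin

interpretation D: psd_form dscale dual dip by (rule psd_form_dual)

abbreviation "dnrm \<equiv> D.nrm"

lemma dip_emb_left: "\<lbrakk>l \<in> dual; f \<in> W\<rbrakk> \<Longrightarrow> dip (emb f) l = cnj (l f)"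
  using D.herm[of l "emb f"] by (simp add: dip_emb)

lemma dnrm_emb: "f \<in> W \<Longrightarrow> dnrm (emb f) = nrm f"
  by (simp add: D.nrm_def nrm_def dip_emb)

lemma dual_apply_le: "\<lbrakk>l \<in> dual; h \<in> W\<rbrakk> \<Longrightarrow> cmod (l h) \<le> dnrm l * nrm h"
  using D.Cauchy_Schwarz[of l "emb h"] by (simp add: dip_emb dnrm_emb)

text \<open>Along an approximating sequence Re l(a i) tends to the square of the dual norm and the
  norm of a i to the dual norm itself. Together with \<open>dual_apply_le\<close> this identifies
  \<open>dnrm l\<close> as the least bound of \<open>l\<close>.\<close>

lemma dnrm_leI:
  assumes l: "l \<in> dual" and C: "\<And>h. h \<in> W \<Longrightarrow> cmod (l h) \<le> C * nrm h" "0 \<le> C"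
  shows "dnrm l \<le> C"
proof -
  obtain a where a: "approximates a l" using approximates_ex l by blast
  have "(\<lambda>i. sqrt (Re (p (a i) (a i)))) \<longlonglongrightarrow> sqrt (Re (dip l l))"
    by (intro tendsto_intros dip_lim2[OF l a a])
  then have n: "(\<lambda>i. nrm (a i)) \<longlonglongrightarrow> dnrm l" by (simp add: nrm_def D.nrm_def)
  have "Re (dip l l) \<le> C * dnrm l"
  proof (rule LIMSEQ_le)
    show "(\<lambda>i. Re (l (a i))) \<longlonglongrightarrow> Re (dip l l)" by (intro tendsto_Re dip_lim[OF l a])
    show "(\<lambda>i. C * nrm (a i)) \<longlonglongrightarrow> C * dnrm l" by (intro tendsto_intros n)
    show "\<exists>N. \<forall>n\<ge>N. Re (l (a n)) \<le> C * nrm (a n)"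
      using C(1) approximates_in[OF a] complex_Re_le_cmod order_trans by blast
  qed
  then have "dnrm l * dnrm l \<le> C * dnrm l" using D.nrm_sq[OF l] by (simp add: power2_eq_square)
  then show ?thesis using C(2) D.nrm_nonneg[OF l] mult_right_le_imp_le[of "dnrm l" "dnrm l" C]
    by linarith
qed

lemma dual_eqI: "\<lbrakk>l \<in> dual; m \<in> dual; \<And>h. h \<in> W \<Longrightarrow> l h = m h\<rbrakk> \<Longrightarrow> l = m"
  by (metis dual_off ext)

text \<open>A functional of norm 0 vanishes on \<open>W\<close>, because its values are bounded by
  its norm. So the dual is definite even when \<open>p\<close> is not.\<close>

lemma dnrm_pos: assumes "l \<in> dual" "l \<noteq> 0" shows "0 < dnrm l"
proof (rule ccontr)
  assume "\<not> 0 < dnrm l"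
  then have "dnrm l = 0" using D.nrm_nonneg[OF assms(1)] by simp
  then have "l h = 0" if "h \<in> W" for h using dual_apply_le[OF assms(1) that] by simp
  then have "l = 0" using dual_off[OF assms(1)] by (metis ext zero_fun_apply)
  with assms show False by simp
qed

text \<open>The pointwise limit of the functionals is also their limit in norm, as in the dual of
  any normed space.\<close>

lemma dual_complete:
  assumes \<sigma>: "\<And>i. \<sigma> i \<in> dual"
    and Cau: "\<And>e. e > 0 \<Longrightarrow> \<exists>N. \<forall>i\<ge>N. \<forall>j\<ge>N. dnrm (\<sigma> i - \<sigma> j) < e"
  shows "\<exists>l\<in>dual. (\<lambda>i. dnrm (\<sigma> i - l)) \<longlonglongrightarrow> 0"
proof -
  have ap: "cmod (\<sigma> i h - \<sigma> j h) \<le> dnrm (\<sigma> i - \<sigma> j) * nrm h" if "h \<in> W" for i j h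
    using dual_apply_le[of "\<sigma> i - \<sigma> j" h] \<sigma> that by simp
  have conv: "convergent (\<lambda>i. \<sigma> i h)" if h: "h \<in> W" for h
  proof -
    have "Cauchy (\<lambda>i. \<sigma> i h)"
    proof (rule metric_CauchyI)
      fix r :: real assume r: "r > 0"
      \<comment> \<open>The summand 1 covers the case of a null vector \<open>h\<close>.\<close>
      have "r / (nrm h + 1) > 0" using r h by (simp add: add_nonneg_pos)
      then obtain N where N: "\<And>i j. i \<ge> N \<Longrightarrow> j \<ge> N \<Longrightarrow> dnrm (\<sigma> i - \<sigma> j) < r / (nrm h + 1)"
        using Cau by blast
      have "dist (\<sigma> i h) (\<sigma> j h) < r" if "i \<ge> N" "j \<ge> N" for i j
      proof -
        have n0: "0 \<le> nrm h" using h by simp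
        have "cmod (\<sigma> i h - \<sigma> j h) \<le> r / (nrm h + 1) * nrm h"
          using ap[OF h, of i j] mult_right_mono[OF less_imp_le[OF N[OF that]] n0] by linarith
        also have "\<dots> < r" using r n0 by (simp add: field_simps)
        finally show ?thesis by (simp add: dist_norm)
      qed
      then show "\<exists>M. \<forall>m\<ge>M. \<forall>n\<ge>M. dist (\<sigma> m h) (\<sigma> n h) < r" by blast
    qed
    then show ?thesis by (simp add: Cauchy_convergent_iff)
  qed
  define l where "l = (\<lambda>h. lim (\<lambda>i. \<sigma> i h))"
  have l: "(\<lambda>i. \<sigma> i h) \<longlonglongrightarrow> l h" for h
  proof (cases "h \<in> W")
    case True then show ?thesis using conv by (simp add: l_def convergent_LIMSEQ_iff)
  next
    case False then show ?thesis using dual_off[OF \<sigma>] by (simp add: l_def)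
  qed
  \<comment> \<open>Letting only \<open>j\<close> tend to infinity keeps the estimate uniform in
    \<open>h\<close>; it yields both the boundedness of \<open>l\<close> and the convergence in
    norm.\<close>
  have lim_diff: "cmod (\<sigma> i h - l h) \<le> e * nrm h"
    if h: "h \<in> W" and N: "\<And>j. j \<ge> N \<Longrightarrow> dnrm (\<sigma> i - \<sigma> j) < e" for i h e N
  proof (rule LIMSEQ_le_const2)
    show "(\<lambda>j. cmod (\<sigma> i h - \<sigma> j h)) \<longlonglongrightarrow> cmod (\<sigma> i h - l h)" by (intro tendsto_intros l)
    have "cmod (\<sigma> i h - \<sigma> j h) \<le> e * nrm h" if "j \<ge> N" for j
      using ap[OF h, of i j] mult_right_mono[OF less_imp_le[OF N[OF that]] nrm_nonneg[OF h]] by linarith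
    then show "\<exists>N. \<forall>j\<ge>N. cmod (\<sigma> i h - \<sigma> j h) \<le> e * nrm h" by blast
  qed
  have "l \<in> dual"
  proof -
    obtain N where N: "\<And>i j. i \<ge> N \<Longrightarrow> j \<ge> N \<Longrightarrow> dnrm (\<sigma> i - \<sigma> j) < 1" using Cau[of 1] by auto
    show ?thesis
    proof (rule dualI[where C = "dnrm (\<sigma> N) + 1"])
      fix x y c
      show "l x = 0" if "x \<notin> W" using dual_off[OF \<sigma> that] by (simp add: l_def)
      show "l (x + y) = l x + l y" if "x \<in> W" "y \<in> W"
        using l[of "x + y"] tendsto_add[OF l[of x] l[of y]] dual_add[OF \<sigma> that] by (simp add: LIMSEQ_unique)
      show "l (s c x) = cnj c * l x" if "x \<in> W"
        using l[of "s c x"] tendsto_mult_left[OF l[of x], of "cnj c"] dual_scale[OF \<sigma> that]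
        by (simp add: LIMSEQ_unique)
      show "cmod (l x) \<le> (dnrm (\<sigma> N) + 1) * nrm x" if "x \<in> W"
        using lim_diff[of x N N 1, OF that N] dual_apply_le[OF \<sigma> that, of N] norm_triangle_ineq4[of "\<sigma> N x" "\<sigma> N x - l x"]
        by (simp add: distrib_right)
    qed
  qed
  moreover have "(\<lambda>i. dnrm (\<sigma> i - l)) \<longlonglongrightarrow> 0"
  proof (rule LIMSEQ_I)
    fix r :: real assume r: "r > 0"
    then obtain N where N: "\<And>i j. i \<ge> N \<Longrightarrow> j \<ge> N \<Longrightarrow> dnrm (\<sigma> i - \<sigma> j) < r / 2" using Cau[of "r / 2"] by auto
    have "dnrm (\<sigma> i - l) \<le> r / 2" if "i \<ge> N" for i
      using lim_diff[of _ N i "r / 2", OF _ N[OF that]] that r \<sigma> \<open>l \<in> dual\<close> by (intro dnrm_leI) auto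
    then have "norm (dnrm (\<sigma> i - l) - 0) < r" if "i \<ge> N" for i
      using that r D.nrm_nonneg[of "\<sigma> i - l"] \<sigma> \<open>l \<in> dual\<close> by fastforce
    then show "\<exists>no. \<forall>n\<ge>no. norm (dnrm (\<sigma> n - l) - 0) < r" by blast
  qed
  ultimately show ?thesis by blast
qed

end


section \<open>Newton iteration for the sign of a dominated form\<close>

text \<open>The data shared by all iterates. The adjoint \<open>T'\<close> is a map on
  \<open>W\<close> itself, so that a single \<open>T'\<close> can be the adjoint with respect to
  \<open>k\<close> and to every dominating form at once.\<close>

locale form_system = hform s W k
  for s :: "complex \<Rightarrow> 'w::ab_group_add \<Rightarrow> 'w" and W and k +
  fixes T T' :: "'i \<Rightarrow> 'w \<Rightarrow> 'w" and c :: "'i \<Rightarrow> real"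
  assumes T_in [simp, intro]: "x \<in> W \<Longrightarrow> T a x \<in> W"
    and T_add: "\<lbrakk>x \<in> W; y \<in> W\<rbrakk> \<Longrightarrow> T a (x + y) = T a x + T a y"
    and T_scale: "x \<in> W \<Longrightarrow> T a (s d x) = s d (T a x)"
    and T'_in [simp, intro]: "x \<in> W \<Longrightarrow> T' a x \<in> W"
    and T'_add: "\<lbrakk>x \<in> W; y \<in> W\<rbrakk> \<Longrightarrow> T' a (x + y) = T' a x + T' a y"
    and T'_scale: "x \<in> W \<Longrightarrow> T' a (s d x) = s d (T' a x)"
    and adjoint: "\<lbrakk>x \<in> W; y \<in> W\<rbrakk> \<Longrightarrow> k (T a x) y = k x (T' a y)"
    and c_nonneg: "0 \<le> c a"
begin

lemma adjoint': "\<lbrakk>x \<in> W; y \<in> W\<rbrakk> \<Longrightarrow> k (T' a x) y = k x (T a y)"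
  using adjoint[of y x a] herm[of y "T' a x"] herm[of "T a y" x] by simp

end

locale dominating_form = k: form_system s W k T T' c + psd_form s W p
  for s :: "complex \<Rightarrow> 'w::ab_group_add \<Rightarrow> 'w" and W and k and T T' :: "'i \<Rightarrow> 'w \<Rightarrow> 'w"
    and c :: "'i \<Rightarrow> real" and p +
  assumes dominates: "x \<in> W \<Longrightarrow> \<bar>Re (k x x)\<bar> \<le> Re (p x x)"
    and adj: "\<lbrakk>x \<in> W; y \<in> W\<rbrakk> \<Longrightarrow> p (T a x) y = p x (T' a y)"
    and bound: "x \<in> W \<Longrightarrow> Re (p (T a x) (T a x)) \<le> (c a)\<^sup>2 * Re (p x x)"
begin

interpretation D: psd_form dscale dual dip by (rule psd_form_dual)

lemma k_bound: "\<lbrakk>f \<in> W; g \<in> W\<rbrakk> \<Longrightarrow> cmod (k f g) \<le> nrm f * nrm g"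
  using form_bound[OF k.hform_axioms dominates] by blast

lemma T_bound: "x \<in> W \<Longrightarrow> nrm (T a x) \<le> c a * nrm x"
  using bound[of x a] k.c_nonneg[of a] real_sqrt_le_mono[of "Re (p (T a x) (T a x))" "(c a)\<^sup>2 * Re (p x x)"]
  by (simp add: nrm_def real_sqrt_mult)

text \<open>Duality gives the adjoint the bound of \<open>T\<close>.\<close>

lemma T'_bound: assumes x: "x \<in> W" shows "nrm (T' a x) \<le> c a * nrm x"
proof (rule nrm_leI)
  fix y assume y: "y \<in> W"
  have "p (T' a x) y = p x (T a y)"
    using adj[OF y x, of a] herm[of y "T' a x"] herm[of "T a y" x] x y by simp
  then have "cmod (p (T' a x) y) \<le> nrm x * nrm (T a y)" using x y by (simp add: Cauchy_Schwarz)
  also have "\<dots> \<le> nrm x * (c a * nrm y)" using x y by (intro mult_left_mono T_bound) auto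
  finally show "cmod (p (T' a x) y) \<le> c a * nrm x * nrm y" by (simp add: mult_ac)
qed (use x k.c_nonneg in auto)

text \<open>In the completion, where k(f, g) = p(A f, g) for a selfadjoint contraction A, this is
  the functional of the vector A f.\<close>

definition kap :: "'w \<Rightarrow> 'w \<Rightarrow> complex" where
  "kap f = (\<lambda>h. if h \<in> W then k f h else 0)"

lemma kap_apply [simp]: "h \<in> W \<Longrightarrow> kap f h = k f h" by (simp add: kap_def)

lemma kap_in [simp, intro]: "f \<in> W \<Longrightarrow> kap f \<in> dual"
  by (rule dualI[where C = "nrm f"]) (auto simp: kap_def k.add_right k.scale_right k_bound)

lemma kap_add: "\<lbrakk>f \<in> W; g \<in> W\<rbrakk> \<Longrightarrow> kap (f + g) = kap f + kap g"
  by (rule ext) (simp add: kap_def k.add_left)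

lemma kap_scale: "f \<in> W \<Longrightarrow> kap (s d f) = dscale d (kap f)"
  by (rule ext) (simp add: kap_def k.scale_left)

lemma dnrm_kap_le: "f \<in> W \<Longrightarrow> dnrm (kap f) \<le> nrm f"
  by (rule dnrm_leI) (auto simp: k_bound)

text \<open>Precomposition with the adjoint extends \<open>T a\<close> to the dual: it matches
  \<open>T a\<close> along both \<open>emb\<close> and \<open>kap\<close> (\<open>U_emb\<close>,
  \<open>U_kap\<close>).\<close>

definition U :: "'i \<Rightarrow> ('w \<Rightarrow> complex) \<Rightarrow> 'w \<Rightarrow> complex" where
  "U a l = (\<lambda>h. if h \<in> W then l (T' a h) else 0)"

definition U' :: "'i \<Rightarrow> ('w \<Rightarrow> complex) \<Rightarrow> 'w \<Rightarrow> complex" where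
  "U' a l = (\<lambda>h. if h \<in> W then l (T a h) else 0)"

lemma U_apply [simp]: "h \<in> W \<Longrightarrow> U a l h = l (T' a h)" by (simp add: U_def)
lemma U'_apply [simp]: "h \<in> W \<Longrightarrow> U' a l h = l (T a h)" by (simp add: U'_def)

lemma U_apply_le: assumes "l \<in> dual" "h \<in> W" shows "cmod (l (T' a h)) \<le> c a * dnrm l * nrm h"
proof -
  have "cmod (l (T' a h)) \<le> dnrm l * nrm (T' a h)" using assms by (intro dual_apply_le) auto
  also have "\<dots> \<le> dnrm l * (c a * nrm h)" using assms by (intro mult_left_mono T'_bound) auto
  finally show ?thesis by (simp add: mult_ac)
qed

lemma U_in [simp, intro]: "l \<in> dual \<Longrightarrow> U a l \<in> dual"
  by (rule dualI[where C = "c a * dnrm l"])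
    (auto simp: U_def U_apply_le k.T'_add k.T'_scale dual_add dual_scale)

lemma dnrm_U: "l \<in> dual \<Longrightarrow> dnrm (U a l) \<le> c a * dnrm l"
  by (rule dnrm_leI) (auto simp: U_apply_le k.c_nonneg)

text \<open>Moving \<open>T'\<close> across \<open>p\<close> tests the old error against
  \<open>T a h\<close>, which costs a factor \<open>c a\<close>. Adjointness of \<open>U\<close> and
  \<open>U'\<close> is then read off along approximating sequences.\<close>

lemma approximates_U': assumes "approximates b m" shows "approximates (\<lambda>i. T' a (b i)) (U' a m)"
proof -
  obtain e where e: "e \<longlonglongrightarrow> 0" "\<And>i. 0 \<le> e i" "\<And>i h. h \<in> W \<Longrightarrow> cmod (m h - p (b i) h) \<le> e i * nrm h"
    using assms unfolding approximates_def by blast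
  have b: "b i \<in> W" for i using assms by (rule approximates_in)
  have "cmod (U' a m h - p (T' a (b i)) h) \<le> (e i * c a) * nrm h" if h: "h \<in> W" for i h
  proof -
    have "p (T' a (b i)) h = p (b i) (T a h)"
      using adj[OF h b, of a i] herm[of h "T' a (b i)"] herm[of "T a h" "b i"] h b by simp
    then have "cmod (U' a m h - p (T' a (b i)) h) \<le> e i * nrm (T a h)"
      using e(3)[of "T a h" i] h by simp
    also have "\<dots> \<le> e i * (c a * nrm h)" using h e(2) by (intro mult_left_mono T_bound) auto
    finally show ?thesis by (simp add: mult_ac)
  qed
  moreover have "(\<lambda>i. e i * c a) \<longlonglongrightarrow> 0" using tendsto_mult_left_zero[OF e(1)] .
  moreover have "0 \<le> e i * c a" for i using e k.c_nonneg by simp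
  ultimately show ?thesis unfolding approximates_def using b by blast
qed

lemma U_adjoint: assumes "l \<in> dual" "m \<in> dual" shows "dip (U a l) m = dip l (U' a m)"
proof -
  obtain b where b: "approximates b m" using approximates_ex assms by blast
  show ?thesis
    using dip_lim[OF U_in[OF assms(1)] b, of a] dip_lim[OF assms(1) approximates_U'[OF b, of a]] approximates_in[OF b]
    by (simp add: LIMSEQ_unique)
qed

lemma U_emb: "f \<in> W \<Longrightarrow> U a (emb f) = emb (T a f)"
  by (rule ext) (simp add: U_def emb_def adj)

lemma U_kap: "f \<in> W \<Longrightarrow> U a (kap f) = kap (T a f)"
  by (rule ext) (simp add: U_def kap_def k.adjoint)

lemma U'_kap: "f \<in> W \<Longrightarrow> U' a (kap f) = kap (T' a f)"
  by (rule ext) (simp add: U'_def kap_def k.adjoint')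

text \<open>For \<open>p = \<langle>\<cdot>, \<cdot>\<rangle>\<close> and \<open>k = \<langle>A \<cdot>, \<cdot>\<rangle>\<close> this is the form of \<open>(1 + A\<^sup>2) / 2\<close>, the Newton step
  \<open>B \<mapsto> (B + A B\<^sup>-\<^sup>1 A) / 2\<close> towards \<open>\<bar>A\<bar>\<close>, started at \<open>B = 1\<close>.\<close>

definition newton :: "'w \<Rightarrow> 'w \<Rightarrow> complex" where
  "newton f g = (p f g + dip (kap f) (kap g)) / 2"

lemma Re_newton: "f \<in> W \<Longrightarrow> Re (newton f f) = (Re (p f f) + (dnrm (kap f))\<^sup>2) / 2"
  by (simp add: newton_def D.nrm_sq)

lemma newton_le: "f \<in> W \<Longrightarrow> Re (newton f f) \<le> Re (p f f)"
  using power_mono[OF dnrm_kap_le[of f] D.nrm_nonneg[OF kap_in], of 2] by (simp add: Re_newton nrm_sq)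

text \<open>The left-hand side is the squared dual norm of k(f, .). It is estimated through
  constants \<open>C\<close> because the dual norm changes with \<open>p\<close>, whereas such a
  constant can be carried from the limit form to every iterate.\<close>

lemma newton_ge:
  assumes f: "f \<in> W" and C: "\<And>g. g \<in> W \<Longrightarrow> cmod (k f g) \<le> C * nrm g" "0 \<le> C"
  shows "2 * Re (newton f f) - Re (p f f) \<le> C\<^sup>2"
proof -
  have "dnrm (kap f) \<le> C" using assms by (intro dnrm_leI) auto
  then have "(dnrm (kap f))\<^sup>2 \<le> C\<^sup>2" using f by (intro power_mono) auto
  then show ?thesis using Re_newton[OF f] by argo
qed

text \<open>Domination survives because |k(x, x)| is at most the geometric mean of p(x, x) and the
  squared dual norm of \<open>kap x\<close>, hence at most their arithmetic mean. Adjoints and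
  bounds survive because \<open>U\<close> and \<open>U'\<close> act on \<open>kap\<close> as
  \<open>T\<close> and \<open>T'\<close> act on \<open>W\<close>.\<close>

lemma dominating_newton: "dominating_form s W k T T' c newton"
proof
  show "k.subspace W" by (rule subspace_W)
  show "newton (x + y) z = newton x z + newton y z" if "x \<in> W" "y \<in> W" "z \<in> W" for x y z
    using that by (simp add: newton_def add_left kap_add D.add_left add_divide_distrib)
  show "newton (s d x) y = d * newton x y" if "x \<in> W" "y \<in> W" for x y d
    using that by (simp add: newton_def scale_left kap_scale D.scale_left algebra_simps)
  show "newton y x = cnj (newton x y)" if "x \<in> W" "y \<in> W" for x y
    using that herm[of x y] D.herm[of "kap x" "kap y"] by (simp add: newton_def)
  show "0 \<le> Re (newton x x)" if "x \<in> W" for x using that by (simp add: Re_newton nonneg)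
  show "\<bar>Re (k x x)\<bar> \<le> Re (newton x x)" if x: "x \<in> W" for x
  proof -
    have "\<bar>Re (k x x)\<bar> \<le> cmod (kap x x)" using x by (simp add: abs_Re_le_cmod)
    also have "\<dots> \<le> dnrm (kap x) * nrm x" using x by (intro dual_apply_le) auto
    also have "\<dots> \<le> ((dnrm (kap x))\<^sup>2 + (nrm x)\<^sup>2) / 2"
      using zero_le_power2[of "dnrm (kap x) - nrm x"] by (simp add: power2_diff)
    finally show ?thesis using x by (simp add: Re_newton nrm_sq add.commute)
  qed
  show "newton (T a x) y = newton x (T' a y)" if "x \<in> W" "y \<in> W" for a x y
    using that U_adjoint[of "kap x" "kap y" a] by (simp add: newton_def adj U_kap U'_kap)
  show "Re (newton (T a x) (T a x)) \<le> (c a)\<^sup>2 * Re (newton x x)" if x: "x \<in> W" for a x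
  proof -
    have "dnrm (kap (T a x)) \<le> c a * dnrm (kap x)" using dnrm_U[of "kap x" a] x by (simp add: U_kap)
    then have "(dnrm (kap (T a x)))\<^sup>2 \<le> (c a)\<^sup>2 * (dnrm (kap x))\<^sup>2"
      using power_mono[of "dnrm (kap (T a x))" "c a * dnrm (kap x)" 2] x by (simp add: power_mult_distrib)
    then show ?thesis using bound[OF x, of a] x by (simp add: Re_newton distrib_left)
  qed
qed

end

context form_system
begin

text \<open>The last conclusion is what remains of the fixed-point equation: a bound of k(f, .)
  relative to \<open>r\<close> is also a bound relative to every larger iterate, so it limits 2
  P(n+1) - P(n) on the diagonal, and that tends to \<open>r\<close>.\<close>

lemma newton_limit:
  assumes dom: "dominating_form s W k T T' c p"
  obtains r where "dominating_form s W k T T' c r" "\<And>f. f \<in> W \<Longrightarrow> Re (r f f) \<le> Re (p f f)"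
    "\<And>f C. \<lbrakk>f \<in> W; 0 \<le> C; \<And>g. g \<in> W \<Longrightarrow> cmod (k f g) \<le> C * sqrt (Re (r g g))\<rbrakk> \<Longrightarrow> Re (r f f) \<le> C\<^sup>2"
proof -
  \<comment> \<open>Packs the two facts about \<open>newton\<close> into a relation between bare
    forms, to which dependent choice applies.\<close>
  define step where "step q q' \<longleftrightarrow> (\<forall>f\<in>W. Re (q' f f) \<le> Re (q f f)) \<and>
     (\<forall>f\<in>W. \<forall>C\<ge>0. (\<forall>g\<in>W. cmod (k f g) \<le> C * sqrt (Re (q g g))) \<longrightarrow> 2 * Re (q' f f) - Re (q f f) \<le> C\<^sup>2)" for q q'
  have step_D: "2 * Re (q' f f) - Re (q f f) \<le> C\<^sup>2"
    if "step q q'" "f \<in> W" "0 \<le> C" "\<And>g. g \<in> W \<Longrightarrow> cmod (k f g) \<le> C * sqrt (Re (q g g))" for q q' f C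
    using that unfolding step_def by simp
  have step_ex: "\<exists>q'. dominating_form s W k T T' c q' \<and> step q q'" if "dominating_form s W k T T' c q" for q
  proof -
    interpret q: dominating_form s W k T T' c q by fact
    have "dominating_form s W k T T' c q.newton" by (rule q.dominating_newton)
    moreover have "step q q.newton" using q.newton_le q.newton_ge unfolding q.nrm_def step_def by blast
    ultimately show ?thesis by blast
  qed
  have "\<exists>P. \<forall>n. (dominating_form s W k T T' c (P n) \<and> (n = 0 \<longrightarrow> P n = p)) \<and> step (P n) (P (Suc n))"
  proof (rule dependent_nat_choice)
    show "\<exists>q. dominating_form s W k T T' c q \<and> ((0::nat) = 0 \<longrightarrow> q = p)" using dom by blast
    fix q and n :: nat assume "dominating_form s W k T T' c q \<and> (n = 0 \<longrightarrow> q = p)"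
    then obtain q' where "dominating_form s W k T T' c q'" "step q q'" using step_ex by blast
    then show "\<exists>q'. (dominating_form s W k T T' c q' \<and> (Suc n = 0 \<longrightarrow> q' = p)) \<and> step q q'" by blast
  qed
  then obtain P where "\<forall>n. (dominating_form s W k T T' c (P n) \<and> (n = 0 \<longrightarrow> P n = p)) \<and> step (P n) (P (Suc n))"
    by (rule exE)
  then have P: "\<And>n. dominating_form s W k T T' c (P n)" "\<And>n. step (P n) (P (Suc n))" "P 0 = p" by simp_all
  interpret P: dominating_form s W k T T' c "P n" for n by (rule P(1))
  have dec: "decseq (\<lambda>n. Re (P n f f))" if "f \<in> W" for f
    using P(2) that unfolding step_def by (intro decseq_SucI) blast
  define r where "r f g = lim (\<lambda>n. P n f g)" for f g
  have diag: "convergent (\<lambda>n. Re (P n f f))" if "f \<in> W" for f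
    using decseq_convergent[OF dec[OF that], of 0] P.nonneg[OF that] convergentI by blast
  have lim: "(\<lambda>n. P n f g) \<longlonglongrightarrow> r f g" if fg: "f \<in> W" "g \<in> W" for f g
  proof -
    \<comment> \<open>Monotonicity gives convergence only on the diagonal; polarization transfers it
      to all pairs.\<close>
    have "(\<lambda>n. P n f g) = (\<lambda>n. (complex_of_real (Re (P n (f + g) (f + g)) - Re (P n (f - g) (f - g)))
      + \<i> * complex_of_real (Re (P n (f + s \<i> g) (f + s \<i> g)) - Re (P n (f - s \<i> g) (f - s \<i> g)))) / 4)"
    proof
      fix n show "P n f g = (complex_of_real (Re (P n (f + g) (f + g)) - Re (P n (f - g) (f - g)))
      + \<i> * complex_of_real (Re (P n (f + s \<i> g) (f + s \<i> g)) - Re (P n (f - s \<i> g) (f - s \<i> g)))) / 4"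
        unfolding P.polarization[OF fg, symmetric] by simp
    qed
    moreover obtain L1 L2 L3 L4 where "(\<lambda>n. Re (P n (f + g) (f + g))) \<longlonglongrightarrow> L1"
      "(\<lambda>n. Re (P n (f - g) (f - g))) \<longlonglongrightarrow> L2"
      "(\<lambda>n. Re (P n (f + s \<i> g) (f + s \<i> g))) \<longlonglongrightarrow> L3"
      "(\<lambda>n. Re (P n (f - s \<i> g) (f - s \<i> g))) \<longlonglongrightarrow> L4"
      using diag[of "f + g"] diag[of "f - g"] diag[of "f + s \<i> g"] diag[of "f - s \<i> g"] fg
      unfolding convergent_def by auto
    then have "(\<lambda>n. (complex_of_real (Re (P n (f + g) (f + g)) - Re (P n (f - g) (f - g)))
      + \<i> * complex_of_real (Re (P n (f + s \<i> g) (f + s \<i> g)) - Re (P n (f - s \<i> g) (f - s \<i> g)))) / 4)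
      \<longlonglongrightarrow> (complex_of_real (L1 - L2) + \<i> * complex_of_real (L3 - L4)) / 4"
      by (intro tendsto_intros) simp_all
    ultimately have "convergent (\<lambda>n. P n f g)" by (simp only: convergentI)
    then show ?thesis by (simp add: r_def convergent_LIMSEQ_iff)
  qed
  have limRe: "(\<lambda>n. Re (P n f f)) \<longlonglongrightarrow> Re (r f f)" if "f \<in> W" for f
    using lim[OF that that] by (rule tendsto_Re)
  have le: "Re (r f f) \<le> Re (P n f f)" if "f \<in> W" for f n
    using decseq_ge[OF dec[OF that] limRe[OF that]] .
  have r: "dominating_form s W k T T' c r"
  proof
    show "subspace W" by (rule subspace_W)
    fix x y z d a
    show "r (x + y) z = r x z + r y z" if "x \<in> W" "y \<in> W" "z \<in> W"
      using lim[of "x + y" z] tendsto_add[OF lim[of x z] lim[of y z]] that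
      by (simp add: P.add_left LIMSEQ_unique)
    show "r (s d x) y = d * r x y" if "x \<in> W" "y \<in> W"
      using lim[of "s d x" y] tendsto_mult_left[OF lim[of x y], of d] that
      by (simp add: P.scale_left LIMSEQ_unique)
    show "r y x = cnj (r x y)" if "x \<in> W" "y \<in> W"
      using lim[of y x] tendsto_cnj[OF lim[of x y]] that by (simp add: P.herm[symmetric] LIMSEQ_unique)
    show "0 \<le> Re (r x x)" if "x \<in> W"
      using limRe[OF that] by (rule LIMSEQ_le_const) (simp add: P.nonneg that)
    show "\<bar>Re (k x x)\<bar> \<le> Re (r x x)" if "x \<in> W"
      using limRe[OF that] by (rule LIMSEQ_le_const) (simp add: P.dominates that)
    show "r (T a x) y = r x (T' a y)" if "x \<in> W" "y \<in> W"
      using lim[of "T a x" y] lim[of x "T' a y"] that by (simp add: P.adj LIMSEQ_unique)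
    show "Re (r (T a x) (T a x)) \<le> (c a)\<^sup>2 * Re (r x x)" if "x \<in> W"
      using limRe[OF T_in[OF that]] tendsto_mult_left[OF limRe[OF that], of "(c a)\<^sup>2"]
      by (rule LIMSEQ_le) (simp add: P.bound that)
  qed
  moreover have "Re (r f f) \<le> Re (p f f)" if "f \<in> W" for f using le[OF that, of 0] P(3) by simp
  moreover have "Re (r f f) \<le> C\<^sup>2"
    if f: "f \<in> W" and C: "0 \<le> C" "\<And>g. g \<in> W \<Longrightarrow> cmod (k f g) \<le> C * sqrt (Re (r g g))" for f C
  proof -
    have "cmod (k f g) \<le> C * sqrt (Re (P n g g))" if "g \<in> W" for g n
      using C(2)[OF that] mult_left_mono[OF real_sqrt_le_mono[OF le[OF that, of n]] C(1)] by linarith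
    then have "2 * Re (P (Suc n) f f) - Re (P n f f) \<le> C\<^sup>2" for n
      using step_D[OF P(2) f C(1)] by simp
    moreover have "(\<lambda>n. 2 * Re (P (Suc n) f f) - Re (P n f f)) \<longlonglongrightarrow> 2 * Re (r f f) - Re (r f f)"
      by (rule tendsto_diff[OF tendsto_mult_left[OF LIMSEQ_Suc[OF limRe[OF f]]] limRe[OF f]])
    ultimately have "2 * Re (r f f) - Re (r f f) \<le> C\<^sup>2" by (intro LIMSEQ_le_const2) auto
    then show ?thesis by simp
  qed
  ultimately show ?thesis by (rule that)
qed

end

text \<open>At the fixed point of the iteration the dominated form becomes a symmetry on the dual.\<close>

locale sign_form = dominating_form +
  assumes tight: "\<lbrakk>f \<in> W; 0 \<le> C; \<And>g. g \<in> W \<Longrightarrow> cmod (k f g) \<le> C * sqrt (Re (p g g))\<rbrakk> \<Longrightarrow> Re (p f f) \<le> C\<^sup>2"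
begin

interpretation D: psd_form dscale dual dip by (rule psd_form_dual)

text \<open>\<open>dnrm (kap f)\<close> is an admissible constant in \<open>tight\<close>, which
  supplies the inequality that \<open>kap\<close> lacks for being an isometry.\<close>

lemma dnrm_kap: assumes f: "f \<in> W" shows "dnrm (kap f) = nrm f"
proof (rule antisym)
  show "dnrm (kap f) \<le> nrm f" using f by (rule dnrm_kap_le)
  have "Re (p f f) \<le> (dnrm (kap f))\<^sup>2"
  proof (rule tight[OF f])
    show "cmod (k f g) \<le> dnrm (kap f) * sqrt (Re (p g g))" if "g \<in> W" for g
      using dual_apply_le[of "kap f" g] f that by (simp add: nrm_def)
  qed (use f in simp)
  then show "nrm f \<le> dnrm (kap f)"
    using f power2_le_imp_le[of "nrm f" "dnrm (kap f)"] by (simp add: nrm_sq)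
qed

lemma dip_kap: assumes "f \<in> W" "g \<in> W" shows "dip (kap f) (kap g) = p f g"
proof (rule hform_eqI[OF _ hform_axioms _ assms])
  show "hform s W (\<lambda>f g. dip (kap f) (kap g))"
    by unfold_locales
      (auto simp: subspace_W kap_add kap_scale D.add_left D.scale_left intro: D.herm)
  show "Re (dip (kap x) (kap x)) = Re (p x x)" if "x \<in> W" for x
    using that dnrm_kap[of x] D.nrm_sq[of "kap x"] nrm_sq[of x] by simp
qed

text \<open>Pairing with \<open>kap h\<close> defines the symmetry on the whole dual at once, in
  place of extending emb f -> kap f by continuity; \<open>A_emb\<close> shows that it is this
  extension.\<close>

definition A :: "('a \<Rightarrow> complex) \<Rightarrow> 'a \<Rightarrow> complex" where
  "A l = (\<lambda>h. if h \<in> W then dip l (kap h) else 0)"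

lemma A_apply [simp]: "h \<in> W \<Longrightarrow> A l h = dip l (kap h)" by (simp add: A_def)

lemma A_in [simp, intro]: "l \<in> dual \<Longrightarrow> A l \<in> dual"
  using D.Cauchy_Schwarz[of l]
  by (intro dualI[where C = "dnrm l"])
    (auto simp: A_def kap_add kap_scale D.add_right D.scale_right dnrm_kap[symmetric])

lemma A_add: "\<lbrakk>l \<in> dual; m \<in> dual\<rbrakk> \<Longrightarrow> A (l + m) = A l + A m"
  by (rule ext) (simp add: A_def D.add_left)

lemma A_scale: "l \<in> dual \<Longrightarrow> A (dscale d l) = dscale d (A l)"
  by (rule ext) (simp add: A_def D.scale_left)

lemma A_emb: "f \<in> W \<Longrightarrow> A (emb f) = kap f"
  by (rule dual_eqI) (auto simp: dip_emb_left k.herm[symmetric])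

lemma A_kap: "f \<in> W \<Longrightarrow> A (kap f) = emb f"
  by (rule dual_eqI) (auto simp: dip_kap)

text \<open>If emb(b i) tends to \<open>m\<close>, isometry of \<open>kap\<close> makes kap(b i)
  tend to \<open>A m\<close> with the same errors. The pairings of \<open>l\<close> with kap(b i)
  are the values of \<open>A l\<close> at b i, which tend to \<open>dip (A l) m\<close>.\<close>

lemma A_sym: assumes l: "l \<in> dual" and m: "m \<in> dual" shows "dip (A l) m = dip l (A m)"
proof -
  obtain b where b: "approximates b m" using approximates_ex m by blast
  then obtain e where e: "e \<longlonglongrightarrow> 0" "\<And>i. 0 \<le> e i" "\<And>i h. h \<in> W \<Longrightarrow> cmod (m h - p (b i) h) \<le> e i * nrm h"
    unfolding approximates_def by blast
  have bW: "b i \<in> W" for i using approximates_in[OF b] .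
  have me: "dnrm (m - emb (b i)) \<le> e i" for i
    using e m bW by (intro dnrm_leI) auto
  have ke: "dnrm (A m - kap (b i)) \<le> e i" for i
  proof (rule dnrm_leI)
    fix h assume h: "h \<in> W"
    have "(A m - kap (b i)) h = dip (m - emb (b i)) (kap h)"
      using h m bW k.herm[of h "b i"] by (simp add: D.diff_left dip_emb_left)
    then have "cmod ((A m - kap (b i)) h) \<le> dnrm (m - emb (b i)) * nrm h"
      using D.Cauchy_Schwarz[of "m - emb (b i)" "kap h"] h m bW by (simp add: dnrm_kap)
    then show "cmod ((A m - kap (b i)) h) \<le> e i * nrm h"
      using mult_right_mono[OF me[of i] nrm_nonneg[OF h]] by linarith
  qed (use m bW e in auto)
  then have "cmod (dip l (A m) - A l (b i)) \<le> dnrm l * e i" for i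
  proof -
    have "cmod (dip l (A m - kap (b i))) \<le> dnrm l * dnrm (A m - kap (b i))"
      using l m bW by (intro D.Cauchy_Schwarz) auto
    also have "\<dots> \<le> dnrm l * e i" using l ke by (intro mult_left_mono) auto
    finally show ?thesis using l m bW by (simp add: D.diff_right)
  qed
  moreover have "(\<lambda>i. dnrm l * e i) \<longlonglongrightarrow> 0" using tendsto_mult_right_zero[OF e(1)] .
  ultimately have "(\<lambda>i. dip l (A m) - A l (b i)) \<longlonglongrightarrow> 0"
    by (metis (no_types, lifting) Lim_null_comparison always_eventually)
  from tendsto_add[OF this dip_lim[OF A_in[OF l] b]] show ?thesis by (simp add: LIMSEQ_const_iff)
qed

text \<open>Symmetry moves \<open>A\<close> onto \<open>kap h\<close>, where it gives
  \<open>emb h\<close>, and pairing with \<open>emb h\<close> is evaluation at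
  \<open>h\<close>.\<close>

lemma A_A: "l \<in> dual \<Longrightarrow> A (A l) = l"
  by (rule dual_eqI) (auto simp: A_sym A_kap dip_emb)

lemma A_U: "l \<in> dual \<Longrightarrow> A (U a l) = U a (A l)"
  by (rule dual_eqI) (auto simp: U_adjoint U'_kap)

lemma U_add: "\<lbrakk>l \<in> dual; m \<in> dual\<rbrakk> \<Longrightarrow> U a (l + m) = U a l + U a m"
  by (rule ext) (simp add: U_def)

lemma U_scale: "U a (dscale d l) = dscale d (U a l)"
  by (rule ext) (simp add: U_def)

end


section \<open>Hilbert spaces on a carrier\<close>

locale definite_form = psd_form +
  assumes pos: "\<lbrakk>x \<in> W; x \<noteq> 0\<rbrakk> \<Longrightarrow> 0 < Re (p x x)"
begin

lemma nrm_pos: "\<lbrakk>x \<in> W; x \<noteq> 0\<rbrakk> \<Longrightarrow> 0 < nrm x" by (simp add: nrm_def pos)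

lemma nrm_eq_0: "x \<in> W \<Longrightarrow> nrm x = 0 \<longleftrightarrow> x = 0" using nrm_pos[of x] by force

lemma eq_by_form: "\<lbrakk>x \<in> W; y \<in> W; \<And>z. z \<in> W \<Longrightarrow> p z x = p z y\<rbrakk> \<Longrightarrow> x = y"
  using pos[of "x - y"] by (force simp: diff_right)

definition metr :: "'a \<Rightarrow> 'a \<Rightarrow> real" where
  "metr x y = (if x \<in> W \<and> y \<in> W then nrm (x - y) else 0)"

lemma Metric_space_metr: "Metric_space W metr"
  by unfold_locales (auto simp: metr_def nrm_commute nrm_eq_0 nrm_triangle_diff)

interpretation M: Metric_space W metr by (rule Metric_space_metr)

lemma mcomplete_metr:
  "M.mcomplete \<longleftrightarrow> (\<forall>\<sigma>. (\<forall>i. \<sigma> i \<in> W) \<and> (\<forall>e>0. \<exists>N. \<forall>i\<ge>N. \<forall>j\<ge>N. nrm (\<sigma> i - \<sigma> j) < e) \<longrightarrow>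
     (\<exists>l\<in>W. (\<lambda>i. nrm (\<sigma> i - l)) \<longlonglongrightarrow> 0))"
proof -
  have "M.MCauchy \<sigma> \<longleftrightarrow> (\<forall>i. \<sigma> i \<in> W) \<and> (\<forall>e>0. \<exists>N. \<forall>i\<ge>N. \<forall>j\<ge>N. nrm (\<sigma> i - \<sigma> j) < e)" for \<sigma>
    unfolding M.MCauchy_def metr_def image_subset_iff by auto
  moreover have "limitin M.mtopology \<sigma> l sequentially \<longleftrightarrow> l \<in> W \<and> (\<lambda>i. nrm (\<sigma> i - l)) \<longlonglongrightarrow> 0"
    if "\<forall>i. \<sigma> i \<in> W" for \<sigma> l
    using that by (auto simp: M.limitin_metric_dist_null metr_def)
  ultimately show ?thesis unfolding M.mcomplete_def by metis
qed

lemma closure_of_metr: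
  "A \<subseteq> W \<Longrightarrow> M.mtopology closure_of A = W \<longleftrightarrow> (\<forall>x\<in>W. \<forall>e>0. \<exists>a\<in>A. nrm (x - a) < e)"
  unfolding M.metric_closure_of by (auto simp: metr_def subset_iff set_eq_iff) blast+

end

locale hilbert_form = definite_form +
  assumes complete: "\<lbrakk>\<And>i. \<sigma> i \<in> W; \<And>e. e > 0 \<Longrightarrow> \<exists>N. \<forall>i\<ge>N. \<forall>j\<ge>N. nrm (\<sigma> i - \<sigma> j) < e\<rbrakk>
      \<Longrightarrow> \<exists>l\<in>W. (\<lambda>i. nrm (\<sigma> i - l)) \<longlonglongrightarrow> 0"
begin

interpretation M: Metric_space W metr by (rule Metric_space_metr)

lemma mcomplete: "M.mcomplete"
  unfolding mcomplete_metr using complete by blast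

text \<open>Approximating sequences are Cauchy by \<open>approximates_bound\<close>; completeness
  supplies a limit, and the limit represents \<open>l\<close>.\<close>

lemma dual_represented:
  assumes l: "l \<in> dual"
  obtains w where "w \<in> W" "\<And>h. h \<in> W \<Longrightarrow> l h = p w h"
proof -
  obtain b where b: "approximates b l" using approximates_ex l by blast
  then obtain e where e: "e \<longlonglongrightarrow> 0" "\<And>i. 0 \<le> e i" "\<And>i h. h \<in> W \<Longrightarrow> cmod (l h - p (b i) h) \<le> e i * nrm h"
    unfolding approximates_def by blast
  have bW: "b i \<in> W" for i using approximates_in[OF b] .
  obtain c d where cd: "c \<longlonglongrightarrow> 0" "d \<longlonglongrightarrow> 0" "\<And>i j. nrm (b i - b j) \<le> c i + d j"
    by (rule approximates_bound[OF b b]) blast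
  have Cau: "\<exists>N. \<forall>i\<ge>N. \<forall>j\<ge>N. nrm (b i - b j) < r" if r: "r > 0" for r
  proof -
    have "\<forall>\<^sub>F i in sequentially. c i < r / 2" "\<forall>\<^sub>F i in sequentially. d i < r / 2"
      using order_tendstoD(2)[of _ 0 sequentially "r / 2"] cd r by simp_all
    then obtain M N where MN: "\<And>i. i \<ge> M \<Longrightarrow> c i < r / 2" "\<And>i. i \<ge> N \<Longrightarrow> d i < r / 2"
      unfolding eventually_sequentially by blast
    have "nrm (b i - b j) < r" if "i \<ge> max M N" "j \<ge> max M N" for i j
      using cd(3)[of i j] MN(1)[of i] MN(2)[of j] that by simp
    then show ?thesis by blast
  qed
  obtain w where w: "w \<in> W" "(\<lambda>i. nrm (b i - w)) \<longlonglongrightarrow> 0" using complete[OF bW Cau] by blast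
  have "l h = p w h" if h: "h \<in> W" for h
  proof -
    have "cmod (l h - p w h) \<le> e i * nrm h + nrm (b i - w) * nrm h" for i
      using e(3)[OF h, of i] Cauchy_Schwarz[of "b i - w" h] bW w h
        norm_triangle_ineq[of "l h - p (b i) h" "p (b i - w) h"]
      by (simp add: diff_left)
    moreover have "(\<lambda>i. e i * nrm h + nrm (b i - w) * nrm h) \<longlonglongrightarrow> 0"
      using tendsto_add_zero[OF tendsto_mult_left_zero[OF e(1)] tendsto_mult_left_zero[OF w(2)]] .
    ultimately have "cmod (l h - p w h) \<le> 0" by (intro LIMSEQ_le_const) auto
    then show ?thesis by simp
  qed
  with w that show ?thesis by blast
qed

text \<open>Conjugation turns \<open>l\<close> into a member of \<open>dual\<close>, whose elements
  are conjugate linear.\<close>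

lemma riesz:
  assumes "\<And>x y. \<lbrakk>x \<in> W; y \<in> W\<rbrakk> \<Longrightarrow> l (x + y) = l x + l y" "\<And>c x. x \<in> W \<Longrightarrow> l (s c x) = c * l x"
    and "\<And>x. x \<in> W \<Longrightarrow> cmod (l x) \<le> C * nrm x"
  obtains w where "w \<in> W" "\<And>h. h \<in> W \<Longrightarrow> l h = p h w"
proof -
  have "(\<lambda>x. if x \<in> W then cnj (l x) else 0) \<in> dual"
    using assms by (intro dualI[where C = C]) auto
  then obtain w where w: "w \<in> W" "\<And>h. h \<in> W \<Longrightarrow> (if h \<in> W then cnj (l h) else 0) = p w h"
    by (rule dual_represented) blast
  have "l h = p h w" if "h \<in> W" for h
    using w(2)[OF that] herm[OF w(1) that] that by (metis complex_cnj_cnj)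
  with w that show ?thesis by blast
qed

text \<open>Uniform boundedness: otherwise the points at which some \<open>p _ y\<close> exceeds \<open>n\<close> form a dense open
  set for every \<open>n\<close>, against Baire's theorem.\<close>

lemma uniform_bound:
  assumes Y: "Y \<subseteq> W" and ptw: "\<And>x. x \<in> W \<Longrightarrow> \<exists>C. \<forall>y\<in>Y. cmod (p x y) \<le> C"
  shows "\<exists>C\<ge>0. \<forall>x\<in>W. \<forall>y\<in>Y. cmod (p x y) \<le> C * nrm x"
proof (rule ccontr)
  assume neg: "\<not> ?thesis"
  define G where "G n = {x\<in>W. \<exists>y\<in>Y. real n < cmod (p x y)}" for n
  have GW: "G n \<subseteq> W" for n by (auto simp: G_def)
  have "openin M.mtopology (G n)" for n
    unfolding M.openin_mtopology
  proof (intro conjI allI impI GW)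
    fix x assume "x \<in> G n"
    then obtain y where y: "x \<in> W" "y \<in> Y" "y \<in> W" "real n < cmod (p x y)" using Y by (auto simp: G_def)
    \<comment> \<open>On this ball p(., y) changes by less than its excess over \<open>n\<close>;
      the summand 1 covers a vanishing \<open>y\<close>.\<close>
    define r where "r = (cmod (p x y) - real n) / (nrm y + 1)"
    have n1: "nrm y + 1 > 0" using y by (simp add: add_nonneg_pos)
    have "z \<in> G n" if "z \<in> M.mball x r" for z
    proof -
      have z: "z \<in> W" "nrm (x - z) < r" using that y by (auto simp: metr_def)
      have "cmod (p (x - z) y) \<le> nrm (x - z) * nrm y" using y z by (intro Cauchy_Schwarz) auto
      also have "\<dots> \<le> r * nrm y" using z y by (intro mult_right_mono) auto
      also have "\<dots> < r * (nrm y + 1)" using z y order_le_less_trans[OF nrm_nonneg z(2)] by (intro mult_strict_left_mono) auto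
      also have "\<dots> = cmod (p x y) - real n" using n1 by (simp add: r_def)
      finally have "real n < cmod (p z y)"
        using norm_triangle_ineq2[of "p x y" "p z y"] y z by (simp add: diff_left)
      with z y show ?thesis by (auto simp: G_def)
    qed
    then show "\<exists>r>0. M.mball x r \<subseteq> G n" using y n1 by (intro exI[of _ r]) (auto simp: r_def)
  qed
  moreover have "M.mtopology closure_of G n = W" for n
    unfolding closure_of_metr[OF GW]
  proof (intro ballI allI impI)
    fix x and r :: real assume x: "x \<in> W" and r: "r > 0"
    have "2 * real n / r \<ge> 0" using r by simp
    then obtain z y where z: "z \<in> W" "y \<in> Y" "y \<in> W" "2 * real n / r * nrm z < cmod (p z y)"
      using neg Y by (meson not_le subsetD)
    have "nrm z \<noteq> 0" using z Cauchy_Schwarz[of z y] by auto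
    then have nz: "nrm z > 0" using nrm_nonneg[OF z(1)] by linarith
    \<comment> \<open>Rescaled to norm r / 2, the vector still has |p(w, y)| > n: this is why
      \<open>z\<close> was chosen with the factor 2 n / r.\<close>
    define w where "w = s (complex_of_real (r / (2 * nrm z))) z"
    have w: "w \<in> W" "nrm w = r / 2" using z nz r by (simp_all add: w_def nrm_scale norm_divide norm_mult)
    have "cmod (p w y) = r / (2 * nrm z) * cmod (p z y)"
      using z nz r by (simp add: w_def scale_left norm_mult norm_divide)
    also have "\<dots> > r / (2 * nrm z) * (2 * real n / r * nrm z)"
      using z(4) nz r by (intro mult_strict_left_mono) auto
    finally have pw: "real n < cmod (p w y)" using nz r by simp
    \<comment> \<open>The values at x + w and x - w differ by 2 p(w, y), so they cannot both have
      modulus at most \<open>n\<close>.\<close>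
    have "real n < cmod (p (x + w) y) \<or> real n < cmod (p (x - w) y)"
    proof -
      have "2 * cmod (p w y) = cmod (p (x + w) y - p (x - w) y)"
        using x w z by (simp add: add_left diff_left norm_mult flip: mult_2)
      also have "\<dots> \<le> cmod (p (x + w) y) + cmod (p (x - w) y)" by (rule norm_triangle_ineq4)
      finally show ?thesis using pw by linarith
    qed
    then have "x + w \<in> G n \<or> x - w \<in> G n" using x w z by (auto simp: G_def)
    moreover have "nrm (x - (x + w)) < r" "nrm (x - (x - w)) < r" using w r by (simp_all add: nrm_minus)
    ultimately show "\<exists>a\<in>G n. nrm (x - a) < r" by blast
  qed
  ultimately have "M.mtopology closure_of \<Inter>(range G) = W"
    by (intro M.metric_Baire_category mcomplete) auto
  then have "\<Inter>(range G) \<noteq> {}" using W_intros(1) by (metis closure_of_empty empty_iff)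
  then obtain x where "x \<in> \<Inter>(range G)" by (meson ex_in_conv)
  then have x: "x \<in> G n" for n by simp
  then have "x \<in> W" using GW by (meson subsetD)
  then obtain C where C: "\<And>y. y \<in> Y \<Longrightarrow> cmod (p x y) \<le> C" using ptw by meson
  obtain n where "C \<le> real n" using real_arch_simple by blast
  with x[of n] C show False unfolding G_def by fastforce
qed

end

lemma (in psd_form) hilbert_form_dual: "hilbert_form dscale dual dip"
proof -
  interpret D: psd_form dscale dual dip by (rule psd_form_dual)
  show ?thesis
  proof
    show "0 < Re (dip l l)" if "l \<in> dual" "l \<noteq> 0" for l
      using dnrm_pos[OF that] by (simp add: D.nrm_def)
  qed (rule dual_complete)
qed

lemma hform_iff_inner_product_space: "inner_product_space E \<longleftrightarrow> hform (scale E) (vecs E) (ip E)"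
  unfolding inner_product_space_def hform_def hform_axioms_def
  by blast

text \<open>The metric of the locale is available only for a definite form; for any other form both
  sides fail.\<close>

lemma hilbert_space_iff: "hilbert_space E \<longleftrightarrow> hilbert_form (scale E) (vecs E) (ip E)"
proof (cases "inner_product_space E \<and> (\<forall>x\<in>vecs E. x \<noteq> 0 \<longrightarrow> 0 < Re (ip E x x))")
  case True
  then interpret hform "scale E" "vecs E" "ip E" by (simp add: hform_iff_inner_product_space)
  interpret definite_form "scale E" "vecs E" "ip E"
    using True by unfold_locales (metis less_eq_real_def zero_left W_intros(1) zero_complex.simps(1), blast)
  have "idist E = metr"
    by (auto simp: fun_eq_iff idist_def metr_def inorm_def nrm_def)
  then have "hilbert_space E \<longleftrightarrow> Metric_space.mcomplete (vecs E) metr" using True by (simp add: hilbert_space_def)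
  also have "\<dots> \<longleftrightarrow> hilbert_form_axioms (vecs E) (ip E)"
    unfolding mcomplete_metr hilbert_form_axioms_def by blast
  also have "\<dots> \<longleftrightarrow> hilbert_form (scale E) (vecs E) (ip E)"
    using definite_form_axioms by (simp add: hilbert_form_def)
  finally show ?thesis .
next
  case False
  then show ?thesis
    by (auto simp: hilbert_space_def hform_iff_inner_product_space hilbert_form_def definite_form_def
        definite_form_axioms_def psd_form_def)
qed


section \<open>Krein spaces\<close>

locale krein_pair =
  fixes E :: "'a::ab_group_add ispace" and g :: "'a \<Rightarrow> 'a \<Rightarrow> complex" and J :: "'a \<Rightarrow> 'a"
  assumes pair: "fundamental_pair E g J"

sublocale krein_pair \<subseteq> hilbert_form "scale E" "vecs E" g
  using pair by (simp add: fundamental_pair_def hilbert_space_iff)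

context krein_pair
begin

lemma J_in [simp, intro]: "x \<in> vecs E \<Longrightarrow> J x \<in> vecs E"
  and J_add: "\<lbrakk>x \<in> vecs E; y \<in> vecs E\<rbrakk> \<Longrightarrow> J (x + y) = J x + J y"
  and J_scale: "x \<in> vecs E \<Longrightarrow> J (scale E c x) = scale E c (J x)"
  and J_J: "x \<in> vecs E \<Longrightarrow> J (J x) = x"
  and J_sym: "\<lbrakk>x \<in> vecs E; y \<in> vecs E\<rbrakk> \<Longrightarrow> g (J x) y = g x (J y)"
  and ip_eq: "\<lbrakk>x \<in> vecs E; y \<in> vecs E\<rbrakk> \<Longrightarrow> ip E x y = g (J x) y"
  using pair by (auto simp: fundamental_pair_def linear_on_def)

lemma g_eq: "\<lbrakk>x \<in> vecs E; y \<in> vecs E\<rbrakk> \<Longrightarrow> g x y = ip E (J x) y"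
  by (simp add: ip_eq J_J)

lemma nrm_J: "x \<in> vecs E \<Longrightarrow> nrm (J x) = nrm x"
  by (simp add: nrm_def J_sym J_J)

lemma ip_bound: "\<lbrakk>x \<in> vecs E; y \<in> vecs E\<rbrakk> \<Longrightarrow> cmod (ip E x y) \<le> nrm x * nrm y"
  using Cauchy_Schwarz[of "J x" y] by (simp add: ip_eq nrm_J)

lemma hform_ip: "hform (scale E) (vecs E) (ip E)"
proof unfold_locales
  fix x y assume "x \<in> vecs E" "y \<in> vecs E"
  then show "ip E y x = cnj (ip E x y)" using herm[of x "J y"] by (simp add: ip_eq J_sym)
qed (auto simp: subspace_W ip_eq J_add J_scale add_left scale_left)

lemma inorm_eq: "inorm (E\<lparr>ip := g\<rparr>) x = nrm x" by (simp add: inorm_def nrm_def)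

lemma idist_eq: "idist (E\<lparr>ip := g\<rparr>) = metr" by (auto simp: fun_eq_iff idist_def metr_def inorm_eq)

lemma hilbert_structure: "hilbert_structure E g" using pair by (auto simp: hilbert_structure_def)

lemma krein_space: "krein_space E"
  using hilbert_structure hform_ip by (auto simp: krein_space_def hform_iff_inner_product_space)

lemma ip_eqI:
  assumes "x \<in> vecs E" "y \<in> vecs E" "\<And>z. z \<in> vecs E \<Longrightarrow> ip E z x = ip E z y"
  shows "x = y"
  using assms g_eq by (intro eq_by_form) auto

end

lemma krein_pairI:
  assumes "hilbert_form (scale E) (vecs E) g"
    and "\<And>x. x \<in> vecs E \<Longrightarrow> J x \<in> vecs E"
    and "\<And>x y. \<lbrakk>x \<in> vecs E; y \<in> vecs E\<rbrakk> \<Longrightarrow> J (x + y) = J x + J y"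
    and "\<And>c x. x \<in> vecs E \<Longrightarrow> J (scale E c x) = scale E c (J x)"
    and "\<And>x. x \<in> vecs E \<Longrightarrow> J (J x) = x"
    and "\<And>x y. \<lbrakk>x \<in> vecs E; y \<in> vecs E\<rbrakk> \<Longrightarrow> g (J x) y = g x (J y)"
    and "\<And>x y. \<lbrakk>x \<in> vecs E; y \<in> vecs E\<rbrakk> \<Longrightarrow> ip E x y = g (J x) y"
  shows "krein_pair E g J"
  using assms by (simp add: krein_pair_def fundamental_pair_def hilbert_space_iff linear_on_def)

lemma hilbert_structureE:
  assumes "hilbert_structure E g" obtains J where "krein_pair E g J"
  using assms by (auto simp: hilbert_structure_def krein_pair_def)

lemma krein_spaceE:
  assumes "krein_space E" obtains g J where "krein_pair E g J"
  using assms by (auto simp: krein_space_def elim: hilbert_structureE)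

section \<open>Independence of the choice of Hilbert structure\<close>

lemma hilbert_structures_equivalent:
  assumes "hilbert_structure E g" "hilbert_structure E h"
  shows "\<exists>C\<ge>0. \<forall>x\<in>vecs E. inorm (E\<lparr>ip := h\<rparr>) x \<le> C * inorm (E\<lparr>ip := g\<rparr>) x"
proof -
  obtain J where "krein_pair E g J" using assms(1) by (rule hilbert_structureE)
  then interpret g: krein_pair E g J .
  obtain I where "krein_pair E h I" using assms(2) by (rule hilbert_structureE)
  then interpret h: krein_pair E h I .
  \<comment> \<open>The image under \<open>J\<close> of the unit ball of \<open>h\<close>. As g x (J
    y) is ip E x y, which is at most the \<open>h\<close>-norm of \<open>x\<close>, this family is
    pointwise bounded, and uniform boundedness estimates ip E x y by the \<open>g\<close>-norm of
    \<open>x\<close>.\<close>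
  define Y where "Y = {J y |y. y \<in> vecs E \<and> h.nrm y \<le> 1}"
  have gY: "g x (J y) = ip E x y" if "x \<in> vecs E" "y \<in> vecs E" for x y
    using that by (simp add: g.ip_eq g.J_sym)
  have "\<exists>C\<ge>0. \<forall>x\<in>vecs E. \<forall>y\<in>Y. cmod (g x y) \<le> C * g.nrm x"
  proof (rule g.uniform_bound)
    show "Y \<subseteq> vecs E" by (auto simp: Y_def)
    fix x assume x: "x \<in> vecs E"
    have "cmod (g x (J y)) \<le> h.nrm x" if "y \<in> vecs E" "h.nrm y \<le> 1" for y
      using h.ip_bound[OF x that(1)] mult_left_mono[OF that(2) h.nrm_nonneg[OF x]] x that by (simp add: gY)
    then show "\<exists>C. \<forall>y\<in>Y. cmod (g x y) \<le> C" by (auto simp: Y_def)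
  qed
  then obtain C where C: "C \<ge> 0" "\<And>x y. x \<in> vecs E \<Longrightarrow> y \<in> vecs E \<Longrightarrow> h.nrm y \<le> 1 \<Longrightarrow> cmod (ip E x y) \<le> C * g.nrm x"
    unfolding Y_def using gY by (metis (mono_tags, lifting) mem_Collect_eq)
  have "h.nrm x \<le> C * g.nrm x" if x: "x \<in> vecs E" for x
  proof (cases "h.nrm x = 0")
    case True then show ?thesis using C x by simp
  next
    case False
    then have n: "h.nrm x > 0" using h.nrm_nonneg[OF x] by linarith
    \<comment> \<open>The normalization of \<open>I x\<close>, at which ip E x y attains the
      \<open>h\<close>-norm of \<open>x\<close>.\<close>
    define y where "y = scale E (complex_of_real (inverse (h.nrm x))) (I x)"
    have y: "y \<in> vecs E" "h.nrm y \<le> 1" using x n by (simp_all add: y_def h.nrm_scale h.nrm_J norm_inverse)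
    have "ip E x y = complex_of_real (inverse (h.nrm x)) * h x x"
      using x by (simp add: y_def h.ip_eq h.scale_right h.J_sym h.J_J)
    also have "h x x = complex_of_real ((h.nrm x)\<^sup>2)" using h.diag[OF x] by (simp add: h.nrm_sq[OF x])
    finally have "cmod (ip E x y) = h.nrm x" using n by (simp add: norm_mult norm_inverse power2_eq_square)
    then show ?thesis using C(2)[OF x y] by simp
  qed
  with C show ?thesis by (auto simp: g.inorm_eq h.inorm_eq)
qed

text \<open>Equivalence of norms replaces the Hilbert structures chosen in the definition by the
  given ones; only the constant changes.\<close>

lemma bounded_operator_iff:
  assumes "krein_pair E g J" "krein_pair F h I"
  shows "bounded_operator E F T \<longleftrightarrow>
    linear_on E F T \<and> (\<exists>c\<ge>0. \<forall>x\<in>vecs E. psd_form.nrm h (T x) \<le> c * psd_form.nrm g x)"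
proof -
  interpret E: krein_pair E g J by fact
  interpret F: krein_pair F h I by fact
  show ?thesis
  proof
    assume "bounded_operator E F T"
    then obtain g' h' c where lin: "linear_on E F T"
      and gh: "hilbert_structure E g'" "hilbert_structure F h'"
      and c: "\<And>x. x \<in> vecs E \<Longrightarrow> inorm (F\<lparr>ip := h'\<rparr>) (T x) \<le> c * inorm (E\<lparr>ip := g'\<rparr>) x"
      unfolding bounded_operator_def by blast
    obtain C where C: "C \<ge> 0" "\<And>x. x \<in> vecs E \<Longrightarrow> inorm (E\<lparr>ip := g'\<rparr>) x \<le> C * E.nrm x"
      using hilbert_structures_equivalent[OF E.hilbert_structure gh(1)] by (auto simp: E.inorm_eq)
    obtain D where D: "D \<ge> 0" "\<And>x. x \<in> vecs F \<Longrightarrow> F.nrm x \<le> D * inorm (F\<lparr>ip := h'\<rparr>) x"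
      using hilbert_structures_equivalent[OF gh(2) F.hilbert_structure] by (auto simp: F.inorm_eq)
    obtain J' where "krein_pair E g' J'" using gh(1) by (rule hilbert_structureE)
    then interpret E': krein_pair E g' J' .
    have "F.nrm (T x) \<le> (D * \<bar>c\<bar> * C) * E.nrm x" if x: "x \<in> vecs E" for x
    proof -
      have Tx: "T x \<in> vecs F" using lin x by (simp add: linear_on_def)
      have "F.nrm (T x) \<le> D * inorm (F\<lparr>ip := h'\<rparr>) (T x)" using D(2)[OF Tx] .
      also have "\<dots> \<le> D * (\<bar>c\<bar> * inorm (E\<lparr>ip := g'\<rparr>) x)"
        using c[OF x] D(1) E'.nrm_nonneg[OF x] abs_ge_self[of c]
        by (intro mult_left_mono) (auto simp: E'.inorm_eq intro: order_trans mult_right_mono)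
      also have "\<dots> \<le> D * (\<bar>c\<bar> * (C * E.nrm x))"
        using C(2)[OF x] D(1) by (intro mult_left_mono) auto
      finally show ?thesis by (simp add: mult_ac)
    qed
    moreover have "0 \<le> D * \<bar>c\<bar> * C" using C D by simp
    ultimately show "linear_on E F T \<and> (\<exists>c\<ge>0. \<forall>x\<in>vecs E. F.nrm (T x) \<le> c * E.nrm x)" using lin by blast
  next
    assume "linear_on E F T \<and> (\<exists>c\<ge>0. \<forall>x\<in>vecs E. F.nrm (T x) \<le> c * E.nrm x)"
    then show "bounded_operator E F T"
      unfolding bounded_operator_def
      by (metis E.hilbert_structure F.hilbert_structure E.inorm_eq F.inorm_eq)
  qed
qed

lemma (in krein_pair) dense_in_iff:
  assumes "A \<subseteq> vecs E"
  shows "dense_in E A \<longleftrightarrow> (\<forall>x\<in>vecs E. \<forall>e>0. \<exists>a\<in>A. nrm (x - a) < e)"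
proof
  assume "dense_in E A"
  then obtain h where h: "hilbert_structure E h"
    and cl: "Metric_space.mtopology (vecs E) (idist (E\<lparr>ip := h\<rparr>)) closure_of A = vecs E"
    unfolding dense_in_def by blast
  obtain I where "krein_pair E h I" using h by (rule hilbert_structureE)
  then interpret h: krein_pair E h I .
  obtain C where C: "C \<ge> 0" "\<And>x. x \<in> vecs E \<Longrightarrow> nrm x \<le> C * h.nrm x"
    using hilbert_structures_equivalent[OF h hilbert_structure] by (auto simp: h.inorm_eq inorm_eq)
  show "\<forall>x\<in>vecs E. \<forall>e>0. \<exists>a\<in>A. nrm (x - a) < e"
  proof (intro ballI allI impI)
    fix x and e :: real assume x: "x \<in> vecs E" and e: "e > 0"
    have "e / (C + 1) > 0" using C e by simp
    then obtain a where a: "a \<in> A" "h.nrm (x - a) < e / (C + 1)"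
      using cl x unfolding h.idist_eq h.closure_of_metr[OF assms] by blast
    have xa: "x - a \<in> vecs E" using x a assms by auto
    have "nrm (x - a) \<le> (C + 1) * h.nrm (x - a)"
      using C(2)[OF xa] h.nrm_nonneg[OF xa] by (simp add: distrib_right)
    also have "\<dots> < e" using a C by (simp add: field_simps)
    finally show "\<exists>a\<in>A. nrm (x - a) < e" using a by blast
  qed
next
  assume "\<forall>x\<in>vecs E. \<forall>e>0. \<exists>a\<in>A. nrm (x - a) < e"
  then have "Metric_space.mtopology (vecs E) (idist (E\<lparr>ip := g\<rparr>)) closure_of A = vecs E"
    unfolding idist_eq closure_of_metr[OF assms] .
  then show "dense_in E A" using hilbert_structure by (auto simp: dense_in_def)
qed

section \<open>Operators between Krein spaces and their adjoints\<close>

locale krein_operator = E: krein_pair E g J + F: krein_pair F h I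
  for E :: "'a::ab_group_add ispace" and g J and F :: "'b::ab_group_add ispace" and h I +
  fixes T
  assumes bounded: "bounded_operator E F T"
begin

lemma T_in [simp, intro]: "x \<in> vecs E \<Longrightarrow> T x \<in> vecs F"
  and T_add: "\<lbrakk>x \<in> vecs E; y \<in> vecs E\<rbrakk> \<Longrightarrow> T (x + y) = T x + T y"
  and T_scale: "x \<in> vecs E \<Longrightarrow> T (scale E c x) = scale F c (T x)"
  using bounded by (auto simp: bounded_operator_def linear_on_def)

lemma T_bound: obtains c where "c \<ge> 0" "\<And>x. x \<in> vecs E \<Longrightarrow> F.nrm (T x) \<le> c * E.nrm x"
  using bounded bounded_operator_iff[OF E.krein_pair_axioms F.krein_pair_axioms] by blast

lemma T_minus: "x \<in> vecs E \<Longrightarrow> T (- x) = - T x"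
  using T_scale[of x "-1"] by simp

lemma T_zero: "T 0 = 0"
  using T_scale[of 0 0] by simp

lemma T_diff: "\<lbrakk>x \<in> vecs E; y \<in> vecs E\<rbrakk> \<Longrightarrow> T (x - y) = T x - T y"
  using T_add[of x "-y"] T_minus[of y] by simp

lemma T_sum: "(\<And>i. i \<in> A \<Longrightarrow> f i \<in> vecs E) \<Longrightarrow> T (sum f A) = (\<Sum>i\<in>A. T (f i))"
  by (induction A rule: infinite_finite_induct) (auto simp: T_zero T_add E.W_sum)

text \<open>Riesz represents x -> ip F (T x) y by a vector \<open>w\<close> with respect to
  \<open>g\<close>; \<open>J w\<close> then represents it in the indefinite product.\<close>

lemma adj_ex:
  assumes y: "y \<in> vecs F"
  obtains z where "z \<in> vecs E" "\<And>x. x \<in> vecs E \<Longrightarrow> ip F (T x) y = ip E x z"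
proof -
  interpret F': hform "scale F" "vecs F" "ip F" by (rule F.hform_ip)
  obtain c where c: "c \<ge> 0" "\<And>x. x \<in> vecs E \<Longrightarrow> F.nrm (T x) \<le> c * E.nrm x" using T_bound by blast
  have "cmod (ip F (T x) y) \<le> (c * F.nrm y) * E.nrm x" if x: "x \<in> vecs E" for x
    using F.ip_bound[OF T_in[OF x] y] mult_right_mono[OF c(2)[OF x] F.nrm_nonneg[OF y]] by (simp add: mult_ac)
  then obtain w where w: "w \<in> vecs E" "\<And>x. x \<in> vecs E \<Longrightarrow> ip F (T x) y = g x w"
    using y by (rule_tac l = "\<lambda>x. ip F (T x) y" in E.riesz) (auto simp: T_add T_scale F'.add_left F'.scale_left)
  have "ip F (T x) y = ip E x (J w)" if "x \<in> vecs E" for x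
    using w that by (simp add: E.ip_eq E.J_sym E.J_J)
  with w that show ?thesis by blast
qed

lemma adj_eqI:
  assumes "z \<in> vecs E" "\<And>x. x \<in> vecs E \<Longrightarrow> ip F (T x) y = ip E x z"
  shows "adj E F T y = z"
  unfolding adj_def using assms by (intro the_equality conjI ballI) (auto intro: E.ip_eqI)

lemma adj_in [simp, intro]: "y \<in> vecs F \<Longrightarrow> adj E F T y \<in> vecs E"
  and ip_adj: "\<lbrakk>x \<in> vecs E; y \<in> vecs F\<rbrakk> \<Longrightarrow> ip E x (adj E F T y) = ip F (T x) y"
  by (metis adj_ex adj_eqI)+

text \<open>The \<open>g\<close>-product of the adjoint at \<open>y\<close> with \<open>x\<close> is
  the conjugate of ip F (T (J x)) y, so the constant of \<open>T\<close> carries over.\<close>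

lemma bounded_adj: "bounded_operator F E (adj E F T)"
proof -
  interpret E': hform "scale E" "vecs E" "ip E" by (rule E.hform_ip)
  interpret F': hform "scale F" "vecs F" "ip F" by (rule F.hform_ip)
  obtain c where c: "c \<ge> 0" "\<And>x. x \<in> vecs E \<Longrightarrow> F.nrm (T x) \<le> c * E.nrm x" using T_bound by blast
  have "E.nrm (adj E F T y) \<le> c * F.nrm y" if y: "y \<in> vecs F" for y
  proof (rule E.nrm_leI)
    fix x assume x: "x \<in> vecs E"
    have "g (adj E F T y) x = cnj (ip E (J x) (adj E F T y))"
      using x y E.herm[of x "adj E F T y"] by (simp add: E.ip_eq E.J_J)
    also have "\<dots> = cnj (ip F (T (J x)) y)" using x y by (simp add: ip_adj)
    finally have "cmod (g (adj E F T y) x) \<le> F.nrm (T (J x)) * F.nrm y"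
      using F.ip_bound[of "T (J x)" y] x y by simp
    also have "\<dots> \<le> (c * E.nrm x) * F.nrm y"
      using c(2)[of "J x"] x y by (intro mult_right_mono) (auto simp: E.nrm_J)
    finally show "cmod (g (adj E F T y) x) \<le> c * F.nrm y * E.nrm x" by (simp add: mult_ac)
  qed (use y c in auto)
  moreover have "linear_on F E (adj E F T)"
    unfolding linear_on_def
    by (intro conjI ballI allI adj_in adj_eqI)
      (auto simp: E'.add_right F'.add_right E'.scale_right F'.scale_right ip_adj)
  ultimately show ?thesis
    using c(1) by (auto simp: bounded_operator_iff[OF F.krein_pair_axioms E.krein_pair_axioms])
qed

end

lemma krein_operatorI: "\<lbrakk>krein_pair E g J; krein_pair F h I; bounded_operator E F T\<rbrakk> \<Longrightarrow> krein_operator E g J F h I T"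
  by (simp add: krein_operator_def krein_operator_axioms_def)

lemma bounded_operator_comp:
  assumes E: "krein_pair E g J" and F: "krein_pair F h I" and G: "krein_pair G k L"
    and S: "bounded_operator E F S" and T: "bounded_operator F G T"
  shows "bounded_operator E G (\<lambda>x. T (S x))"
proof -
  interpret S: krein_operator E g J F h I S using E F S by (rule krein_operatorI)
  interpret T: krein_operator F h I G k L T using F G T by (rule krein_operatorI)
  obtain c where c: "c \<ge> 0" "\<And>x. x \<in> vecs E \<Longrightarrow> S.F.nrm (S x) \<le> c * S.E.nrm x" using S.T_bound by blast
  obtain d where d: "d \<ge> 0" "\<And>x. x \<in> vecs F \<Longrightarrow> T.F.nrm (T x) \<le> d * S.F.nrm x" using T.T_bound by blast
  have "T.F.nrm (T (S x)) \<le> (d * c) * S.E.nrm x" if "x \<in> vecs E" for x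
    using d(2)[of "S x"] mult_left_mono[OF c(2)[OF that] d(1)] that by simp
  then show ?thesis
    using c d by (auto simp: bounded_operator_iff[OF E G] linear_on_def S.T_add S.T_scale T.T_add T.T_scale
        intro!: exI[of _ "d * c"])
qed

section \<open>Transport of a Krein space along a linear injection\<close>

locale krein_transport = krein_pair E g J
  for E :: "'a::ab_group_add ispace" and g J +
  fixes sF :: "complex \<Rightarrow> 'b::ab_group_add \<Rightarrow> 'b" and \<Theta> :: "'a \<Rightarrow> 'b"
  assumes vsF: "vector_space sF"
    and \<Theta>_add: "\<lbrakk>x \<in> vecs E; y \<in> vecs E\<rbrakk> \<Longrightarrow> \<Theta> (x + y) = \<Theta> x + \<Theta> y"
    and \<Theta>_scale: "x \<in> vecs E \<Longrightarrow> \<Theta> (scale E c x) = sF c (\<Theta> x)"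
    and \<Theta>_inj: "inj_on \<Theta> (vecs E)"
begin

definition \<Theta>i :: "'b \<Rightarrow> 'a" where "\<Theta>i = inv_into (vecs E) \<Theta>"

lemma \<Theta>i_\<Theta> [simp]: "x \<in> vecs E \<Longrightarrow> \<Theta>i (\<Theta> x) = x" using \<Theta>_inj by (simp add: \<Theta>i_def)

text \<open>The structure carried to the image of \<Theta>. It serves to turn the functionals that
  form the Krein space into functions of type \<open>'x \<Rightarrow> 'h\<close>.\<close>

definition F :: "'b ispace" where
  "F = \<lparr>vecs = \<Theta> ` vecs E, scale = sF, ip = (\<lambda>x y. ip E (\<Theta>i x) (\<Theta>i y))\<rparr>"

lemma F_simps [simp]: "vecs F = \<Theta> ` vecs E" "scale F = sF" "ip F x y = ip E (\<Theta>i x) (\<Theta>i y)"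
  by (simp_all add: F_def)

definition gF :: "'b \<Rightarrow> 'b \<Rightarrow> complex" where "gF x y = g (\<Theta>i x) (\<Theta>i y)"

lemma \<Theta>i_add: "\<lbrakk>x \<in> vecs F; y \<in> vecs F\<rbrakk> \<Longrightarrow> \<Theta>i (x + y) = \<Theta>i x + \<Theta>i y"
  by (auto simp: \<Theta>_add[symmetric])

lemma \<Theta>i_scale: "x \<in> vecs F \<Longrightarrow> \<Theta>i (sF c x) = scale E c (\<Theta>i x)"
  by (auto simp: \<Theta>_scale[symmetric])

lemma \<Theta>_zero: "\<Theta> 0 = 0"
proof -
  interpret V: vector_space sF by (rule vsF)
  show ?thesis using \<Theta>_scale[of 0 0] by simp
qed

lemma \<Theta>_diff: "\<lbrakk>x \<in> vecs E; y \<in> vecs E\<rbrakk> \<Longrightarrow> \<Theta> (x - y) = \<Theta> x - \<Theta> y"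
  using \<Theta>_add[of "x - y" y] by (simp add: eq_diff_eq)

lemma definite_F: "definite_form sF (vecs F) gF"
proof -
  interpret V: vector_space sF by (rule vsF)
  have "V.subspace (vecs F)"
  proof (rule V.subspaceI)
    show "0 \<in> vecs F" using \<Theta>_zero by (auto intro!: image_eqI[of _ _ 0])
    show "x + y \<in> vecs F" if "x \<in> vecs F" "y \<in> vecs F" for x y
      using that by (auto simp: \<Theta>_add[symmetric])
    show "sF c x \<in> vecs F" if "x \<in> vecs F" for x c
      using that by (auto simp: \<Theta>_scale[symmetric])
  qed
  then show ?thesis
  proof unfold_locales
    fix x assume x: "x \<in> vecs F" "x \<noteq> 0"
    then obtain y where "y \<in> vecs E" "x = \<Theta> y" "y \<noteq> 0" using \<Theta>_zero by auto
    then show "0 < Re (gF x x)" by (simp add: gF_def pos)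
  next
    fix x y assume "x \<in> vecs F" "y \<in> vecs F"
    then show "gF y x = cnj (gF x y)" unfolding gF_def by (intro herm) auto
  qed (auto simp: gF_def \<Theta>i_add[simplified] \<Theta>i_scale[simplified] add_left scale_left nonneg
      \<Theta>_add[symmetric] \<Theta>_scale[symmetric])
qed

lemma nrm_F: "x \<in> vecs E \<Longrightarrow> psd_form.nrm gF (\<Theta> x) = nrm x"
proof -
  interpret F: definite_form sF "vecs F" gF by (rule definite_F)
  show "x \<in> vecs E \<Longrightarrow> F.nrm (\<Theta> x) = nrm x" by (simp add: F.nrm_def nrm_def gF_def)
qed

lemma krein_pair_F: "krein_pair F gF (\<lambda>x. \<Theta> (J (\<Theta>i x)))"
proof (rule krein_pairI)
  interpret F: definite_form sF "vecs F" gF by (rule definite_F)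
  have "hilbert_form sF (vecs F) gF"
  proof
    fix \<sigma> :: "nat \<Rightarrow> 'b" assume "\<And>i. \<sigma> i \<in> vecs F"
      and Cau: "\<And>e. e > 0 \<Longrightarrow> \<exists>N. \<forall>i\<ge>N. \<forall>j\<ge>N. F.nrm (\<sigma> i - \<sigma> j) < e"
    then have "\<forall>i. \<exists>x\<in>vecs E. \<sigma> i = \<Theta> x" by (simp add: image_iff)
    then obtain \<tau> where \<tau>: "\<And>i. \<tau> i \<in> vecs E" "\<And>i. \<sigma> i = \<Theta> (\<tau> i)" by metis
    have dist: "F.nrm (\<sigma> i - \<Theta> x) = nrm (\<tau> i - x)" if "x \<in> vecs E" for i x
      using that \<tau> nrm_F[of "\<tau> i - x"] by (simp add: \<Theta>_diff)
    have "\<exists>l\<in>vecs E. (\<lambda>i. nrm (\<tau> i - l)) \<longlonglongrightarrow> 0"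
      using Cau dist \<tau> by (intro complete) auto
    then show "\<exists>l\<in>vecs F. (\<lambda>i. F.nrm (\<sigma> i - l)) \<longlonglongrightarrow> 0" using dist by auto
  qed
  then show "hilbert_form (scale F) (vecs F) gF" by simp
qed (auto simp: gF_def ip_eq J_sym J_J J_add J_scale \<Theta>_add[symmetric] \<Theta>_scale[symmetric])

end


section \<open>Kernel forms on finitely supported functions\<close>

definition fscale :: "'h::ab_group_add ispace \<Rightarrow> complex \<Rightarrow> ('x \<Rightarrow>\<^sub>0 'h) \<Rightarrow> ('x \<Rightarrow>\<^sub>0 'h)" where
  "fscale H c f = Poly_Mapping.map (scale H c) f"

text \<open>Both \<open>psi\<close> and its adjoint have this shape: \<open>psi\<close> moves values
  along \<phi>(a) with weight 1/\<alpha>, the adjoint along \<phi>(\<II>(a)) with weight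
  \<alpha>.\<close>

definition shift_op ::
  "'h::ab_group_add ispace \<Rightarrow> ('x \<Rightarrow> 'x) \<Rightarrow> ('x \<Rightarrow> complex) \<Rightarrow> ('x \<Rightarrow>\<^sub>0 'h) \<Rightarrow> ('x \<Rightarrow>\<^sub>0 'h)" where
  "shift_op H u v f =
     (\<Sum>x\<in>Poly_Mapping.keys f. Poly_Mapping.single (u x) (scale H (v x) (Poly_Mapping.lookup f x)))"

lemma psi_eq_shift_op: "psi H \<phi> \<alpha> a = shift_op H (\<phi> a) (\<lambda>x. inverse (\<alpha> a x))"
  by (simp add: psi_def shift_op_def fun_eq_iff)

locale kernel_space = krein_pair H gH JH for H :: "'h::ab_group_add ispace" and gH JH
begin

interpretation I: hform "scale H" "vecs H" "ip H" by (rule hform_ip)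

lemma lookup_fscale [simp]: "Poly_Mapping.lookup (fscale H c f) x = scale H c (Poly_Mapping.lookup f x)"
  by (simp add: fscale_def map.rep_eq when_def)

lemma vector_space_fscale: "vector_space (fscale H)"
  by unfold_locales (auto intro!: poly_mapping_eqI simp: lookup_add scale_right_distrib scale_left_distrib)

lemma finsupp_lookup [simp, intro]: "f \<in> finsupp H \<Longrightarrow> Poly_Mapping.lookup f x \<in> vecs H"
  by (auto simp: finsupp_def)

lemma finsuppI: "(\<And>x. Poly_Mapping.lookup f x \<in> vecs H) \<Longrightarrow> f \<in> finsupp H"
  by (auto simp: finsupp_def)

lemma finsupp_zero [simp]: "0 \<in> finsupp H"
  and finsupp_add [simp, intro]: "\<lbrakk>f \<in> finsupp H; f' \<in> finsupp H\<rbrakk> \<Longrightarrow> f + f' \<in> finsupp H"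
  and finsupp_diff [simp, intro]: "\<lbrakk>f \<in> finsupp H; f' \<in> finsupp H\<rbrakk> \<Longrightarrow> f - f' \<in> finsupp H"
  and finsupp_scale [simp, intro]: "f \<in> finsupp H \<Longrightarrow> fscale H c f \<in> finsupp H"
  and finsupp_single [simp, intro]: "\<xi> \<in> vecs H \<Longrightarrow> Poly_Mapping.single x \<xi> \<in> finsupp H"
  by (auto intro!: finsuppI simp: lookup_add lookup_minus lookup_single when_def)

lemma finsupp_sum [intro]: "(\<And>i. i \<in> A \<Longrightarrow> F i \<in> finsupp H) \<Longrightarrow> sum F A \<in> finsupp H"
  by (induction A rule: infinite_finite_induct) auto

lemma subspace_finsupp: "module.subspace (fscale H) (finsupp H)"
proof -
  interpret V: vector_space "fscale H" by (rule vector_space_fscale)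
  show ?thesis by (rule V.subspaceI) auto
qed

lemma fscale_single: "fscale H c (Poly_Mapping.single x \<xi>) = Poly_Mapping.single x (scale H c \<xi>)"
  by (rule poly_mapping_eqI) (simp add: lookup_single when_def)

lemma finsupp_induct [consumes 1, case_names single add]:
  assumes f: "f \<in> finsupp H"
    and single: "\<And>x \<xi>. \<xi> \<in> vecs H \<Longrightarrow> P (Poly_Mapping.single x \<xi>)"
    and add: "\<And>f f'. \<lbrakk>f \<in> finsupp H; f' \<in> finsupp H; P f; P f'\<rbrakk> \<Longrightarrow> P (f + f')"
  shows "P f"
proof -
  let ?s = "\<lambda>x. Poly_Mapping.single x (Poly_Mapping.lookup f x)"
  have zero: "P 0" using single[of 0] by simp
  have "(\<Sum>x\<in>A. ?s x) \<in> finsupp H \<and> P (\<Sum>x\<in>A. ?s x)" if "finite A" for A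
    using that by induction (use f in \<open>auto simp: zero intro!: single add\<close>)
  moreover have "f = (\<Sum>x\<in>Poly_Mapping.keys f. ?s x)"
    by (rule poly_mapping_eqI) (auto simp: lookup_sum lookup_single when_def in_keys_iff sum.If_cases)
  ultimately show ?thesis by (metis finite_keys)
qed

lemma keys_sum_superset:
  assumes "finite A" "Poly_Mapping.keys f \<subseteq> A" "\<And>x. F x 0 = 0"
  shows "(\<Sum>x\<in>Poly_Mapping.keys f. F x (Poly_Mapping.lookup f x)) = (\<Sum>x\<in>A. F x (Poly_Mapping.lookup f x))"
  using assms by (intro sum.mono_neutral_left) (auto simp: in_keys_iff)

lemma keys_sum_scale:
  assumes "\<And>x. F x 0 = 0"
  shows "(\<Sum>x\<in>Poly_Mapping.keys (fscale H c f). F x (Poly_Mapping.lookup (fscale H c f) x)) =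
    (\<Sum>x\<in>Poly_Mapping.keys f. F x (scale H c (Poly_Mapping.lookup f x)))"
proof -
  have "Poly_Mapping.keys (fscale H c f) \<subseteq> Poly_Mapping.keys f" by (auto simp: in_keys_iff)
  then show ?thesis
    using keys_sum_superset[of "Poly_Mapping.keys f" "fscale H c f" F] assms by simp
qed

lemma shift_op_add: "shift_op H u v (f + f') = shift_op H u v f + shift_op H u v f'"
  unfolding shift_op_def
  by (rule setsum_keys_plus_distrib) (simp_all add: scale_right_distrib single_add)

lemma fscale_sum: "fscale H c (sum F A) = (\<Sum>i\<in>A. fscale H c (F i))"
proof -
  interpret V: vector_space "fscale H" by (rule vector_space_fscale)
  show ?thesis by (rule V.scale_sum_right)
qed

lemma shift_op_scale: "shift_op H u v (fscale H c f) = fscale H c (shift_op H u v f)"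
  unfolding shift_op_def
  by (subst keys_sum_scale) (simp_all add: fscale_sum fscale_single mult.commute)

lemma shift_op_in [simp, intro]: "f \<in> finsupp H \<Longrightarrow> shift_op H u v f \<in> finsupp H"
  unfolding shift_op_def by auto

lemma shift_op_single [simp]:
  "shift_op H u v (Poly_Mapping.single x \<xi>) = Poly_Mapping.single (u x) (scale H (v x) \<xi>)"
  by (simp add: shift_op_def)

lemma bounded_iff:
  "bounded_operator H H T \<longleftrightarrow> linear_on H H T \<and> (\<exists>c\<ge>0. \<forall>x\<in>vecs H. nrm (T x) \<le> c * nrm x)"
  using bounded_operator_iff[OF krein_pair_axioms krein_pair_axioms] .

text \<open>Removes the definite description behind \<open>adj\<close> in favour of an identity that
  can be computed with.\<close>

lemma hermitian_kernel_iff: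
  "hermitian_kernel H K \<longleftrightarrow> (\<forall>x y. bounded_operator H H (K x y)) \<and>
     (\<forall>x y. \<forall>\<xi>\<in>vecs H. \<forall>\<eta>\<in>vecs H. ip H (K x y \<xi>) \<eta> = ip H \<xi> (K y x \<eta>))"
proof (cases "\<forall>x y. bounded_operator H H (K x y)")
  case True
  then interpret K: krein_operator H gH JH H gH JH "K x y" for x y
    by (simp add: krein_operatorI krein_pair_axioms)
  show ?thesis
  proof
    assume "hermitian_kernel H K"
    then show "(\<forall>x y. bounded_operator H H (K x y)) \<and>
        (\<forall>x y. \<forall>\<xi>\<in>vecs H. \<forall>\<eta>\<in>vecs H. ip H (K x y \<xi>) \<eta> = ip H \<xi> (K y x \<eta>))"
      by (simp add: hermitian_kernel_def K.ip_adj)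
  next
    assume "(\<forall>x y. bounded_operator H H (K x y)) \<and>
        (\<forall>x y. \<forall>\<xi>\<in>vecs H. \<forall>\<eta>\<in>vecs H. ip H (K x y \<xi>) \<eta> = ip H \<xi> (K y x \<eta>))"
    then show "hermitian_kernel H K"
      unfolding hermitian_kernel_def by (auto intro!: K.adj_eqI[symmetric])
  qed
qed (auto simp: hermitian_kernel_def)

lemma ip_left_eqI:
  assumes "x \<in> vecs H" "y \<in> vecs H" "\<And>z. z \<in> vecs H \<Longrightarrow> ip H x z = ip H y z"
  shows "x = y"
proof (rule ip_eqI)
  show "ip H z x = ip H z y" if "z \<in> vecs H" for z
    using assms(3)[OF that] I.herm[OF assms(1) that] I.herm[OF assms(2) that] by simp
qed (use assms in auto)

lemma kernel_ip_single:
  assumes "linear_on H H (K x y)" "\<xi> \<in> vecs H" "\<eta> \<in> vecs H"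
  shows "kernel_ip H K (Poly_Mapping.single y \<xi>) (Poly_Mapping.single x \<eta>) = ip H (K x y \<xi>) \<eta>"
proof -
  have "K x y \<xi> \<in> vecs H" "K x y 0 = 0"
    using assms unfolding linear_on_def by (metis scale_zero_left W_intros(1))+
  then show ?thesis using assms by (auto simp: kernel_ip_def)
qed

lemma hform_kernel_ip:
  fixes K :: "('x, 'h) kernel"
  assumes K: "hermitian_kernel H K"
  shows "hform (fscale H) (finsupp H) (kernel_ip H K)"
proof -
  interpret V: vector_space "fscale H" by (rule vector_space_fscale)
  interpret K: krein_operator H gH JH H gH JH "K x y" for x y
    using K by (simp add: krein_operatorI krein_pair_axioms hermitian_kernel_def)
  have herm: "ip H (K x y \<xi>) \<eta> = ip H \<xi> (K y x \<eta>)" if "\<xi> \<in> vecs H" "\<eta> \<in> vecs H" for x y \<xi> \<eta>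
    using K that by (simp add: hermitian_kernel_iff)
  show ?thesis
  proof
    show "V.subspace (finsupp H)" by (rule subspace_finsupp)
    fix f f' h :: "'x \<Rightarrow>\<^sub>0 'h" and c
    assume f: "f \<in> finsupp H"
    show "kernel_ip H K (fscale H c f) h = c * kernel_ip H K f h" if h: "h \<in> finsupp H"
    proof -
      have "(\<Sum>y\<in>Poly_Mapping.keys (fscale H c f). ip H (K x y (Poly_Mapping.lookup (fscale H c f) y)) (Poly_Mapping.lookup h x))
        = (\<Sum>y\<in>Poly_Mapping.keys f. ip H (K x y (scale H c (Poly_Mapping.lookup f y))) (Poly_Mapping.lookup h x))" for x
        using h by (intro keys_sum_scale) (simp add: K.T_zero)
      then show ?thesis
        unfolding kernel_ip_def using f h by (simp add: K.T_scale I.scale_left sum_distrib_left)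
    qed
    show "kernel_ip H K h f = cnj (kernel_ip H K f h)" if h: "h \<in> finsupp H"
    proof -
      have "ip H (K x y (Poly_Mapping.lookup h y)) (Poly_Mapping.lookup f x) =
          cnj (ip H (K y x (Poly_Mapping.lookup f x)) (Poly_Mapping.lookup h y))" for x y
        using f h I.herm[of "K y x (Poly_Mapping.lookup f x)" "Poly_Mapping.lookup h y"] by (simp add: herm)
      then show ?thesis unfolding kernel_ip_def cnj_sum by (subst sum.swap) simp
    qed
    show "kernel_ip H K (f + f') h = kernel_ip H K f h + kernel_ip H K f' h"
      if f': "f' \<in> finsupp H" and h: "h \<in> finsupp H"
    proof -
      have "(\<Sum>y\<in>Poly_Mapping.keys (f + f'). ip H (K x y (Poly_Mapping.lookup (f + f') y)) (Poly_Mapping.lookup h x))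
        = (\<Sum>y\<in>Poly_Mapping.keys f. ip H (K x y (Poly_Mapping.lookup f y)) (Poly_Mapping.lookup h x))
        + (\<Sum>y\<in>Poly_Mapping.keys f'. ip H (K x y (Poly_Mapping.lookup f' y)) (Poly_Mapping.lookup h x))" for x
        using f f' h by (intro setsum_keys_plus_distrib) (simp_all add: K.T_zero K.T_add I.add_left)
      then show ?thesis unfolding kernel_ip_def by (simp add: sum.distrib)
    qed
  qed
qed

lemma psd_form_kernel_ip: "pd_kernel H K \<Longrightarrow> psd_form (fscale H) (finsupp H) (kernel_ip H K)"
  by (simp add: pd_kernel_def psd_form_def psd_form_axioms_def hform_kernel_ip)

lemma linear_kernel: "hermitian_kernel H K \<Longrightarrow> linear_on H H (K x y)"
  by (simp add: hermitian_kernel_def bounded_operator_def)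

lemma kernel_ip_cong:
  assumes "\<And>x y \<xi>. \<xi> \<in> vecs H \<Longrightarrow> K x y \<xi> = K' x y \<xi>" "f \<in> finsupp H"
  shows "kernel_ip H K f h = kernel_ip H K' f h"
  unfolding kernel_ip_def using assms by (simp cong: sum.cong)

lemma kernel_ip_plus:
  assumes "\<And>x y. linear_on H H (K x y)" "\<And>x y. linear_on H H (K' x y)" "f \<in> finsupp H" "h \<in> finsupp H"
  shows "kernel_ip H (K + K') f h = kernel_ip H K f h + kernel_ip H K' f h"
  unfolding kernel_ip_def using assms by (simp add: linear_on_def I.add_left sum.distrib)

lemma kernel_ip_uminus:
  assumes "\<And>x y. linear_on H H (K x y)" "f \<in> finsupp H" "h \<in> finsupp H"
  shows "kernel_ip H (- K) f h = - kernel_ip H K f h"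
  unfolding kernel_ip_def using assms by (simp add: linear_on_def I.minus_left sum_negf)

lemma kernel_ip_minus:
  assumes "\<And>x y. linear_on H H (K x y)" "\<And>x y. linear_on H H (K' x y)" "f \<in> finsupp H" "h \<in> finsupp H"
  shows "kernel_ip H (\<lambda>x y \<xi>. K x y \<xi> - K' x y \<xi>) f h = kernel_ip H K f h - kernel_ip H K' f h"
  unfolding kernel_ip_def using assms by (simp add: linear_on_def I.diff_left sum_subtractf)

lemma pd_kernel_plus:
  assumes "pd_kernel H K" "pd_kernel H K'"
  shows "pd_kernel H (K + K')"
proof -
  have lin: "linear_on H H (K x y)" "linear_on H H (K' x y)" for x y
    using assms by (auto simp: pd_kernel_def linear_kernel)
  have "bounded_operator H H ((K + K') x y)" for x y
  proof -
    obtain c d where cd: "c \<ge> 0" "\<And>\<xi>. \<xi> \<in> vecs H \<Longrightarrow> nrm (K x y \<xi>) \<le> c * nrm \<xi>"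
      "d \<ge> 0" "\<And>\<xi>. \<xi> \<in> vecs H \<Longrightarrow> nrm (K' x y \<xi>) \<le> d * nrm \<xi>"
      using assms unfolding pd_kernel_def hermitian_kernel_def bounded_iff by metis
    have "nrm (K x y \<xi> + K' x y \<xi>) \<le> (c + d) * nrm \<xi>" if "\<xi> \<in> vecs H" for \<xi>
      using nrm_triangle[of "K x y \<xi>" "K' x y \<xi>"] cd(2)[OF that] cd(4)[OF that] lin[of x y] that
      by (simp add: linear_on_def distrib_right)
    then show ?thesis
      using cd lin[of x y] by (auto simp: bounded_iff linear_on_def algebra_simps intro!: exI[of _ "c + d"])
  qed
  moreover have "ip H ((K + K') x y \<xi>) \<eta> = ip H \<xi> ((K + K') y x \<eta>)" if "\<xi> \<in> vecs H" "\<eta> \<in> vecs H" for x y \<xi> \<eta>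
    using assms lin[of x y] lin[of y x] that
    by (simp add: pd_kernel_def hermitian_kernel_iff linear_on_def I.add_left I.add_right)
  moreover have "0 \<le> Re (kernel_ip H (K + K') f f)" if "f \<in> finsupp H" for f
    using assms that by (simp add: kernel_ip_plus[OF lin] pd_kernel_def)
  ultimately show ?thesis by (simp add: pd_kernel_def hermitian_kernel_iff)
qed

text \<open>For L = Kp + Km the kernels L - K and L + K are 2 Km and 2 Kp, hence positive
  definite.\<close>

lemma majorant_of_difference:
  assumes p: "pd_kernel H Kp" and m: "pd_kernel H Km"
    and K: "\<And>x y \<xi>. \<xi> \<in> vecs H \<Longrightarrow> K x y \<xi> = Kp x y \<xi> - Km x y \<xi>"
    and inv: "phi_invariant H \<II> \<phi> \<alpha> Kp" "phi_invariant H \<II> \<phi> \<alpha> Km"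
  shows "kernel_le H (- (Kp + Km)) K" "kernel_le H K (Kp + Km)" "phi_invariant H \<II> \<phi> \<alpha> (Kp + Km)"
proof -
  have lin: "linear_on H H (Kp x y)" "linear_on H H (Km x y)" for x y
    using p m by (auto simp: pd_kernel_def linear_kernel)
  then have lin': "linear_on H H ((Kp + Km) x y)" for x y
    by (auto simp: linear_on_def scale_right_distrib)
  have "kernel_ip H K f f = kernel_ip H Kp f f - kernel_ip H Km f f" if "f \<in> finsupp H" for f
    using kernel_ip_cong[of K "\<lambda>x y \<xi>. Kp x y \<xi> - Km x y \<xi>" f, OF K that] that
    by (simp add: kernel_ip_minus[OF lin])
  moreover have "kernel_ip H (Kp + Km) f f = kernel_ip H Kp f f + kernel_ip H Km f f" if "f \<in> finsupp H" for f
    using kernel_ip_plus[OF lin that that] .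
  moreover have "kernel_ip H (- (Kp + Km)) f f = - kernel_ip H (Kp + Km) f f" if "f \<in> finsupp H" for f
    using kernel_ip_uminus[OF lin' that that] .
  ultimately show "kernel_le H (- (Kp + Km)) K" "kernel_le H K (Kp + Km)"
    using p m unfolding kernel_le_def pd_kernel_def by fastforce+
  show "phi_invariant H \<II> \<phi> \<alpha> (Kp + Km)"
    using inv unfolding phi_invariant_def by (simp add: scale_right_distrib)
qed

end

section \<open>From a reducible decomposition to a disjoint one\<close>

locale reducible_decomposition = H: kernel_space H gH JH + E: krein_pair E g J
  for H :: "'h::ab_group_add ispace" and gH JH and E :: "'k::ab_group_add ispace" and g J +
  fixes K :: "('x, 'h) kernel" and V :: "'x \<Rightarrow> 'h \<Rightarrow> 'k" and U :: "'s::monoid_mult \<Rightarrow> 'k \<Rightarrow> 'k"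
    and \<II> :: "'s \<Rightarrow> 's" and \<phi> :: "'s \<Rightarrow> 'x \<Rightarrow> 'x" and \<alpha> :: "'s \<Rightarrow> 'x \<Rightarrow> complex"
  assumes kolm: "kolmogorov_decomposition H K E V"
    and assoc: "associated_representation H \<phi> \<alpha> E V U"
    and commutes: "k \<in> vecs E \<Longrightarrow> U a (J k) = J (U a k)"
    and alpha_nonzero: "\<alpha> a x \<noteq> 0"
    and invariant: "phi_invariant H \<II> \<phi> \<alpha> K"
begin

interpretation IH: hform "scale H" "vecs H" "ip H" by (rule H.hform_ip)
interpretation IE: hform "scale E" "vecs E" "ip E" by (rule E.hform_ip)

interpretation V: krein_operator H gH JH E g J "V x" for x
  using kolm by (simp add: krein_operatorI H.krein_pair_axioms E.krein_pair_axioms kolmogorov_decomposition_def)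

interpretation U: krein_operator E g J E g J "U a" for a
  using assoc by (simp add: krein_operatorI E.krein_pair_axioms associated_representation_def
      projective_representation_def)

lemma V_action: "\<xi> \<in> vecs H \<Longrightarrow> V (\<phi> a x) \<xi> = scale E (\<alpha> a x) (U a (V x \<xi>))"
  using assoc by (simp add: associated_representation_def)

text \<open>The linear extension of \<open>V\<close> to finitely supported functions. Through it
  kernel forms become forms on \<open>E\<close> (\<open>kernel_ip_compress\<close>) and
  \<open>psi\<close> becomes \<open>U\<close> (\<open>kv_psi\<close>).\<close>

definition kv :: "('x \<Rightarrow>\<^sub>0 'h) \<Rightarrow> 'k" where
  "kv f = (\<Sum>x\<in>Poly_Mapping.keys f. V x (Poly_Mapping.lookup f x))"

lemma kv_in [simp, intro]: "f \<in> finsupp H \<Longrightarrow> kv f \<in> vecs E"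
  unfolding kv_def by (intro E.W_sum) auto

lemma kv_add: "\<lbrakk>f \<in> finsupp H; f' \<in> finsupp H\<rbrakk> \<Longrightarrow> kv (f + f') = kv f + kv f'"
  unfolding kv_def by (rule setsum_keys_plus_distrib) (auto simp: V.T_zero V.T_add)

lemma kv_scale: "f \<in> finsupp H \<Longrightarrow> kv (fscale H c f) = scale E c (kv f)"
  unfolding kv_def by (subst H.keys_sum_scale) (auto simp: V.T_zero V.T_scale E.scale_sum_right)

lemma kv_diff: "\<lbrakk>f \<in> finsupp H; f' \<in> finsupp H\<rbrakk> \<Longrightarrow> kv (f - f') = kv f - kv f'"
  using kv_add[of "f - f'" f'] by (simp add: eq_diff_eq)

lemma kv_single [simp]: "kv (Poly_Mapping.single x \<xi>) = V x \<xi>"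
  by (simp add: kv_def V.T_zero)

lemma kv_dense: assumes "k \<in> vecs E" "e > 0" shows "\<exists>f\<in>finsupp H. E.nrm (k - kv f) < e"
proof -
  let ?S = "E.span (\<Union>x. V x ` vecs H)"
  have "E.subspace (kv ` finsupp H)"
  proof (rule E.subspaceI)
    show "0 \<in> kv ` finsupp H" by (rule image_eqI[of _ _ 0]) (simp_all add: kv_def)
    fix x y c assume x: "x \<in> kv ` finsupp H"
    then show "scale E c x \<in> kv ` finsupp H" by (auto simp: kv_scale[symmetric])
    assume "y \<in> kv ` finsupp H"
    with x show "x + y \<in> kv ` finsupp H" by (auto simp: kv_add[symmetric])
  qed
  moreover have "(\<Union>x. V x ` vecs H) \<subseteq> kv ` finsupp H"
    using kv_single by (force simp: image_iff)
  ultimately have sub: "?S \<subseteq> kv ` finsupp H" by (intro E.span_minimal)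
  then have SE: "?S \<subseteq> vecs E" by auto
  have "dense_in E ?S" using kolm by (simp add: kolmogorov_decomposition_def)
  then have "\<exists>a\<in>?S. E.nrm (k - a) < e" using assms E.dense_in_iff[OF SE] by blast
  then show ?thesis using sub by blast
qed

text \<open>The weights 1/\<alpha> in \<open>psi\<close> cancel the \<alpha> that the action
  produces in \<open>V\<close>.\<close>

lemma kv_psi: "f \<in> finsupp H \<Longrightarrow> kv (psi H \<phi> \<alpha> a f) = U a (kv f)"
proof (induction f rule: H.finsupp_induct)
  case (single x \<xi>)
  then show ?case by (simp add: psi_eq_shift_op V_action U.T_scale V.T_scale alpha_nonzero)
next
  case (add f f')
  then show ?case by (simp add: psi_eq_shift_op H.shift_op_add kv_add U.T_add)
qed

lemma ip_adj_V: "\<lbrakk>\<eta> \<in> vecs H; k \<in> vecs E\<rbrakk> \<Longrightarrow> ip H (adj H E (V x) k) \<eta> = ip E k (V x \<eta>)"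
  using IH.herm[of \<eta> "adj H E (V x) k"] IE.herm[of "V x \<eta>" k] by (simp add: V.ip_adj)

lemma K_eq: "\<xi> \<in> vecs H \<Longrightarrow> K x y \<xi> = adj H E (V x) (V y \<xi>)"
  using kolm by (simp add: kolmogorov_decomposition_def)

text \<open>For \<open>k\<close> in the range of some \<open>V(y)\<close> this is the invariance of \<open>K\<close>; density gives the rest.\<close>

lemma ip_U:
  assumes k: "k \<in> vecs E" and \<eta>: "\<eta> \<in> vecs H"
  shows "ip E (U a k) (V x \<eta>) = ip E k (scale E (\<alpha> a (\<phi> (\<II> a) x)) (V (\<phi> (\<II> a) x) \<eta>))"
proof -
  define w where "w = scale E (\<alpha> a (\<phi> (\<II> a) x)) (V (\<phi> (\<II> a) x) \<eta>)"
  have w: "w \<in> vecs E" using \<eta> by (simp add: w_def)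
  have kv: "ip E (U a (kv f)) (V x \<eta>) = ip E (kv f) w" if "f \<in> finsupp H" for f
    using that
  proof (induction f rule: H.finsupp_induct)
    case (single y \<xi>)
    have in_H: "K (\<phi> (\<II> a) x) y \<xi> \<in> vecs H" using single by (simp add: K_eq V.adj_in)
    have "\<alpha> a y * ip E (U a (V y \<xi>)) (V x \<eta>) = ip H (K x (\<phi> a y) \<xi>) \<eta>"
      using single \<eta> by (simp add: K_eq ip_adj_V V_action IE.scale_left)
    also have "\<dots> = cnj (\<alpha> a (\<phi> (\<II> a) x)) * \<alpha> a y * ip H (K (\<phi> (\<II> a) x) y \<xi>) \<eta>"
      using invariant single \<eta> in_H by (simp add: phi_invariant_def IH.scale_left)
    also have "ip H (K (\<phi> (\<II> a) x) y \<xi>) \<eta> = ip E (V y \<xi>) (V (\<phi> (\<II> a) x) \<eta>)"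
      using single \<eta> by (simp add: K_eq ip_adj_V)
    finally have "\<alpha> a y * ip E (U a (V y \<xi>)) (V x \<eta>) = \<alpha> a y * ip E (V y \<xi>) w"
      using single \<eta> by (simp add: w_def IE.scale_right)
    then show ?case using alpha_nonzero by simp
  next
    case (add f f')
    then show ?case using w \<eta> by (simp add: kv_add U.T_add IE.add_left)
  qed
  obtain c where c: "c \<ge> 0" "\<And>z. z \<in> vecs E \<Longrightarrow> E.nrm (U a z) \<le> c * E.nrm z" using U.T_bound by blast
  \<comment> \<open>Bounds the difference of the two sides as a functional of \<open>k\<close>, so
    that its vanishing on the dense range of \<open>kv\<close> suffices.\<close>
  define C where "C = c * E.nrm (V x \<eta>) + E.nrm w"
  have C: "C \<ge> 0" using c \<eta> w by (simp add: C_def)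
  have le: "cmod (ip E (U a z) (V x \<eta>) - ip E z w) \<le> C * E.nrm z" if z: "z \<in> vecs E" for z
  proof -
    have "cmod (ip E (U a z) (V x \<eta>)) \<le> (c * E.nrm z) * E.nrm (V x \<eta>)"
      using E.ip_bound[of "U a z" "V x \<eta>"] mult_right_mono[OF c(2)[OF z] E.nrm_nonneg[of "V x \<eta>"]] z \<eta> by simp
    moreover have "cmod (ip E z w) \<le> E.nrm z * E.nrm w" using z w by (rule E.ip_bound)
    ultimately show ?thesis
      using norm_triangle_ineq4[of "ip E (U a z) (V x \<eta>)" "ip E z w"] by (simp add: C_def algebra_simps)
  qed
  have "cmod (ip E (U a k) (V x \<eta>) - ip E k w) \<le> 0 + e" if e: "e > 0" for e
  proof -
    have "e / (C + 1) > 0" using C e by simp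
    then obtain f where f: "f \<in> finsupp H" "E.nrm (k - kv f) < e / (C + 1)" using kv_dense[OF k] by blast
    have "ip E (U a k) (V x \<eta>) - ip E k w = ip E (U a (k - kv f)) (V x \<eta>) - ip E (k - kv f) w"
      using k \<eta> w f kv[OF f(1)] by (simp add: U.T_diff IE.diff_left)
    then have "cmod (ip E (U a k) (V x \<eta>) - ip E k w) \<le> C * E.nrm (k - kv f)"
      using le[of "k - kv f"] k f by simp
    also have "\<dots> \<le> (C + 1) * E.nrm (k - kv f)"
      using k f by (simp add: distrib_right)
    also have "\<dots> \<le> e" using f C by (simp add: field_simps)
    finally show ?thesis by simp
  qed
  then have "cmod (ip E (U a k) (V x \<eta>) - ip E k w) \<le> 0" by (rule field_le_epsilon)
  then show ?thesis by (simp add: w_def)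
qed

definition compress :: "('k \<Rightarrow> 'k) \<Rightarrow> ('x, 'h) kernel" where
  "compress B x y \<xi> = adj H E (V x) (B (V y \<xi>))"

context
  fixes B
  assumes B: "bounded_operator E E B"
begin

interpretation B: krein_operator E g J E g J B
  using B by (simp add: krein_operatorI E.krein_pair_axioms)

lemma kernel_ip_compress:
  assumes "f \<in> finsupp H" "f' \<in> finsupp H"
  shows "kernel_ip H (compress B) f f' = ip E (B (kv f)) (kv f')"
  unfolding kernel_ip_def compress_def kv_def
  using assms by (simp add: ip_adj_V B.T_sum IE.sum_left IE.sum_right IE.W_sum)

lemma pd_kernel_compress:
  assumes sym: "\<And>k m. \<lbrakk>k \<in> vecs E; m \<in> vecs E\<rbrakk> \<Longrightarrow> ip E (B k) m = ip E k (B m)"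
    and pos: "\<And>k. k \<in> vecs E \<Longrightarrow> 0 \<le> Re (ip E (B k) k)"
  shows "pd_kernel H (compress B)"
proof -
  note pairs = H.krein_pair_axioms E.krein_pair_axioms
  have "bounded_operator H E (\<lambda>\<xi>. B (V y \<xi>))" for y
    by (rule bounded_operator_comp[OF pairs pairs(2) V.bounded B])
  then have "bounded_operator H H (compress B x y)" for x y
    unfolding compress_def by (rule bounded_operator_comp[OF pairs pairs(1) _ V.bounded_adj])
  moreover have "ip H (compress B x y \<xi>) \<eta> = ip H \<xi> (compress B y x \<eta>)"
    if "\<xi> \<in> vecs H" "\<eta> \<in> vecs H" for x y \<xi> \<eta>
    using that by (simp add: compress_def ip_adj_V V.ip_adj sym)
  ultimately show ?thesis
    by (simp add: pd_kernel_def H.hermitian_kernel_iff kernel_ip_compress pos)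
qed

text \<open>\<open>V_action\<close> extracts \<open>U a\<close>, commutation lets it act after
  \<open>B\<close>, and \<open>ip_U\<close> moves it to the other argument, where it becomes the
  shift of \<open>x\<close>.\<close>

lemma phi_invariant_compress:
  assumes comm: "\<And>a k. k \<in> vecs E \<Longrightarrow> B (U a k) = U a (B k)"
  shows "phi_invariant H \<II> \<phi> \<alpha> (compress B)"
  unfolding phi_invariant_def compress_def
proof (intro allI ballI)
  fix x y a \<xi> assume \<xi>: "\<xi> \<in> vecs H"
  show "adj H E (V x) (B (V (\<phi> a y) \<xi>)) =
    scale H (cnj (\<alpha> a (\<phi> (\<II> a) x)) * \<alpha> a y) (adj H E (V (\<phi> (\<II> a) x)) (B (V y \<xi>)))"
  proof (rule H.ip_left_eqI)
    fix \<eta> assume \<eta>: "\<eta> \<in> vecs H"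
    have "ip H (adj H E (V x) (B (V (\<phi> a y) \<xi>))) \<eta> = \<alpha> a y * ip E (U a (B (V y \<xi>))) (V x \<eta>)"
      using \<xi> \<eta> by (simp add: ip_adj_V V_action B.T_scale comm IE.scale_left)
    also have "\<dots> = \<alpha> a y * (cnj (\<alpha> a (\<phi> (\<II> a) x)) * ip E (B (V y \<xi>)) (V (\<phi> (\<II> a) x) \<eta>))"
      using \<xi> \<eta> by (simp add: ip_U IE.scale_right)
    also have "\<dots> = ip H (scale H (cnj (\<alpha> a (\<phi> (\<II> a) x)) * \<alpha> a y) (adj H E (V (\<phi> (\<II> a) x)) (B (V y \<xi>)))) \<eta>"
      using \<xi> \<eta> by (simp add: ip_adj_V IH.scale_left V.adj_in)
    finally show "ip H (adj H E (V x) (B (V (\<phi> a y) \<xi>))) \<eta> =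
      ip H (scale H (cnj (\<alpha> a (\<phi> (\<II> a) x)) * \<alpha> a y) (adj H E (V (\<phi> (\<II> a) x)) (B (V y \<xi>)))) \<eta>" .
  qed (use \<xi> in \<open>auto intro!: V.adj_in H.W_intros\<close>)
qed

end

text \<open>For e = 1 and e = -1, the projection onto the eigenspace of \<open>J\<close> for the
  eigenvalue \<open>e\<close>; keeping \<open>e\<close> as a parameter treats both signs at
  once.\<close>

definition proj :: "complex \<Rightarrow> 'k \<Rightarrow> 'k" where
  "proj e k = scale E (1 / 2) (k + scale E e (J k))"

text \<open>For both signs this is \<open>J\<close> composed with \<open>proj e\<close>, and also
  \<open>e\<close> times \<open>proj e\<close>. The first form turns \<open>ip E\<close> into
  \<open>g\<close> and gives positivity, the second makes the difference of the two parts the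
  identity.\<close>

definition part :: "complex \<Rightarrow> 'k \<Rightarrow> 'k" where
  "part e k = scale E (1 / 2) (J k + scale E e k)"

lemma proj_in [simp, intro]: "k \<in> vecs E \<Longrightarrow> proj e k \<in> vecs E"
  and part_in [simp, intro]: "k \<in> vecs E \<Longrightarrow> part e k \<in> vecs E"
  by (simp_all add: proj_def part_def)

context
  fixes e :: complex
  assumes e: "e = 1 \<or> e = - 1"
begin

lemma ee: "e * e = 1" "cnj e = e" "cmod e = 1" using e by auto

lemma g_part: "\<lbrakk>k \<in> vecs E; m \<in> vecs E\<rbrakk> \<Longrightarrow> ip E (part e k) m = g (proj e k) m"
  by (simp add: part_def proj_def E.ip_eq E.J_add E.J_scale E.J_J)

lemma proj_diff: "\<lbrakk>k \<in> vecs E; m \<in> vecs E\<rbrakk> \<Longrightarrow> proj e (k - m) = proj e k - proj e m"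
  using E.J_add[of "k - m" m]
  by (simp add: proj_def eq_diff_eq[symmetric] E.scale_right_distrib E.scale_right_diff_distrib add_diff_add)

lemma proj_sym: "\<lbrakk>k \<in> vecs E; m \<in> vecs E\<rbrakk> \<Longrightarrow> g (proj e k) m = g k (proj e m)"
  by (simp add: proj_def E.scale_left E.scale_right E.add_left E.add_right E.J_sym ee)

lemma proj_proj: assumes k: "k \<in> vecs E" shows "proj e (proj e k) = proj e k"
proof -
  have "scale E e (J (proj e k)) = proj e k"
    using k by (simp add: proj_def E.J_scale E.J_add E.J_J E.scale_right_distrib mult.left_commute[of e] ee
        add.commute)
  then have "proj e (proj e k) = scale E (1 / 2) (proj e k + proj e k)" by (simp only: proj_def[of e "proj e k"])
  also have "\<dots> = scale E (1 / 2 + 1 / 2) (proj e k)" by (simp only: E.scale_left_distrib E.scale_right_distrib)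
  finally show ?thesis by simp
qed

lemma g_proj: "k \<in> vecs E \<Longrightarrow> Re (g (proj e k) k) = (E.nrm (proj e k))\<^sup>2"
  using proj_sym[of "proj e k" k] by (simp add: E.nrm_sq proj_proj)

lemma nrm_proj: "k \<in> vecs E \<Longrightarrow> E.nrm (proj e k) \<le> E.nrm k"
  using E.nrm_triangle[of k "scale E e (J k)"] ee by (simp add: proj_def E.nrm_scale E.nrm_J norm_divide)

lemma bounded_part: "bounded_operator E E (part e)"
proof -
  have "E.nrm (part e k) \<le> 1 * E.nrm k" if "k \<in> vecs E" for k
    using E.nrm_triangle[of "J k" "scale E e k"] ee that by (simp add: part_def E.nrm_scale E.nrm_J norm_divide)
  then show ?thesis
    by (auto simp: bounded_operator_iff[OF E.krein_pair_axioms E.krein_pair_axioms] linear_on_def part_def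
        E.J_add E.J_scale E.scale_right_distrib algebra_simps intro!: exI[of _ 1])
qed

lemma part_commutes: "k \<in> vecs E \<Longrightarrow> part e (U a k) = U a (part e k)"
  by (simp add: part_def commutes U.T_scale U.T_add)

lemma pd_part: "pd_kernel H (compress (part e))"
proof (rule pd_kernel_compress[OF bounded_part])
  fix k m assume km: "k \<in> vecs E" "m \<in> vecs E"
  show "ip E (part e k) m = ip E k (part e m)"
    using km proj_sym[of k m] IE.herm[of "part e m" k] E.herm[of "proj e m" k] by (simp add: g_part)
  show "0 \<le> Re (ip E (part e k) k)" using km by (simp add: g_part g_proj)
qed

lemma invariant_part: "phi_invariant H \<II> \<phi> \<alpha> (compress (part e))"
  by (rule phi_invariant_compress[OF bounded_part part_commutes])

lemma kernel_ip_part: "f \<in> finsupp H \<Longrightarrow> Re (kernel_ip H (compress (part e)) f f) = (E.nrm (proj e (kv f)))\<^sup>2"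
  by (simp add: kernel_ip_compress[OF bounded_part] g_part g_proj)

end

lemma proj_proj_null: "k \<in> vecs E \<Longrightarrow> proj (- 1) (proj 1 k) = 0"
  by (simp add: proj_def E.J_scale E.J_add E.J_J E.scale_right_distrib)

abbreviation "Kp \<equiv> compress (part 1)"
abbreviation "Km \<equiv> compress (part (- 1))"

lemma K_eq_diff: assumes \<xi>: "\<xi> \<in> vecs H" shows "K x y \<xi> = Kp x y \<xi> - Km x y \<xi>"
proof (rule H.ip_left_eqI)
  have "part 1 k - part (- 1) k = k" for k
    by (simp add: part_def E.scale_right_distrib E.scale_right_diff_distrib E.scale_left_distrib[symmetric])
  then have *: "ip E (part 1 k) m - ip E (part (- 1) k) m = ip E k m" if "k \<in> vecs E" "m \<in> vecs E" for k m
    using that IE.diff_left[of "part 1 k" "part (- 1) k" m] by simp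
  fix \<eta> assume \<eta>: "\<eta> \<in> vecs H"
  show "ip H (K x y \<xi>) \<eta> = ip H (Kp x y \<xi> - Km x y \<xi>) \<eta>"
    using \<xi> \<eta> * by (simp add: K_eq compress_def V.adj_in IH.diff_left ip_adj_V)
qed (use \<xi> in \<open>auto simp: K_eq compress_def V.adj_in\<close>)

lemma disjoint_parts: "disjoint_kernels H Kp Km"
  unfolding disjoint_kernels_def
proof (intro allI impI ballI)
  fix P x y \<xi> assume P: "pd_kernel H P \<and> kernel_le H P Kp \<and> kernel_le H P Km" and \<xi>: "\<xi> \<in> vecs H"
  interpret P: psd_form "fscale H" "finsupp H" "kernel_ip H P" using P H.psd_form_kernel_ip by blast
  have le: "P.nrm f \<le> E.nrm (proj e (kv f))" if f: "f \<in> finsupp H" and e: "e = 1 \<or> e = - 1" for f e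
  proof (rule power2_le_imp_le)
    have "Re (kernel_ip H P f f) \<le> Re (kernel_ip H (compress (part e)) f f)"
      using P f e by (auto simp: kernel_le_def)
    then show "(P.nrm f)\<^sup>2 \<le> (E.nrm (proj e (kv f)))\<^sup>2" using f e by (simp add: P.nrm_sq kernel_ip_part)
  qed (use f in auto)
  have null: "P.nrm f = 0" if f: "f \<in> finsupp H" for f
  proof -
    define k where "k = kv f"
    have k: "k \<in> vecs E" using f by (simp add: k_def)
    have "P.nrm f \<le> 0 + r" if r: "r > 0" for r
    proof -
      \<comment> \<open>\<open>kv h\<close> imitates the positive component of \<open>k\<close>:
        then f - h has almost no positive component and \<open>h\<close> almost no negative one, so
        each is small for \<open>P\<close> by a different one of the two dominations.\<close>
      obtain h where h: "h \<in> finsupp H" "E.nrm (proj 1 k - kv h) < r / 2"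
        using kv_dense[of "proj 1 k" "r / 2"] k r by auto
      have d: "proj 1 k - kv h \<in> vecs E" using k h by simp
      have "proj 1 (kv (f - h)) = proj 1 (proj 1 k - kv h)"
        using f h k by (simp add: kv_diff proj_diff proj_proj k_def)
      then have "P.nrm (f - h) \<le> E.nrm (proj 1 k - kv h)"
        using le[of "f - h" 1] nrm_proj[OF _ d, of 1] f h by simp
      moreover have "proj (- 1) (kv h) = - proj (- 1) (proj 1 k - kv h)"
        using h k by (simp add: proj_diff proj_proj_null)
      then have "P.nrm h \<le> E.nrm (proj 1 k - kv h)"
        using le[of h "- 1"] nrm_proj[OF _ d, of "- 1"] h d by (simp add: E.nrm_minus)
      ultimately show ?thesis using P.nrm_triangle[of "f - h" h] f h by simp
    qed
    then have "P.nrm f \<le> 0" by (rule field_le_epsilon)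
    then show ?thesis using P.nrm_nonneg[OF f] by linarith
  qed
  have lin: "linear_on H H (P x y)" using P by (simp add: pd_kernel_def H.linear_kernel)
  show "P x y \<xi> = 0"
  proof (rule H.ip_left_eqI)
    show "P x y \<xi> \<in> vecs H" using lin \<xi> by (simp add: linear_on_def)
    fix \<eta> assume \<eta>: "\<eta> \<in> vecs H"
    \<comment> \<open>One-point functions are null for \<open>P\<close>, so the Cauchy-Schwarz
      inequality annihilates every entry of the kernel.\<close>
    have "cmod (ip H (P x y \<xi>) \<eta>) \<le> 0"
      using P.Cauchy_Schwarz[of "Poly_Mapping.single y \<xi>" "Poly_Mapping.single x \<eta>"] \<xi> \<eta>
      by (simp add: H.kernel_ip_single[of P x y, OF lin] null)
    then show "ip H (P x y \<xi>) \<eta> = ip H 0 \<eta>" using \<eta> by simp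
  qed simp
qed

text \<open>The two projections add up to the identity, so the form of Kp + Km at \<open>f\<close>
  is the squared Hilbert norm of \<open>kv f\<close>, and \<phi>-boundedness is boundedness of
  \<open>U a\<close>.\<close>

lemma bounded_parts: "Kp + Km \<in> phi_bounded_pd_kernels H \<phi> \<alpha>"
proof -
  have pd: "pd_kernel H Kp" "pd_kernel H Km" by (simp_all add: pd_part)
  have "Re (kernel_ip H (Kp + Km) f f) = (E.nrm (kv f))\<^sup>2" if f: "f \<in> finsupp H" for f
  proof -
    have "Re (kernel_ip H (Kp + Km) f f) = Re (g (proj 1 (kv f)) (kv f)) + Re (g (proj (- 1) (kv f)) (kv f))"
      using pd f by (simp add: H.kernel_ip_plus pd_kernel_def H.linear_kernel kernel_ip_part g_proj)
    also have "\<dots> = Re (g (kv f) (kv f))"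
      using f by (simp add: proj_def E.scale_left E.add_left E.diff_left add_divide_distrib diff_divide_distrib)
    finally show ?thesis using f by (simp add: E.nrm_sq)
  qed
  then have "sqrt (Re (kernel_ip H (Kp + Km) f f)) = E.nrm (kv f)" if "f \<in> finsupp H" for f using that by simp
  moreover have "\<exists>c. \<forall>f\<in>finsupp H. E.nrm (kv (psi H \<phi> \<alpha> a f)) \<le> c * E.nrm (kv f)" for a
  proof -
    obtain c where "\<And>z. z \<in> vecs E \<Longrightarrow> E.nrm (U a z) \<le> c * E.nrm z" using U.T_bound by blast
    then show ?thesis by (auto simp: kv_psi intro!: exI[of _ c])
  qed
  ultimately show ?thesis
    using H.pd_kernel_plus[OF pd] by (simp add: phi_bounded_pd_kernels_def psi_eq_shift_op)
qed

end


section \<open>From a majorant to a reducible decomposition\<close>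

text \<open>\<open>psi_psi\<close> is the source of the projective relation;
  \<open>bounded_single\<close> makes \<open>V\<close> bounded and lets functionals be represented
  pointwise by vectors of \<open>H\<close>.\<close>

locale sign_kernel = kernel_space H gH JH +
  S: sign_form "fscale H" "finsupp H" "kernel_ip H K" "psi H \<phi> \<alpha>"
    "\<lambda>a. shift_op H (\<phi> (\<II> a)) (\<lambda>x. \<alpha> a (\<phi> (\<II> a) x))" c r
  for H :: "'h::ab_group_add ispace" and gH JH and K :: "('x, 'h) kernel"
    and \<II> :: "'s::monoid_mult \<Rightarrow> 's" and \<phi> :: "'s \<Rightarrow> 'x \<Rightarrow> 'x" and \<alpha> :: "'s \<Rightarrow> 'x \<Rightarrow> complex"
    and c :: "'s \<Rightarrow> real" and r +
  assumes hermitian: "hermitian_kernel H K"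
    and alpha_nonzero: "\<alpha> a x \<noteq> 0"
    and psi_psi: "f \<in> finsupp H \<Longrightarrow> psi H \<phi> \<alpha> a (psi H \<phi> \<alpha> b f) = fscale H (sigma \<phi> \<alpha> a b) (psi H \<phi> \<alpha> (a * b) f)"
    and bounded_single: "\<exists>C\<ge>0. \<forall>\<xi>\<in>vecs H. S.nrm (Poly_Mapping.single x \<xi>) \<le> C * nrm \<xi>"
begin

abbreviation T' where "T' a \<equiv> shift_op H (\<phi> (\<II> a)) (\<lambda>x. \<alpha> a (\<phi> (\<II> a) x))"

interpretation IH: hform "scale H" "vecs H" "ip H" by (rule hform_ip)
interpretation D: hilbert_form S.dscale S.dual S.dip by (rule S.hilbert_form_dual)

text \<open>On the range of \<open>emb\<close> this product is the kernel form of \<open>K\<close>,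
  since \<open>A\<close> sends \<open>emb f\<close> to \<open>kap f\<close>.\<close>

definition E0 :: "(('x \<Rightarrow>\<^sub>0 'h) \<Rightarrow> complex) ispace" where
  "E0 = \<lparr>vecs = S.dual, scale = S.dscale, ip = (\<lambda>l m. S.dip (S.A l) m)\<rparr>"

lemma E0_simps [simp]: "vecs E0 = S.dual" "scale E0 = S.dscale" "ip E0 l m = S.dip (S.A l) m"
  by (simp_all add: E0_def)

lemma krein_pair_E0: "krein_pair E0 S.dip S.A"
  by (rule krein_pairI)
    (simp_all add: S.hilbert_form_dual S.A_add S.A_scale S.A_A S.A_sym)

text \<open>\<open>section_of l x\<close> is \<open>V(x)\<^sup>\<sharp> l\<close>; it realizes the dual inside \<^typ>\<open>'x \<Rightarrow> 'h\<close>.\<close>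

definition section_of :: "(('x \<Rightarrow>\<^sub>0 'h) \<Rightarrow> complex) \<Rightarrow> 'x \<Rightarrow> 'h" where
  "section_of l x = (SOME z. z \<in> vecs H \<and> (\<forall>\<eta>\<in>vecs H. l (Poly_Mapping.single x \<eta>) = ip H z \<eta>))"

text \<open>By \<open>bounded_single\<close> the functional is continuous on one-point functions at
  \<open>x\<close>. Riesz in the Hilbert product of \<open>H\<close> represents its conjugate by
  some \<open>w\<close>, and \<open>JH w\<close> serves for the indefinite product.\<close>

lemma section_of:
  assumes l: "l \<in> S.dual"
  shows "section_of l x \<in> vecs H" "\<And>\<eta>. \<eta> \<in> vecs H \<Longrightarrow> l (Poly_Mapping.single x \<eta>) = ip H (section_of l x) \<eta>"
proof -
  obtain C where C: "C \<ge> 0" "\<And>\<xi>. \<xi> \<in> vecs H \<Longrightarrow> S.nrm (Poly_Mapping.single x \<xi>) \<le> C * nrm \<xi>"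
    using bounded_single by blast
  obtain w where w: "w \<in> vecs H" "\<And>\<eta>. \<eta> \<in> vecs H \<Longrightarrow> cnj (l (Poly_Mapping.single x \<eta>)) = gH \<eta> w"
  proof (rule riesz)
    show "cnj (l (Poly_Mapping.single x (\<xi> + \<eta>))) = cnj (l (Poly_Mapping.single x \<xi>)) + cnj (l (Poly_Mapping.single x \<eta>))"
      if "\<xi> \<in> vecs H" "\<eta> \<in> vecs H" for \<xi> \<eta>
      using that l by (simp add: single_add S.dual_add)
    show "cnj (l (Poly_Mapping.single x (scale H d \<xi>))) = d * cnj (l (Poly_Mapping.single x \<xi>))"
      if "\<xi> \<in> vecs H" for d \<xi>
      using that l by (simp add: fscale_single[symmetric] S.dual_scale)
    show "cmod (cnj (l (Poly_Mapping.single x \<xi>))) \<le> (D.nrm l * C) * nrm \<xi>" if "\<xi> \<in> vecs H" for \<xi>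
      using S.dual_apply_le[OF l, of "Poly_Mapping.single x \<xi>"] mult_left_mono[OF C(2)[OF that] D.nrm_nonneg[OF l]] that
      by (simp add: mult.assoc)
  qed blast
  have "l (Poly_Mapping.single x \<eta>) = ip H (JH w) \<eta>" if "\<eta> \<in> vecs H" for \<eta>
    using w(2)[OF that] herm[OF that w(1)] w(1) that by (metis complex_cnj_cnj g_eq)
  then have "\<exists>z. z \<in> vecs H \<and> (\<forall>\<eta>\<in>vecs H. l (Poly_Mapping.single x \<eta>) = ip H z \<eta>)"
    using w(1) by blast
  from someI_ex[OF this] show "section_of l x \<in> vecs H"
    "\<And>\<eta>. \<eta> \<in> vecs H \<Longrightarrow> l (Poly_Mapping.single x \<eta>) = ip H (section_of l x) \<eta>"
    unfolding section_of_def by blast+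
qed

lemma section_of_eqI:
  assumes "l \<in> S.dual" "z \<in> vecs H" "\<And>\<eta>. \<eta> \<in> vecs H \<Longrightarrow> l (Poly_Mapping.single x \<eta>) = ip H z \<eta>"
  shows "section_of l x = z"
  using assms section_of[OF assms(1)] by (intro ip_left_eqI) auto

definition pscale :: "complex \<Rightarrow> ('x \<Rightarrow> 'h) \<Rightarrow> 'x \<Rightarrow> 'h" where
  "pscale d F = (\<lambda>x. scale H d (F x))"

lemma krein_transport_section: "krein_transport E0 S.dip S.A pscale section_of"
proof -
  interpret E0: krein_pair E0 S.dip S.A by (rule krein_pair_E0)
  show ?thesis
  proof
    show "section_of (l + m) = section_of l + section_of m" if "l \<in> vecs E0" "m \<in> vecs E0" for l m
    proof
      fix x
      show "section_of (l + m) x = (section_of l + section_of m) x"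
        using that section_of[of l] section_of[of m]
        by (intro section_of_eqI) (auto simp: S.dual_add_closed IH.add_left)
    qed
    show "section_of (scale E0 d l) = pscale d (section_of l)" if "l \<in> vecs E0" for d l
    proof
      fix x
      show "section_of (scale E0 d l) x = pscale d (section_of l) x"
        using that section_of[of l]
        by (intro section_of_eqI) (auto simp: pscale_def S.dual_scale_closed IH.scale_left)
    qed
    \<comment> \<open>One-point functions generate \<open>finsupp H\<close> additively, so a
      functional is determined by its sections.\<close>
    show "inj_on section_of (vecs E0)"
    proof (rule inj_onI)
      fix l m assume lm: "l \<in> vecs E0" "m \<in> vecs E0" and eq: "section_of l = section_of m"
      show "l = m"
      proof (rule S.dual_eqI)
        fix f :: "'x \<Rightarrow>\<^sub>0 'h" assume "f \<in> finsupp H"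
        then show "l f = m f"
        proof (induction f rule: finsupp_induct)
          case (single x \<xi>)
          then show ?case using section_of(2)[of l \<xi> x] section_of(2)[of m \<xi> x] lm eq by simp
        next
          case (add f f')
          then show ?case using lm by (simp add: S.dual_add)
        qed
      qed (use lm in simp_all)
    qed
  qed (auto simp: pscale_def fun_eq_iff scale_right_distrib scale_left_distrib)
qed

sublocale Tr: krein_transport E0 S.dip S.A pscale section_of by (rule krein_transport_section)

sublocale F: krein_pair Tr.F Tr.gF "\<lambda>y. section_of (S.A (Tr.\<Theta>i y))" by (rule Tr.krein_pair_F)

definition V :: "'x \<Rightarrow> 'h \<Rightarrow> 'x \<Rightarrow> 'h" where
  "V x \<xi> = section_of (S.emb (Poly_Mapping.single x \<xi>))"

definition U :: "'s \<Rightarrow> ('x \<Rightarrow> 'h) \<Rightarrow> 'x \<Rightarrow> 'h" where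
  "U a y = section_of (S.U a (Tr.\<Theta>i y))"

lemma emb_add: "\<lbrakk>f \<in> finsupp H; f' \<in> finsupp H\<rbrakk> \<Longrightarrow> S.emb (f + f') = S.emb f + S.emb f'"
  by (rule ext) (simp add: S.emb_def S.add_left)

lemma emb_scale: "f \<in> finsupp H \<Longrightarrow> S.emb (fscale H d f) = S.dscale d (S.emb f)"
  by (rule ext) (simp add: S.emb_def S.scale_left)

lemma nrm_section: "l \<in> S.dual \<Longrightarrow> F.nrm (section_of l) = D.nrm l"
  using Tr.nrm_F[of l] by simp

lemma V_in: "\<xi> \<in> vecs H \<Longrightarrow> V x \<xi> \<in> vecs Tr.F"
  by (simp add: V_def)

lemma bounded_V: "bounded_operator H Tr.F (V x)"
proof -
  obtain C where C: "C \<ge> 0" "\<And>\<xi>. \<xi> \<in> vecs H \<Longrightarrow> S.nrm (Poly_Mapping.single x \<xi>) \<le> C * nrm \<xi>"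
    using bounded_single by blast
  have "V x (\<xi> + \<eta>) = V x \<xi> + V x \<eta>" if "\<xi> \<in> vecs H" "\<eta> \<in> vecs H" for \<xi> \<eta>
    using that Tr.\<Theta>_add[of "S.emb (Poly_Mapping.single x \<xi>)" "S.emb (Poly_Mapping.single x \<eta>)"]
    by (simp add: V_def single_add emb_add)
  moreover have "V x (scale H d \<xi>) = pscale d (V x \<xi>)" if "\<xi> \<in> vecs H" for d \<xi>
    using that Tr.\<Theta>_scale[of "S.emb (Poly_Mapping.single x \<xi>)" d]
    by (simp add: V_def emb_scale fscale_single[symmetric])
  ultimately have "linear_on H Tr.F (V x)" by (simp add: linear_on_def V_def)
  moreover have "F.nrm (V x \<xi>) \<le> C * nrm \<xi>" if "\<xi> \<in> vecs H" for \<xi>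
    using C(2)[OF that] that by (simp add: V_def nrm_section S.dnrm_emb)
  ultimately show ?thesis
    using C(1) by (auto simp: bounded_operator_iff[OF krein_pair_axioms F.krein_pair_axioms])
qed

lemma span_V: "f \<in> finsupp H \<Longrightarrow> section_of (S.emb f) \<in> F.span (\<Union>x. V x ` vecs H)"
proof (induction f rule: finsupp_induct)
  case (single x \<xi>)
  then show ?case by (intro F.span_base) (auto simp: V_def)
next
  case (add f f')
  have "section_of (S.emb (f + f')) = section_of (S.emb f) + section_of (S.emb f')"
    unfolding emb_add[OF add.hyps] using add.hyps by (intro Tr.\<Theta>_add) auto
  with F.span_add[OF add.IH] show ?case by metis
qed

lemma kolmogorov: "kolmogorov_decomposition H K Tr.F V"
  unfolding kolmogorov_decomposition_def
proof (intro conjI allI ballI)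
  show "krein_space Tr.F" by (rule F.krein_space)
  show "bounded_operator H Tr.F (V x)" for x by (rule bounded_V)
  show "K x y \<xi> = adj H Tr.F (V x) (V y \<xi>)" if \<xi>: "\<xi> \<in> vecs H" for x y \<xi>
  proof -
    interpret V: krein_operator H gH JH Tr.F Tr.gF "\<lambda>y. section_of (S.A (Tr.\<Theta>i y))" "V x"
      by (rule krein_operatorI[OF krein_pair_axioms F.krein_pair_axioms bounded_V])
    have lin: "linear_on H H (K x y)" for x y using hermitian by (rule linear_kernel)
    have "ip Tr.F (V x \<eta>) (V y \<xi>) = ip H \<eta> (K x y \<xi>)" if \<eta>: "\<eta> \<in> vecs H" for \<eta>
    proof -
      have "ip Tr.F (V x \<eta>) (V y \<xi>) = kernel_ip H K (Poly_Mapping.single x \<eta>) (Poly_Mapping.single y \<xi>)"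
        using \<xi> \<eta> by (simp add: V_def S.A_emb S.dip_emb)
      also have "\<dots> = ip H (K y x \<eta>) \<xi>" by (rule kernel_ip_single[of K y x, OF lin \<eta> \<xi>])
      also have "\<dots> = ip H \<eta> (K x y \<xi>)" using hermitian \<xi> \<eta> by (simp add: hermitian_kernel_iff)
      finally show ?thesis .
    qed
    then show ?thesis using lin[of x y] \<xi> by (intro V.adj_eqI[symmetric]) (auto simp: linear_on_def)
  qed
  have sub: "F.span (\<Union>x. V x ` vecs H) \<subseteq> vecs Tr.F"
    using V_in by (intro F.span_minimal F.subspace_W) auto
  have "\<exists>a\<in>F.span (\<Union>x. V x ` vecs H). F.nrm (y - a) < e" if y: "y \<in> vecs Tr.F" and e: "e > 0" for y e
  proof -
    obtain l where l: "l \<in> S.dual" "y = section_of l" using y by auto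
    \<comment> \<open>Near-representation by vectors of \<open>finsupp H\<close> is the source of
      density; e / 2 leaves room for the strict inequality.\<close>
    obtain f where f: "f \<in> finsupp H" "\<And>h. h \<in> finsupp H \<Longrightarrow> cmod (l h - r f h) \<le> (e / 2) * S.nrm h"
      using S.dual_approx[OF l(1), of "e / 2"] e by auto
    have d: "l - S.emb f \<in> S.dual" using l f by auto
    have "D.nrm (l - S.emb f) \<le> e / 2" using d f e by (intro S.dnrm_leI) auto
    moreover have "F.nrm (y - section_of (S.emb f)) = D.nrm (l - S.emb f)"
      using Tr.\<Theta>_diff[of l "S.emb f"] nrm_section[OF d] l f by simp
    ultimately show ?thesis using span_V[OF f(1)] e by (intro bexI[of _ "section_of (S.emb f)"]) auto
  qed
  then show "dense_in Tr.F (F.span (\<Union>x. V x ` vecs H))" by (simp only: F.dense_in_iff[OF sub]) blast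
qed

text \<open>The product law is given for \<open>psi\<close>. Passing to adjoints in
  \<open>r\<close>, it says that \<open>T' b (T' a h)\<close> and the conjugate of sigma times
  \<open>T' (a * b) h\<close> differ by an \<open>r\<close>-null vector, on which every bounded
  functional vanishes.\<close>

lemma S_U_U:
  assumes l: "l \<in> S.dual"
  shows "S.U a (S.U b l) = S.dscale (sigma \<phi> \<alpha> a b) (S.U (a * b) l)"
proof (rule S.dual_eqI)
  fix h :: "'x \<Rightarrow>\<^sub>0 'h" assume h: "h \<in> finsupp H"
  define z where "z = T' b (T' a h) - fscale H (cnj (sigma \<phi> \<alpha> a b)) (T' (a * b) h)"
  have z: "z \<in> finsupp H" using h by (simp add: z_def)
  have "r f z = 0" if f: "f \<in> finsupp H" for f
    using f h S.adj[of "psi H \<phi> \<alpha> b f" h a] S.adj[of f "T' a h" b] S.adj[of f h "a * b"]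
    by (simp add: z_def S.diff_right S.scale_right psi_psi S.scale_left)
  then have "S.nrm z = 0" using z by (simp add: S.nrm_def)
  then have "l z = 0" using S.dual_apply_le[OF l z] by simp
  then show "S.U a (S.U b l) h = S.dscale (sigma \<phi> \<alpha> a b) (S.U (a * b) l) h"
    using l h by (simp add: z_def S.dual_diff S.dual_scale)
qed (use l in \<open>auto intro: S.dual_scale_closed\<close>)

lemma bounded_U: "bounded_operator Tr.F Tr.F (U a)"
proof -
  have "U a (y + y') = U a y + U a y'" if "y \<in> vecs Tr.F" "y' \<in> vecs Tr.F" for y y'
    using that Tr.\<Theta>i_add[OF that] by (auto simp: U_def S.U_add Tr.\<Theta>_add[simplified])
  moreover have "U a (pscale d y) = pscale d (U a y)" if "y \<in> vecs Tr.F" for d y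
    using that Tr.\<Theta>i_scale[OF that] by (auto simp: U_def S.U_scale Tr.\<Theta>_scale[simplified])
  ultimately have "linear_on Tr.F Tr.F (U a)" by (auto simp: linear_on_def U_def)
  moreover have "F.nrm (U a y) \<le> c a * F.nrm y" if "y \<in> vecs Tr.F" for y
    using that by (auto simp: U_def nrm_section S.dnrm_U)
  ultimately show ?thesis
    using S.k.c_nonneg by (auto simp: bounded_operator_iff[OF F.krein_pair_axioms F.krein_pair_axioms])
qed

lemma associated: "associated_representation H \<phi> \<alpha> Tr.F V U"
  unfolding associated_representation_def projective_representation_def
proof (intro conjI allI ballI bounded_U)
  show "U a (U b y) = scale Tr.F (sigma \<phi> \<alpha> a b) (U (a * b) y)" if "y \<in> vecs Tr.F" for a b y
    using that by (auto simp: U_def S_U_U Tr.\<Theta>_scale[simplified])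
  show "V (\<phi> a x) \<xi> = scale Tr.F (\<alpha> a x) (U a (V x \<xi>))" if "\<xi> \<in> vecs H" for x a \<xi>
  proof -
    have "S.dscale (\<alpha> a x) (S.emb (psi H \<phi> \<alpha> a (Poly_Mapping.single x \<xi>))) = S.emb (Poly_Mapping.single (\<phi> a x) \<xi>)"
      using that by (simp add: psi_eq_shift_op emb_scale[symmetric] fscale_single alpha_nonzero)
    then show ?thesis
      using that Tr.\<Theta>_scale[of "S.emb (psi H \<phi> \<alpha> a (Poly_Mapping.single x \<xi>))" "\<alpha> a x"]
      by (simp add: V_def U_def S.U_emb)
  qed
qed

lemma reducible: "fundamentally_reducible Tr.F U"
  unfolding fundamentally_reducible_def
proof (intro exI conjI allI ballI)
  show "fundamental_symmetry Tr.F (\<lambda>y. section_of (S.A (Tr.\<Theta>i y)))"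
    using F.pair by (auto simp: fundamental_symmetry_def)
  show "U a (section_of (S.A (Tr.\<Theta>i y))) = section_of (S.A (Tr.\<Theta>i (U a y)))" if "y \<in> vecs Tr.F" for a y
    using that by (auto simp: U_def S.A_U)
qed

end

section \<open>The cocycle, adjoints of the shifts, and the equivalence\<close>

locale cocycle_action =
  fixes \<phi> :: "'s::monoid_mult \<Rightarrow> 'x \<Rightarrow> 'x" and \<alpha> :: "'s \<Rightarrow> 'x \<Rightarrow> complex"
  assumes action: "\<phi> a (\<phi> b x) = \<phi> (a * b) x"
    and alpha_nonzero: "\<alpha> a x \<noteq> 0"
    and alpha_cocycle: "\<alpha> (a * b) x * cnj (\<alpha> (a * b) y) =
          \<alpha> a (\<phi> b x) * cnj (\<alpha> a (\<phi> b y)) * (\<alpha> b x * cnj (\<alpha> b y))"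
begin

text \<open>By the cocycle identity the candidate values satisfy t(x) cnj(t(y)) = 1 for all
  \<open>x\<close> and \<open>y\<close>; comparison with t(y) cnj(t(y)) = 1 removes the dependence
  on the point.\<close>

lemma sigma_eq: "sigma \<phi> \<alpha> a b = inverse (\<alpha> a (\<phi> b x)) * inverse (\<alpha> b x) * \<alpha> (a * b) x"
proof -
  define t where "t x = inverse (\<alpha> a (\<phi> b x)) * inverse (\<alpha> b x) * \<alpha> (a * b) x" for x
  have *: "t x * cnj (t y) = 1" for x y
  proof -
    have "t x * cnj (t y) = \<alpha> (a * b) x * cnj (\<alpha> (a * b) y) /
        (\<alpha> a (\<phi> b x) * cnj (\<alpha> a (\<phi> b y)) * (\<alpha> b x * cnj (\<alpha> b y)))"
      by (simp add: t_def divide_inverse mult_ac)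
    then show ?thesis by (simp add: alpha_cocycle alpha_nonzero)
  qed
  have "t x = t y" for y
    using *[of x y] *[of y y] by (metis mult_cancel_right mult_zero_right zero_neq_one)
  then have "sigma \<phi> \<alpha> a b = t x"
    unfolding sigma_def t_def[symmetric] by (intro the_equality) auto
  then show ?thesis by (simp add: t_def)
qed

end

context kernel_space
begin

interpretation IH: hform "scale H" "vecs H" "ip H" by (rule hform_ip)

text \<open>On one-point functions this is \<phi>-invariance, with 1/\<alpha> from
  \<open>psi\<close> cancelling one of its factors. The adjoint does not involve \<open>M\<close>,
  so \<open>K\<close> and \<open>L\<close> share it.\<close>

lemma psi_adjoint:
  assumes M: "hermitian_kernel H M" and inv: "phi_invariant H \<II> \<phi> \<alpha> M" and nz: "\<And>a x. \<alpha> a x \<noteq> 0"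
    and f: "f \<in> finsupp H" and f': "f' \<in> finsupp H"
  shows "kernel_ip H M (psi H \<phi> \<alpha> a f) f' =
    kernel_ip H M f (shift_op H (\<phi> (\<II> a)) (\<lambda>x. \<alpha> a (\<phi> (\<II> a) x)) f')"
proof -
  interpret M: hform "fscale H" "finsupp H" "kernel_ip H M" using M by (rule hform_kernel_ip)
  have lin: "linear_on H H (M x y)" for x y using M by (rule linear_kernel)
  show ?thesis using f
  proof (induction f rule: finsupp_induct)
    case (single y \<xi>)
    show ?case using f'
    proof (induction f' rule: finsupp_induct)
      case (single x \<eta>)
      let ?b = "\<alpha> a (\<phi> (\<II> a) x)"
      have M_in: "M x y \<xi> \<in> vecs H" for x y using lin[of x y] \<open>\<xi> \<in> vecs H\<close> by (simp add: linear_on_def)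
      have "M x (\<phi> a y) (scale H (inverse (\<alpha> a y)) \<xi>) = scale H (cnj ?b) (M (\<phi> (\<II> a) x) y \<xi>)"
        using lin[of x "\<phi> a y"] inv \<open>\<xi> \<in> vecs H\<close> nz[of a y]
        by (simp add: linear_on_def phi_invariant_def)
      then show ?case
        using single \<open>\<xi> \<in> vecs H\<close> M_in
        by (simp add: psi_eq_shift_op kernel_ip_single[of M, OF lin] IH.scale_left IH.scale_right)
    next
      case (add f f')
      then show ?case using single by (simp add: shift_op_add psi_eq_shift_op M.add_right)
    qed
  next
    case (add f f')
    then show ?case using \<open>f' \<in> finsupp H\<close> assms(5) by (simp add: psi_eq_shift_op shift_op_add M.add_left)
  qed
qed

lemma reducible_of_majorant:
  fixes \<II> :: "'s::monoid_mult \<Rightarrow> 's" and K L :: "('x, 'h) kernel"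
  assumes "cocycle_action \<phi> \<alpha>"
    and K: "hermitian_kernel H K" "phi_invariant H \<II> \<phi> \<alpha> K"
    and L: "L \<in> phi_bounded_pd_kernels H \<phi> \<alpha>" "kernel_le H (- L) K" "kernel_le H K L" "phi_invariant H \<II> \<phi> \<alpha> L"
  shows "has_reducible_decomposition TYPE('x \<Rightarrow> 'h) H \<phi> \<alpha> K"
proof -
  interpret cocycle_action \<phi> \<alpha> by fact
  have pd: "pd_kernel H L" using L by (simp add: phi_bounded_pd_kernels_def)
  then have hL: "hermitian_kernel H L" by (simp add: pd_kernel_def)
  interpret K: hform "fscale H" "finsupp H" "kernel_ip H K" using K(1) by (rule hform_kernel_ip)
  interpret L: psd_form "fscale H" "finsupp H" "kernel_ip H L" using pd by (rule psd_form_kernel_ip)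
  define T' where "T' a = shift_op H (\<phi> (\<II> a)) (\<lambda>x. \<alpha> a (\<phi> (\<II> a) x))" for a
  \<comment> \<open>The bounds are squared to speak of forms and made nonnegative, as the given
    constants may have any sign, so that one function \<open>c\<close> of \<open>a\<close> can
    collect them.\<close>
  have "\<forall>a. \<exists>d\<ge>0. \<forall>f\<in>finsupp H. Re (kernel_ip H L (psi H \<phi> \<alpha> a f) (psi H \<phi> \<alpha> a f)) \<le> d\<^sup>2 * Re (kernel_ip H L f f)"
  proof
    fix a
    obtain d where d: "\<And>f. f \<in> finsupp H \<Longrightarrow> L.nrm (psi H \<phi> \<alpha> a f) \<le> d * L.nrm f"
      using L(1) unfolding phi_bounded_pd_kernels_def L.nrm_def by blast
    have "Re (kernel_ip H L (psi H \<phi> \<alpha> a f) (psi H \<phi> \<alpha> a f)) \<le> \<bar>d\<bar>\<^sup>2 * Re (kernel_ip H L f f)"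
      if f: "f \<in> finsupp H" for f
    proof -
      have "psi H \<phi> \<alpha> a f \<in> finsupp H" using f by (simp add: psi_eq_shift_op)
      then show ?thesis
        using power_mono[OF d[OF f], of 2] f by (simp add: L.nrm_sq power_mult_distrib)
    qed
    then show "\<exists>d\<ge>0. \<forall>f\<in>finsupp H. Re (kernel_ip H L (psi H \<phi> \<alpha> a f) (psi H \<phi> \<alpha> a f)) \<le> d\<^sup>2 * Re (kernel_ip H L f f)"
      by (intro exI[of _ "\<bar>d\<bar>"]) auto
  qed
  then obtain c where c: "\<And>a. c a \<ge> 0" "\<And>a f. f \<in> finsupp H \<Longrightarrow>
      Re (kernel_ip H L (psi H \<phi> \<alpha> a f) (psi H \<phi> \<alpha> a f)) \<le> (c a)\<^sup>2 * Re (kernel_ip H L f f)"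
    by metis
  have sys: "form_system (fscale H) (finsupp H) (kernel_ip H K) (psi H \<phi> \<alpha>) T' c"
    by unfold_locales
      (auto simp: psi_eq_shift_op T'_def shift_op_add shift_op_scale c
        psi_adjoint[OF K alpha_nonzero, unfolded psi_eq_shift_op])
  then interpret sys: form_system "fscale H" "finsupp H" "kernel_ip H K" "psi H \<phi> \<alpha>" T' c .
  have le: "\<bar>Re (kernel_ip H K f f)\<bar> \<le> Re (kernel_ip H L f f)" if f: "f \<in> finsupp H" for f
    using L(2,3) f kernel_ip_uminus[OF linear_kernel[OF hL] f f] by (force simp: kernel_le_def)
  have "dominating_form (fscale H) (finsupp H) (kernel_ip H K) (psi H \<phi> \<alpha>) T' c (kernel_ip H L)"
  proof unfold_locales
    fix f f' :: "'x \<Rightarrow>\<^sub>0 'h" and a assume f: "f \<in> finsupp H"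
    show "\<bar>Re (kernel_ip H K f f)\<bar> \<le> Re (kernel_ip H L f f)" using f by (rule le)
    show "Re (kernel_ip H L (psi H \<phi> \<alpha> a f) (psi H \<phi> \<alpha> a f)) \<le> (c a)\<^sup>2 * Re (kernel_ip H L f f)"
      using f by (rule c)
    show "kernel_ip H L (psi H \<phi> \<alpha> a f) f' = kernel_ip H L f (T' a f')" if "f' \<in> finsupp H"
      unfolding T'_def by (rule psi_adjoint[OF hL L(4) alpha_nonzero f that])
  qed
  then obtain r where r: "dominating_form (fscale H) (finsupp H) (kernel_ip H K) (psi H \<phi> \<alpha>) T' c r"
    "\<And>f. f \<in> finsupp H \<Longrightarrow> Re (r f f) \<le> Re (kernel_ip H L f f)"
    "\<And>f C. \<lbrakk>f \<in> finsupp H; 0 \<le> C; \<And>h. h \<in> finsupp H \<Longrightarrow> cmod (kernel_ip H K f h) \<le> C * sqrt (Re (r h h))\<rbrakk>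
      \<Longrightarrow> Re (r f f) \<le> C\<^sup>2"
    by (rule sys.newton_limit) blast
  interpret R: psd_form "fscale H" "finsupp H" r using r(1) by (simp add: dominating_form_def)
  interpret sign_kernel H gH JH K \<II> \<phi> \<alpha> c r
  proof (intro sign_kernel.intro sign_kernel_axioms.intro)
    show "kernel_space H gH JH" by (rule kernel_space_axioms)
    show "sign_form (fscale H) (finsupp H) (kernel_ip H K) (psi H \<phi> \<alpha>)
        (\<lambda>a. shift_op H (\<phi> (\<II> a)) (\<lambda>x. \<alpha> a (\<phi> (\<II> a) x))) c r"
      using r(1,3) by (simp add: sign_form_def sign_form_axioms_def T'_def[abs_def])
    show "hermitian_kernel H K" by fact
    show "\<alpha> a x \<noteq> 0" for a x by (rule alpha_nonzero)
    show "psi H \<phi> \<alpha> a (psi H \<phi> \<alpha> b f) = fscale H (sigma \<phi> \<alpha> a b) (psi H \<phi> \<alpha> (a * b) f)"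
      if "f \<in> finsupp H" for a b f
      using that
    proof (induction f rule: finsupp_induct)
      case (single x \<xi>)
      have "sigma \<phi> \<alpha> a b * inverse (\<alpha> (a * b) x) = inverse (\<alpha> a (\<phi> b x)) * inverse (\<alpha> b x)"
        by (simp add: sigma_eq[of a b x] alpha_nonzero)
      then show ?case by (simp add: psi_eq_shift_op fscale_single action)
    next
      case (add f f')
      then show ?case by (simp add: psi_eq_shift_op shift_op_add K.scale_right_distrib)
    qed
    \<comment> \<open>The limit form lies below \<open>L\<close>, so on one-point functions it is
      controlled by the bounded operator \<open>L x x\<close>; the square root passes from the form
      to its norm.\<close>
    show "\<exists>C\<ge>0. \<forall>\<xi>\<in>vecs H. R.nrm (Poly_Mapping.single x \<xi>) \<le> C * nrm \<xi>" for x
    proof -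
      have lin: "linear_on H H (L x x)" using hL by (rule linear_kernel)
      obtain C where C: "C \<ge> 0" "\<And>\<xi>. \<xi> \<in> vecs H \<Longrightarrow> nrm (L x x \<xi>) \<le> C * nrm \<xi>"
        using hL unfolding hermitian_kernel_def bounded_iff by blast
      have "R.nrm (Poly_Mapping.single x \<xi>) \<le> sqrt C * nrm \<xi>" if \<xi>: "\<xi> \<in> vecs H" for \<xi>
      proof -
        have in_H: "L x x \<xi> \<in> vecs H" using lin \<xi> by (simp add: linear_on_def)
        have "Re (r (Poly_Mapping.single x \<xi>) (Poly_Mapping.single x \<xi>)) \<le> Re (ip H (L x x \<xi>) \<xi>)"
          using r(2)[of "Poly_Mapping.single x \<xi>"] \<xi> by (simp add: kernel_ip_single[of L x x, OF lin])
        also have "\<dots> \<le> nrm (L x x \<xi>) * nrm \<xi>"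
          using ip_bound[OF in_H \<xi>] complex_Re_le_cmod order_trans by blast
        also have "\<dots> \<le> C * nrm \<xi> * nrm \<xi>" using C(2)[OF \<xi>] \<xi> by (intro mult_right_mono) auto
        also have "\<dots> = (sqrt C * nrm \<xi>)\<^sup>2"
          unfolding power_mult_distrib real_sqrt_pow2[OF C(1)] by (simp add: power2_eq_square mult.assoc)
        finally have "(R.nrm (Poly_Mapping.single x \<xi>))\<^sup>2 \<le> (sqrt C * nrm \<xi>)\<^sup>2"
          by (simp only: R.nrm_sq[OF finsupp_single[OF \<xi>]])
        moreover have "0 \<le> sqrt C * nrm \<xi>" using C(1) \<xi> by simp
        ultimately show ?thesis by (rule power2_le_imp_le)
      qed
      then show ?thesis using C(1) by (intro exI[of _ "sqrt C"]) auto
    qed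
  qed
  show ?thesis
    unfolding has_reducible_decomposition_def using kolmogorov associated reducible by blast
qed

end

text \<open>The vector type of the Krein space is left arbitrary, so that decompositions on any type
  can be fed in.\<close>

lemma disjoint_of_reducible:
  fixes H :: "'h::ab_group_add ispace" and \<II> :: "'s::monoid_mult \<Rightarrow> 's" and \<alpha> :: "'s \<Rightarrow> 'x \<Rightarrow> complex"
  assumes "krein_pair H gH JH" and nz: "\<And>a x. \<alpha> a x \<noteq> 0" and inv: "phi_invariant H \<II> \<phi> \<alpha> K"
    and red: "has_reducible_decomposition TYPE('k::ab_group_add) H \<phi> \<alpha> K"
  shows "\<exists>Kp Km. pd_kernel H Kp \<and> pd_kernel H Km \<and> disjoint_kernels H Kp Km \<and>
         (\<forall>x y. \<forall>\<xi>\<in>vecs H. K x y \<xi> = Kp x y \<xi> - Km x y \<xi>) \<and>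
         Kp + Km \<in> phi_bounded_pd_kernels H \<phi> \<alpha> \<and>
         phi_invariant H \<II> \<phi> \<alpha> Kp \<and> phi_invariant H \<II> \<phi> \<alpha> Km"
proof -
  obtain E :: "'k ispace" and V U g J where "kolmogorov_decomposition H K E V"
    "associated_representation H \<phi> \<alpha> E V U" "fundamental_pair E g J"
    "\<And>a k. k \<in> vecs E \<Longrightarrow> U a (J k) = J (U a k)"
    using red unfolding has_reducible_decomposition_def fundamentally_reducible_def fundamental_symmetry_def
    by blast
  then interpret reducible_decomposition H gH JH E g J K V U \<II> \<phi> \<alpha>
    using assms by (simp add: reducible_decomposition_def reducible_decomposition_axioms_def
        kernel_space_def krein_pair_def)
  show ?thesis
    using pd_part[of 1] pd_part[of "- 1"] disjoint_parts K_eq_diff bounded_parts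
      invariant_part[of 1] invariant_part[of "- 1"]
    by (intro exI[of _ Kp] exI[of _ Km]) simp
qed

theorem theorem4p3:
  fixes \<II> :: "'s::monoid_mult \<Rightarrow> 's"
    and \<phi> :: "'s \<Rightarrow> 'x \<Rightarrow> 'x"
    and \<alpha> :: "'s \<Rightarrow> 'x \<Rightarrow> complex"
    and H :: "'h::ab_group_add ispace"
    and K :: "('x, 'h) kernel"
  assumes involution: "\<And>a. \<II> (\<II> a) = a" "\<And>a b. \<II> (a * b) = \<II> b * \<II> a"
    and action: "\<And>a b x. \<phi> a (\<phi> b x) = \<phi> (a * b) x" "\<And>x. \<phi> 1 x = x"
    and alpha_nonzero: "\<And>a x. \<alpha> a x \<noteq> 0"
    and alpha_cocycle: "\<And>a b x y. \<alpha> (a * b) x * cnj (\<alpha> (a * b) y) =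
          \<alpha> a (\<phi> b x) * cnj (\<alpha> a (\<phi> b y)) * (\<alpha> b x * cnj (\<alpha> b y))"
    and alpha_unit: "\<And>a x. \<alpha> (a * \<II> a) x = 1"
    and krein: "krein_space H"
    and hermitian: "hermitian_kernel H K"
    and invariant: "phi_invariant H \<II> \<phi> \<alpha> K"
  shows
    "((\<exists>L \<in> phi_bounded_pd_kernels H \<phi> \<alpha>.
         kernel_le H (- L) K \<and> kernel_le H K L \<and> phi_invariant H \<II> \<phi> \<alpha> L)
      \<longleftrightarrow> has_reducible_decomposition TYPE('x \<Rightarrow> 'h) H \<phi> \<alpha> K)
     \<and>
     (has_reducible_decomposition TYPE('x \<Rightarrow> 'h) H \<phi> \<alpha> K
      \<longleftrightarrow>
      (\<exists>Kp Km.
         pd_kernel H Kp \<and> pd_kernel H Km \<and> disjoint_kernels H Kp Km \<and>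
         (\<forall>x y. \<forall>\<xi>\<in>vecs H. K x y \<xi> = Kp x y \<xi> - Km x y \<xi>) \<and>
         Kp + Km \<in> phi_bounded_pd_kernels H \<phi> \<alpha> \<and>
         phi_invariant H \<II> \<phi> \<alpha> Kp \<and> phi_invariant H \<II> \<phi> \<alpha> Km))
     \<and>
     (has_reducible_decomposition TYPE('k::ab_group_add) H \<phi> \<alpha> K
      \<longrightarrow> has_reducible_decomposition TYPE('x \<Rightarrow> 'h) H \<phi> \<alpha> K)"
    (is "(?one \<longleftrightarrow> ?two) \<and> (?two \<longleftrightarrow> ?three) \<and> (?two_k \<longrightarrow> ?two)")
proof -
  obtain gH JH where HJ: "krein_pair H gH JH" using krein by (rule krein_spaceE)
  then interpret kernel_space H gH JH by (simp add: kernel_space_def)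
  have "cocycle_action \<phi> \<alpha>"
    using action(1) alpha_nonzero alpha_cocycle by (simp add: cocycle_action_def)
  then have "?two" if "?one"
    using that reducible_of_majorant[OF _ hermitian invariant] by (elim bexE conjE)
  moreover have "?one" if "?three"
  proof -
    from that obtain Kp Km where pd: "pd_kernel H Kp" "pd_kernel H Km"
      and K: "\<And>x y \<xi>. \<xi> \<in> vecs H \<Longrightarrow> K x y \<xi> = Kp x y \<xi> - Km x y \<xi>"
      and L: "Kp + Km \<in> phi_bounded_pd_kernels H \<phi> \<alpha>"
      and inv: "phi_invariant H \<II> \<phi> \<alpha> Kp" "phi_invariant H \<II> \<phi> \<alpha> Km"
      by (elim exE conjE) simp
    show ?thesis
      using majorant_of_difference[OF pd K inv] L by (intro bexI[of _ "Kp + Km"] conjI)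
  qed
  moreover have "?three" if "?two"
    using that by (rule disjoint_of_reducible[OF HJ alpha_nonzero invariant])
  \<comment> \<open>A decomposition on another vector type thus reaches
    \<open>'x \<Rightarrow> 'h\<close> through the third and the first assertion, instead of being
    embedded directly.\<close>
  moreover have "?three" if "?two_k"
    using that by (rule disjoint_of_reducible[OF HJ alpha_nonzero invariant])
  ultimately show ?thesis by argo
qed

end
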